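(* Let $n\ge0$. The simple modules of the algebra $(\mathcal{D}_n^{(0)},* )$ (hence the vertices of its quiver and the rows and columns of its Cartan matrix) are labelled by the partitions of $n$ with no part equal to $1$, through the idempotents $e_\lambda$. (i) In the quiver of $\mathcal{D}_n^{(0)}$, there is an arrow $\lambda\to\mu$ if and only if $\mu$ is obtained from $\lambda$ by adding two distinct parts (that is, replacing two parts $\lambda_i\neq\lambda_j$ of $\lambda$ by the single part $\lambda_i+\lambda_j$). (ii) The $q$-Cartan invariants of $\mathcal{D}_n^{(0)}$ are given by $$c_{\lambda,\mu}(q)=c_{\lambda,\mu}\,q^{\ell(\lambda)-\ell(\mu)}$$ if $\lambda$ is finer than or equal to $\mu$, and $c_{\lambda,\mu}(q)=0$ otherwise, where $c_{\lambda,\mu}=\dim(e_\mu*\mathcal{D}_n^{(0)}*e_\lambda)$ are the Cartan invariants.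
   Context: $\mathbf{Sym}=\bigoplus_{n\ge0}\mathbf{Sym}_n$ (noncommutative symmetric functions, over $\mathbb{C}$) is the free associative unital algebra on generators $S_1,S_2,\dots$ with $\deg S_n=n$, $S_0=1$. For a composition $I=(i_1,\dots,i_r)$ of $n$, $S^I=S_{i_1}\cdots S_{i_r}$; these form a basis of $\mathbf{Sym}_n$. The internal product $*$ is the bilinear associative product on $\mathbf{Sym}$ with $F*G=0$ if $F,G$ are homogeneous of different degrees, and, for compositions $I,J$ of $n$, $S^I*S^J=\sum_M S^M$, sum over all nonnegative integer matrices $M$ with row sums $I$ and column sums $J$, where $S^M$ is the product of the $S_{m_{ij}}$ read row by row (left to right, top to bottom). Set $S_n^\sharp=\sum_{i=0}^n(-1)^i\frac{S_1^i}{i!}S_{n-i}$ and $\mathcal{D}_n^{(0)}=\{F*S_n^\sharp : F\in\mathbf{Sym}_n\}$, a unital algebra under $*$ with unit $S_n^\sharp$. The Zassenhaus elements $\zeta_n\in\mathbf{Sym}_n$ ($n\ge1$) are defined (in the completion by degree) by $\sum_{n\ge0}S_n=e^{\zeta_1}e^{\zeta_2}e^{\zeta_3}\cdots$. For a partition $\lambda$ with parts written in weakly increasing order $\lambda_1\le\dots\le\lambda_r$, $e_\lambda=\frac{1}{m_\lambda}\zeta_{\lambda_1}\cdots\zeta_{\lambda_r}$, $m_\lambda=\prod_i m_i(\lambda)!$, $m_i(\lambda)$ the multiplicity of the part $i$; the $e_\lambda$ with $\lambda\vdash n$, $1\notin\lambda$, form a complete set of primitive orthogonal idempotents of $\mathcal{D}_n^{(0)}$.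 $\ell(\lambda)$ is the number of parts. $\lambda$ is finer than $\mu$ if the parts of $\lambda$ can be grouped so that the group sums are the parts of $\mu$. The $q$-Cartan invariants are defined by the radical (Loewy) filtration: $c_{\lambda,\mu}(q)=\sum_{k\ge0}q^k\dim\big[(e_\mu*\mathrm{rad}^k\mathcal{D}_n^{(0)}*e_\lambda)/(e_\mu*\mathrm{rad}^{k+1}\mathcal{D}_n^{(0)}*e_\lambda)\big]$, and the number of arrows $\lambda\to\mu$ of the quiver is the coefficient of $q^1$ in $c_{\lambda,\mu}(q)$. *)

theory Defs
  imports
    "HOL-Library.Poly_Mapping"
    "HOL-Library.Multiset"
    "HOL-Computational_Algebra.Formal_Power_Series"
    "HOL-Algebra.Ideal_Product"
    "HOL-Algebra.Module"
begin

section \<open>Noncommutative symmetric functions\<close>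

text \<open>
  Compositions form the free monoid on the positive integers under concatenation. Hence the
  free associative algebra on \<open>S\<^sub>1, S\<^sub>2, \<dots>\<close> is the monoid algebra of compositions, which
  \<^theory>\<open>HOL-Library.Poly_Mapping\<close> provides as a \<^class>\<open>ring_1\<close>.
\<close>

typedef composition = "{I :: nat list. 0 \<notin> set I}"
  morphisms comp_parts Composition
  by (rule exI[of _ "[]"]) simp

lemma comp_parts_nonzero: "0 \<notin> set (comp_parts I)"
  using comp_parts[of I] by simp

lemma comp_parts_Composition [simp]: "0 \<notin> set I \<Longrightarrow> comp_parts (Composition I) = I"
  by (simp add: Composition_inverse)

instantiation composition :: monoid_add
begin

definition "0 = Composition []"

definition "I + J = Composition (comp_parts I @ comp_parts J)"

lemma comp_parts_zero [simp]: "comp_parts 0 = []"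
  by (simp add: zero_composition_def)

lemma comp_parts_plus [simp]: "comp_parts (I + J) = comp_parts I @ comp_parts J"
  by (simp add: plus_composition_def comp_parts_nonzero)

instance
  by standard (simp_all flip: comp_parts_inject)

end

type_synonym nsym = "composition \<Rightarrow>\<^sub>0 complex"

definition nsym_scale :: "complex \<Rightarrow> nsym \<Rightarrow> nsym" where
  "nsym_scale c F = Poly_Mapping.map ((*) c) F"

lemma lookup_nsym_scale [simp]: "Poly_Mapping.lookup (nsym_scale c F) I = c * Poly_Mapping.lookup F I"
  by (cases "Poly_Mapping.lookup F I = 0") (simp_all add: nsym_scale_def Poly_Mapping.map.rep_eq when_def)

text \<open>The homogeneous component of degree \<open>n\<close>.\<close>

definition Sym :: "nat \<Rightarrow> nsym set" where
  "Sym n = {F. \<forall>I\<in>Poly_Mapping.keys F. sum_list (comp_parts I) = n}"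

definition S :: "nat \<Rightarrow> nsym" where
  "S n = (if n = 0 then 1 else Poly_Mapping.single (Composition [n]) 1)"

subsection \<open>The internal product\<close>

text \<open>
  Matrices are lists of rows. A matrix with row sums \<open>I\<close> and column sums \<open>J\<close> exists only if
  \<open>I\<close> and \<open>J\<close> have the same weight, so different degrees multiply to \<open>0\<close> below.
\<close>

definition matrices :: "nat list \<Rightarrow> nat list \<Rightarrow> nat list list set" where
  "matrices I J =
     {M. length M = length I \<and> (\<forall>row\<in>set M. length row = length J) \<and>
         (\<forall>i<length I. (\<Sum>j<length J. M ! i ! j) = I ! i) \<and>
         (\<forall>j<length J. (\<Sum>i<length I. M ! i ! j) = J ! j)}"

definition S_matrix :: "nat list list \<Rightarrow> nsym" where
  "S_matrix M = prod_list (map S (concat M))"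

definition internal_prod :: "nsym \<Rightarrow> nsym \<Rightarrow> nsym"  (infixl \<open>\<star>\<close> 70) where
  "F \<star> G = (\<Sum>I\<in>Poly_Mapping.keys F. \<Sum>J\<in>Poly_Mapping.keys G.
     nsym_scale (Poly_Mapping.lookup F I * Poly_Mapping.lookup G J) (\<Sum>M\<in>matrices (comp_parts I) (comp_parts J). S_matrix M))"

definition S_sharp :: "nat \<Rightarrow> nsym" where
  "S_sharp n = (\<Sum>i\<le>n. nsym_scale ((-1) ^ i / fact i) (S 1 ^ i * S (n - i)))"

definition D0 :: "nat \<Rightarrow> nsym ring" where
  "D0 n = \<lparr>carrier = {F \<star> S_sharp n |F. F \<in> Sym n}, mult = (\<star>), one = S_sharp n,
           zero = 0, add = (+)\<rparr>"

subsection \<open>Zassenhaus elements\<close>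

text \<open>
  An element \<open>\<Sum>n. F n\<close> of the completion of the graded algebra by degree, with \<open>F n\<close>
  homogeneous of degree \<open>n\<close>, is represented by the power series with coefficients \<open>F n\<close>
  in a central variable that records the degree. The topology of \<^typ>\<open>nsym fps\<close> is the one of
  that completion: convergence means that every coefficient is eventually constant.
\<close>

definition cexp :: "nsym fps \<Rightarrow> nsym fps" where
  "cexp f = suminf (\<lambda>k. fps_const (nsym_scale (1 / fact k) 1) * f ^ k)"

definition zassenhaus_prod :: "(nat \<Rightarrow> nsym) \<Rightarrow> nat \<Rightarrow> nsym fps" where
  "zassenhaus_prod z N = prod_list (map (\<lambda>i. cexp (fps_const (z i) * fps_X ^ i)) [1..<Suc N])"

text \<open>The value at index \<open>0\<close> is a junk value.\<close>

definition is_zassenhaus :: "(nat \<Rightarrow> nsym) \<Rightarrow> bool" where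
  "is_zassenhaus z \<longleftrightarrow>
     z 0 = 0 \<and> (\<forall>i\<ge>1. z i \<in> Sym i) \<and> zassenhaus_prod z \<longlonglongrightarrow> Abs_fps S"

definition zeta :: "nat \<Rightarrow> nsym" where
  "zeta = (THE z. is_zassenhaus z)"

subsubsection \<open>The Zassenhaus elements are well defined\<close>

lemma nsym_scale_one_mult [simp]: "nsym_scale c 1 * F = nsym_scale c F"
proof -
  have *: "nsym_scale c 1 = Poly_Mapping.single 0 c"
    by (rule poly_mapping_eqI) (simp add: lookup_one lookup_single when_def)
  have "Poly_Mapping.single 0 c * F = nsym_scale c F"
  proof (induction F rule: update_induct)
    case const
    show ?case by (rule poly_mapping_eqI) simp
  next
    case (update F k d)
    have eq: "Poly_Mapping.update k d F = F + Poly_Mapping.single k d"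
    proof (rule poly_mapping_eqI)
      fix l
      show "Poly_Mapping.lookup (Poly_Mapping.update k d F) l
            = Poly_Mapping.lookup (F + Poly_Mapping.single k d) l"
        using update(1)
        by (auto simp: lookup_update lookup_add lookup_single when_def in_keys_iff)
    qed
    have "Poly_Mapping.single 0 c * Poly_Mapping.update k d F
          = nsym_scale c F + Poly_Mapping.single k (c * d)"
      unfolding eq by (simp add: distrib_left update.IH mult_single)
    also have "\<dots> = nsym_scale c (Poly_Mapping.update k d F)"
      unfolding eq
      by (rule poly_mapping_eqI) (simp add: lookup_add lookup_single when_def distrib_left)
    finally show ?case .
  qed
  then show ?thesis unfolding * .
qed

lemma Sym_zero: "0 \<in> Sym n"
  by (simp add: Sym_def)

lemma Sym_add: "F \<in> Sym n \<Longrightarrow> G \<in> Sym n \<Longrightarrow> F + G \<in> Sym n"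
  using Poly_Mapping.keys_add[of F G] by (auto simp: Sym_def)

lemma Sym_uminus: "F \<in> Sym n \<Longrightarrow> - F \<in> Sym n"
  by (auto simp: Sym_def in_keys_iff)

lemma Sym_scale: "F \<in> Sym n \<Longrightarrow> nsym_scale c F \<in> Sym n"
  by (auto simp: Sym_def in_keys_iff)

lemma Sym_sum: "(\<And>x. x \<in> A \<Longrightarrow> f x \<in> Sym n) \<Longrightarrow> sum f A \<in> Sym n"
  by (induction A rule: infinite_finite_induct) (auto simp: Sym_zero Sym_add)

lemma Sym_mult: "F \<in> Sym m \<Longrightarrow> G \<in> Sym n \<Longrightarrow> F * G \<in> Sym (m + n)"
  using keys_mult[of F G] by (fastforce simp: Sym_def)

lemma Sym_one: "1 \<in> Sym 0"
  by (auto simp: Sym_def in_keys_iff lookup_one when_def split: if_splits)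

lemma Sym_S: "S n \<in> Sym n"
  by (auto simp: S_def Sym_one) (auto simp: Sym_def)

definition graded :: "nsym fps \<Rightarrow> bool" where
  "graded f \<longleftrightarrow> (\<forall>m. fps_nth f m \<in> Sym m)"

lemma graded_mult: "graded f \<Longrightarrow> graded g \<Longrightarrow> graded (f * g)"
  unfolding graded_def fps_mult_nth
  by (intro allI Sym_sum) (metis Sym_mult atLeastAtMost_iff le_add_diff_inverse)

lemma graded_one: "graded 1"
  by (auto simp: graded_def Sym_one Sym_zero)

lemma graded_power: "graded f \<Longrightarrow> graded (f ^ k)"
  by (induction k) (auto intro: graded_one graded_mult)

lemma fps_power_nth_eq_0:
  fixes f :: "'a :: ring_1 fps"
  assumes "\<And>m. m < i \<Longrightarrow> fps_nth f m = 0" and "m < k * i"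
  shows "fps_nth (f ^ k) m = 0"
  using assms(2)
proof (induction k arbitrary: m)
  case (Suc k)
  have "fps_nth f j * fps_nth (f ^ k) (m - j) = 0" if "j \<le> m" for j
  proof (cases "j < i")
    case False
    then have "m - j < k * i" using Suc.prems that by auto
    then show ?thesis using Suc.IH by simp
  qed (simp add: assms(1))
  then show ?case by (simp add: fps_mult_nth)
qed simp

lemma cexp_nth:
  assumes "fps_nth f 0 = 0"
  shows "fps_nth (cexp f) m = (\<Sum>k\<le>m. nsym_scale (1 / fact k) (fps_nth (f ^ k) m))"
proof -
  let ?g = "\<lambda>k. fps_const (nsym_scale (1 / fact k) 1) * f ^ k"
  let ?h = "Abs_fps (\<lambda>m. \<Sum>k\<le>m. nsym_scale (1 / fact k) (fps_nth (f ^ k) m))"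
  have "?g sums ?h"
    unfolding sums_def
  proof (rule tendsto_fpsI)
    fix m
    have "fps_nth (sum ?g {..<N}) m = fps_nth ?h m" if "N > m" for N
    proof -
      have "fps_nth (sum ?g {..<N}) m
            = (\<Sum>k<N. nsym_scale (1 / fact k) (fps_nth (f ^ k) m))"
        by (simp add: fps_sum_nth)
      also have "\<dots> = (\<Sum>k\<le>m. nsym_scale (1 / fact k) (fps_nth (f ^ k) m))"
      proof (rule sum.mono_neutral_right)
        show "\<forall>k\<in>{..<N} - {..m}. nsym_scale (1 / fact k) (fps_nth (f ^ k) m) = 0"
        proof
          fix k assume "k \<in> {..<N} - {..m}"
          then have "fps_nth (f ^ k) m = 0"
            using fps_power_nth_eq_0[of 1 f m k] assms by auto
          then show "nsym_scale (1 / fact k) (fps_nth (f ^ k) m) = 0"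
            by (intro poly_mapping_eqI) simp
        qed
      qed (use that in auto)
      finally show ?thesis by simp
    qed
    then show "\<forall>\<^sub>F N in sequentially. fps_nth (sum ?g {..<N}) m = fps_nth ?h m"
      by (rule eventually_mono[OF eventually_gt_at_top[of m]])
  qed
  then have "cexp f = ?h"
    unfolding cexp_def by (rule sums_unique[symmetric])
  then show ?thesis by simp
qed

lemma graded_cexp: "graded f \<Longrightarrow> fps_nth f 0 = 0 \<Longrightarrow> graded (cexp f)"
  using graded_power[of f] by (auto simp: graded_def cexp_nth intro!: Sym_sum Sym_scale)

lemma zeta_term_nth: "fps_nth (fps_const (a :: nsym) * fps_X ^ i) m = (if m = i then a else 0)"
  by simp

lemma cexp_zeta_term_nth:
  assumes "i \<ge> 1" "m \<le> i"
  shows "fps_nth (cexp (fps_const a * fps_X ^ i)) m = (if m = 0 then 1 else if m = i then a else 0)"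
proof -
  let ?f = "fps_const a * fps_X ^ i"
  let ?t = "\<lambda>k. nsym_scale (1 / fact k) (fps_nth (?f ^ k) m)"
  have one: "nsym_scale 1 F = F" and zero: "nsym_scale c 0 = 0" for F c
    by (rule poly_mapping_eqI; simp)+
  have f0: "fps_nth ?f 0 = 0" using assms by simp
  show ?thesis
  proof (cases "m = 0")
    case True
    then show ?thesis by (simp add: cexp_nth[OF f0] one)
  next
    case False
    have "?t k = 0" if "k \<noteq> 1" for k
    proof (cases "k = 0")
      case False
      then have "2 * i \<le> k * i" using that by (intro mult_right_mono) auto
      then have "m < k * i" using assms by linarith
      then have "fps_nth (?f ^ k) m = 0"
        by (intro fps_power_nth_eq_0) auto
      then show ?thesis by (simp add: zero)
    qed (use \<open>m \<noteq> 0\<close> in \<open>simp add: zero\<close>)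
    then have "(\<Sum>k\<le>m. ?t k) = (\<Sum>k\<in>{1}. ?t k)"
      using False by (intro sum.mono_neutral_right) auto
    also have "\<dots> = (if m = i then a else 0)" by (simp add: one)
    finally show ?thesis using False by (simp add: cexp_nth[OF f0])
  qed
qed

lemma zassenhaus_prod_0: "zassenhaus_prod z 0 = 1"
  by (simp add: zassenhaus_prod_def)

lemma zassenhaus_prod_Suc:
  "zassenhaus_prod z (Suc N)
   = zassenhaus_prod z N * cexp (fps_const (z (Suc N)) * fps_X ^ Suc N)"
  by (simp add: zassenhaus_prod_def del: power_Suc)

lemma zassenhaus_prod_cong:
  assumes "\<And>i. 1 \<le> i \<Longrightarrow> i \<le> N \<Longrightarrow> z i = w i"
  shows "zassenhaus_prod z N = zassenhaus_prod w N"
  using assms by (induction N) (auto simp: zassenhaus_prod_0 zassenhaus_prod_Suc)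

lemma graded_zassenhaus_prod:
  assumes "\<And>i. 1 \<le> i \<Longrightarrow> i \<le> N \<Longrightarrow> z i \<in> Sym i"
  shows "graded (zassenhaus_prod z N)"
  using assms
proof (induction N)
  case (Suc N)
  have *: "graded (fps_const (z (Suc N)) * fps_X ^ Suc N)"
    using Suc.prems unfolding graded_def zeta_term_nth by (auto simp: Sym_zero)
  show ?case
    unfolding zassenhaus_prod_Suc
    by (rule graded_mult[OF Suc.IH graded_cexp[OF *]]) (use Suc.prems in \<open>auto simp del: power_Suc\<close>)
qed (simp add: zassenhaus_prod_0 graded_one)

lemma zassenhaus_prod_Suc_nth:
  assumes "m \<le> Suc N"
  shows "fps_nth (zassenhaus_prod z (Suc N)) m
         = fps_nth (zassenhaus_prod z N) m
           + (if m = Suc N then fps_nth (zassenhaus_prod z N) 0 * z (Suc N) else 0)"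
proof -
  let ?E = "cexp (fps_const (z (Suc N)) * fps_X ^ Suc N)"
  let ?P = "zassenhaus_prod z N"
  have E: "fps_nth ?E (m - j) = (if j = m then 1 else 0) + (if j = 0 \<and> m = Suc N then z (Suc N) else 0)"
    if "j \<le> m" for j
    using cexp_zeta_term_nth[of "Suc N" "m - j" "z (Suc N)"] assms that by auto
  have "fps_nth (?P * ?E) m = (\<Sum>j=0..m. fps_nth ?P j * fps_nth ?E (m - j))"
    by (rule fps_mult_nth)
  also have "\<dots> = (\<Sum>j=0..m. (if j = m then fps_nth ?P j else 0)
        + (if j = 0 then if m = Suc N then fps_nth ?P j * z (Suc N) else 0 else 0))"
  proof (rule sum.cong[OF refl])
    fix j assume "j \<in> {0..m}"
    then have "j \<le> m" by simp
    show "fps_nth ?P j * fps_nth ?E (m - j) = (if j = m then fps_nth ?P j else 0)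
        + (if j = 0 then if m = Suc N then fps_nth ?P j * z (Suc N) else 0 else 0)"
      unfolding E[OF \<open>j \<le> m\<close>] by (simp add: distrib_left)
  qed
  also have "\<dots> = fps_nth ?P m + (if m = Suc N then fps_nth ?P 0 * z (Suc N) else 0)"
    unfolding sum.distrib by (subst (1 2) sum.delta) auto
  finally show ?thesis by (simp add: zassenhaus_prod_Suc del: power_Suc)
qed

lemma zassenhaus_prod_nth_0: "fps_nth (zassenhaus_prod z N) 0 = 1"
  by (induction N) (simp_all add: zassenhaus_prod_0 zassenhaus_prod_Suc_nth)

lemma zassenhaus_prod_stable:
  "m \<le> N \<Longrightarrow> fps_nth (zassenhaus_prod z N) m = fps_nth (zassenhaus_prod z m) m"
  by (induction N rule: dec_induct) (auto simp: zassenhaus_prod_Suc_nth)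

text \<open>The defining equation determines the Zassenhaus elements degree by degree.\<close>

lemma is_zassenhaus_iff:
  "is_zassenhaus z \<longleftrightarrow>
     z 0 = 0 \<and> (\<forall>i\<ge>1. z i \<in> Sym i) \<and>
     (\<forall>m. z (Suc m) = S (Suc m) - fps_nth (zassenhaus_prod z m) (Suc m))"
proof -
  have ev: "(\<forall>\<^sub>F N in sequentially. fps_nth (zassenhaus_prod z N) m = S m)
        \<longleftrightarrow> fps_nth (zassenhaus_prod z m) m = S m" for m
  proof -
    have "\<forall>\<^sub>F N in sequentially. (fps_nth (zassenhaus_prod z N) m = S m
            \<longleftrightarrow> fps_nth (zassenhaus_prod z m) m = S m)"
    proof (rule eventually_mono[OF eventually_ge_at_top[of m]])
      fix N assume "m \<le> N"
      from zassenhaus_prod_stable[OF this, of z]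
      show "fps_nth (zassenhaus_prod z N) m = S m \<longleftrightarrow> fps_nth (zassenhaus_prod z m) m = S m"
        by (rule arg_cong)
    qed
    then have "(\<forall>\<^sub>F N in sequentially. fps_nth (zassenhaus_prod z N) m = S m)
        \<longleftrightarrow> (\<forall>\<^sub>F N in sequentially. fps_nth (zassenhaus_prod z m) m = S m)"
      by (rule eventually_subst)
    then show ?thesis by simp
  qed
  have step: "fps_nth (zassenhaus_prod z (Suc m)) (Suc m) = S (Suc m)
        \<longleftrightarrow> z (Suc m) = S (Suc m) - fps_nth (zassenhaus_prod z m) (Suc m)" for m
    unfolding zassenhaus_prod_Suc_nth[OF order.refl] zassenhaus_prod_nth_0 eq_diff_eq
    by (simp add: add.commute)
  have "(\<forall>m. fps_nth (zassenhaus_prod z m) m = S m)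
        \<longleftrightarrow> (\<forall>m. fps_nth (zassenhaus_prod z (Suc m)) (Suc m) = S (Suc m))" (is "?L \<longleftrightarrow> ?R")
  proof
    assume R: ?R
    show ?L
    proof
      fix m show "fps_nth (zassenhaus_prod z m) m = S m"
      proof (cases m)
        case 0
        then show ?thesis unfolding 0 zassenhaus_prod_nth_0 S_def by simp
      next
        case (Suc k)
        show ?thesis unfolding Suc using R by blast
      qed
    qed
  qed blast
  then show ?thesis
    unfolding is_zassenhaus_def tendsto_fps_iff fps_nth_Abs_fps ev step by simp
qed

fun zeta_rec :: "nat \<Rightarrow> nsym" where
  "zeta_rec 0 = 0"
| "zeta_rec (Suc m) =
     S (Suc m) - fps_nth (zassenhaus_prod (\<lambda>i. if i \<le> m then zeta_rec i else 0) m) (Suc m)"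

lemma zeta_rec_Suc:
  "zeta_rec (Suc m) = S (Suc m) - fps_nth (zassenhaus_prod zeta_rec m) (Suc m)"
proof -
  have "zassenhaus_prod (\<lambda>i. if i \<le> m then zeta_rec i else 0) m = zassenhaus_prod zeta_rec m"
    by (rule zassenhaus_prod_cong) simp
  then show ?thesis by simp
qed

lemma zeta_rec_Sym: "zeta_rec n \<in> Sym n"
proof (induction n rule: less_induct)
  case (less n)
  show ?case
  proof (cases n)
    case (Suc m)
    have "graded (zassenhaus_prod zeta_rec m)"
      by (rule graded_zassenhaus_prod) (use less Suc in auto)
    then have "fps_nth (zassenhaus_prod zeta_rec m) (Suc m) \<in> Sym (Suc m)"
      by (simp add: graded_def)
    then have "S (Suc m) + - fps_nth (zassenhaus_prod zeta_rec m) (Suc m) \<in> Sym (Suc m)"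
      by (intro Sym_add Sym_S Sym_uminus)
    then show ?thesis
      unfolding Suc zeta_rec_Suc by simp
  qed (simp add: Sym_zero)
qed

lemma ex1_zassenhaus: "\<exists>!z. is_zassenhaus z"
proof
  show "is_zassenhaus zeta_rec"
    using zeta_rec_Suc by (auto simp: is_zassenhaus_iff zeta_rec_Sym simp del: zeta_rec.simps(2))
next
  fix z assume z: "is_zassenhaus z"
  have "z n = zeta_rec n" for n
  proof (induction n rule: less_induct)
    case (less n)
    show ?case
    proof (cases n)
      case 0
      then show ?thesis using z by (simp add: is_zassenhaus_iff)
    next
      case (Suc m)
      have "zassenhaus_prod z m = zassenhaus_prod zeta_rec m"
        by (rule zassenhaus_prod_cong) (use less Suc in auto)
      then show ?thesis
        using z zeta_rec_Suc unfolding Suc is_zassenhaus_iff by metis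
    qed
  qed
  then show "z = zeta_rec" by blast
qed

lemma is_zassenhaus_zeta: "is_zassenhaus zeta"
  unfolding zeta_def by (rule theI'[OF ex1_zassenhaus])

subsection \<open>Partitions and the idempotents\<close>

definition partitions_no1 :: "nat \<Rightarrow> nat multiset set" where
  "partitions_no1 n = {\<nu>. sum_mset \<nu> = n \<and> 0 \<notin># \<nu> \<and> 1 \<notin># \<nu>}"

definition e_idem :: "nat multiset \<Rightarrow> nsym" where
  "e_idem \<nu> = nsym_scale (1 / (\<Prod>i\<in>set_mset \<nu>. fact (count \<nu> i)))
                (prod_list (map zeta (sorted_list_of_multiset \<nu>)))"

text \<open>The blocks in \<open>P\<close> are nonempty as soon as \<open>\<mu>\<close> has no part \<open>0\<close>.\<close>

definition finer :: "nat multiset \<Rightarrow> nat multiset \<Rightarrow> bool" where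
  "finer \<nu> \<mu> \<longleftrightarrow> (\<exists>P :: nat multiset multiset. \<Sum>\<^sub># P = \<nu> \<and> image_mset sum_mset P = \<mu>)"

definition adds_two_distinct_parts :: "nat multiset \<Rightarrow> nat multiset \<Rightarrow> bool" where
  "adds_two_distinct_parts \<nu> \<mu> \<longleftrightarrow>
     (\<exists>i j. i \<noteq> j \<and> {#i, j#} \<subseteq># \<nu> \<and> \<mu> = \<nu> - {#i, j#} + {#i + j#})"

section \<open>Modules over a noncommutative ring\<close>

text \<open>
  The locale \<^locale>\<open>Module.module\<close> demands a commutative ring, but its record and the locale
  \<^locale>\<open>submodule\<close> do not. In the modules constructed below the ring fields
  \<^const>\<open>monoid.mult\<close> and \<^const>\<open>monoid.one\<close> of the record are meaningless.
\<close>

locale left_module = R?: ring R + M?: abelian_group M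
  for R :: "('a, 'c) ring_scheme" (structure) and M :: "('a, 'b, 'd) module_scheme" (structure) +
  assumes smult_closed:
      "\<lbrakk>a \<in> carrier R; x \<in> carrier M\<rbrakk> \<Longrightarrow> a \<odot>\<^bsub>M\<^esub> x \<in> carrier M"
    and smult_l_distr:
      "\<lbrakk>a \<in> carrier R; b \<in> carrier R; x \<in> carrier M\<rbrakk> \<Longrightarrow>
         (a \<oplus>\<^bsub>R\<^esub> b) \<odot>\<^bsub>M\<^esub> x = a \<odot>\<^bsub>M\<^esub> x \<oplus>\<^bsub>M\<^esub> b \<odot>\<^bsub>M\<^esub> x"
    and smult_r_distr:
      "\<lbrakk>a \<in> carrier R; x \<in> carrier M; y \<in> carrier M\<rbrakk> \<Longrightarrow>
         a \<odot>\<^bsub>M\<^esub> (x \<oplus>\<^bsub>M\<^esub> y) = a \<odot>\<^bsub>M\<^esub> x \<oplus>\<^bsub>M\<^esub> a \<odot>\<^bsub>M\<^esub> y"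
    and smult_assoc:
      "\<lbrakk>a \<in> carrier R; b \<in> carrier R; x \<in> carrier M\<rbrakk> \<Longrightarrow>
         (a \<otimes>\<^bsub>R\<^esub> b) \<odot>\<^bsub>M\<^esub> x = a \<odot>\<^bsub>M\<^esub> (b \<odot>\<^bsub>M\<^esub> x)"
    and smult_one:
      "x \<in> carrier M \<Longrightarrow> \<one>\<^bsub>R\<^esub> \<odot>\<^bsub>M\<^esub> x = x"

definition simple_module :: "('a, 'c) ring_scheme \<Rightarrow> ('a, 'b) module \<Rightarrow> bool" where
  "simple_module R M \<longleftrightarrow> left_module R M \<and> carrier M \<noteq> {\<zero>\<^bsub>M\<^esub>} \<and>
     (\<forall>N. submodule N R M \<longrightarrow> N = {\<zero>\<^bsub>M\<^esub>} \<or> N = carrier M)"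

definition module_iso :: "('a, 'c) ring_scheme \<Rightarrow> ('a, 'b) module \<Rightarrow> ('a, 'd) module \<Rightarrow> bool" where
  "module_iso R M N \<longleftrightarrow> (\<exists>f. bij_betw f (carrier M) (carrier N) \<and>
     (\<forall>x\<in>carrier M. \<forall>y\<in>carrier M. f (x \<oplus>\<^bsub>M\<^esub> y) = f x \<oplus>\<^bsub>N\<^esub> f y) \<and>
     (\<forall>a\<in>carrier R. \<forall>x\<in>carrier M. f (a \<odot>\<^bsub>M\<^esub> x) = a \<odot>\<^bsub>N\<^esub> f x))"

definition quotient_module ::
  "('a, 'c) ring_scheme \<Rightarrow> ('a, 'b) module \<Rightarrow> 'b set \<Rightarrow> ('a, 'b set) module" where
  "quotient_module R M N =
     \<lparr>carrier = a_rcosets\<^bsub>M\<^esub> N, mult = undefined, one = undefined,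
      zero = N, add = set_add M, smult = (\<lambda>a X. \<Union>x\<in>X. N +>\<^bsub>M\<^esub> (a \<odot>\<^bsub>M\<^esub> x))\<rparr>"

definition principal_module :: "('a, 'c) ring_scheme \<Rightarrow> 'a \<Rightarrow> ('a, 'a) module" where
  "principal_module R e =
     \<lparr>carrier = (\<lambda>x. x \<otimes>\<^bsub>R\<^esub> e) ` carrier R, mult = undefined, one = undefined,
      zero = \<zero>\<^bsub>R\<^esub>, add = add R, smult = mult R\<rparr>"

definition left_ideal :: "'a set \<Rightarrow> ('a, 'c) ring_scheme \<Rightarrow> bool" where
  "left_ideal I R \<longleftrightarrow>
     additive_subgroup I R \<and> (\<forall>a\<in>carrier R. \<forall>x\<in>I. a \<otimes>\<^bsub>R\<^esub> x \<in> I)"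

definition maximal_left_ideal :: "'a set \<Rightarrow> ('a, 'c) ring_scheme \<Rightarrow> bool" where
  "maximal_left_ideal I R \<longleftrightarrow> left_ideal I R \<and> I \<noteq> carrier R \<and>
     (\<forall>J. left_ideal J R \<and> I \<subseteq> J \<longrightarrow> J = I \<or> J = carrier R)"

text \<open>
  Intersecting with the carrier only matters for the zero ring, which has no maximal left ideal
  (this occurs: \<^term>\<open>D0 1\<close> is zero).
\<close>

definition jacobson_radical :: "('a, 'c) ring_scheme \<Rightarrow> 'a set" where
  "jacobson_radical R = carrier R \<inter> \<Inter>{I. maximal_left_ideal I R}"

primrec rad_power :: "('a, 'c) ring_scheme \<Rightarrow> nat \<Rightarrow> 'a set" where
  "rad_power R 0 = carrier R"
| "rad_power R (Suc k) = ideal_prod R (rad_power R k) (jacobson_radical R)"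

text \<open>The simple top \<open>Re / (rad R)e\<close> of the projective module \<open>Re\<close>.\<close>

definition top_module :: "('a, 'c) ring_scheme \<Rightarrow> 'a \<Rightarrow> ('a, 'a set) module" where
  "top_module R e =
     quotient_module R (principal_module R e) ((\<lambda>x. x \<otimes>\<^bsub>R\<^esub> e) ` jacobson_radical R)"

section \<open>Dimension of a quotient space\<close>

interpretation nsym: vector_space nsym_scale
  by standard (auto intro!: poly_mapping_eqI simp: lookup_add algebra_simps)

text \<open>The classes modulo \<open>W\<close> of the elements of \<open>B\<close> form a finite basis of \<open>V / W\<close>.\<close>

definition basis_mod :: "nsym set \<Rightarrow> nsym set \<Rightarrow> nsym set \<Rightarrow> bool" where
  "basis_mod V W B \<longleftrightarrow> finite B \<and> B \<subseteq> V \<and>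
     (\<forall>v\<in>V. \<exists>!c. (\<forall>b. b \<notin> B \<longrightarrow> c b = 0) \<and> v - (\<Sum>b\<in>B. nsym_scale (c b) b) \<in> W)"

definition quotient_dim :: "nsym set \<Rightarrow> nsym set \<Rightarrow> nat" where
  "quotient_dim V W = (THE d. \<exists>B. basis_mod V W B \<and> card B = d)"

lemma basis_modD:
  "basis_mod V W B \<Longrightarrow> v \<in> V \<Longrightarrow>
     \<exists>!c. (\<forall>b. b \<notin> B \<longrightarrow> c b = 0) \<and> v - (\<Sum>b\<in>B. nsym_scale (c b) b) \<in> W"
  by (simp add: basis_mod_def)

lemma basis_mod_Un:
  assumes V: "nsym.subspace V" and W: "nsym.subspace W" "W \<subseteq> V"
    and B: "basis_mod V W B" and C: "C \<subseteq> W" "nsym.independent C" "W \<subseteq> nsym.span C" "finite C"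
  shows "B \<inter> C = {}" "nsym.independent (B \<union> C)" "nsym.span (B \<union> C) = V"
proof -
  have B': "finite B" "B \<subseteq> V" using B by (auto simp: basis_mod_def)
  have uniq: "c b = 0" if "(\<Sum>b\<in>B. nsym_scale (c b) b) \<in> W" "b \<in> B" for c b
  proof -
    define P where
      "P c \<longleftrightarrow> (\<forall>b. b \<notin> B \<longrightarrow> c b = 0) \<and> 0 - (\<Sum>b\<in>B. nsym_scale (c b) b) \<in> W" for c
    define d where "d = (\<lambda>b. if b \<in> B then c b else 0)"
    have "(\<Sum>b\<in>B. nsym_scale (d b) b) = (\<Sum>b\<in>B. nsym_scale (c b) b)"
      by (rule sum.cong) (auto simp: d_def)
    then have "P d"
      using that(1) nsym.subspace_neg[OF W(1)] by (simp add: P_def d_def)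
    moreover have "P (\<lambda>_. 0)"
      using nsym.subspace_0[OF W(1)] by (simp add: P_def)
    moreover have "\<exists>!c. P c"
      unfolding P_def by (rule basis_modD[OF B nsym.subspace_0[OF V]])
    ultimately have "d = (\<lambda>_. 0)"
      by blast
    from fun_cong[OF this, of b] show ?thesis using that(2) by (simp add: d_def)
  qed
  show disj: "B \<inter> C = {}"
  proof (rule ccontr)
    assume "B \<inter> C \<noteq> {}"
    then obtain b where b: "b \<in> B" "b \<in> C" by blast
    define \<delta> :: "nsym \<Rightarrow> complex" where "\<delta> x = (if x = b then 1 else 0)" for x
    have "(\<Sum>x\<in>B. nsym_scale (\<delta> x) x) = (\<Sum>x\<in>B. if x = b then b else 0)"
      by (rule sum.cong) (auto simp: \<delta>_def)
    also have "\<dots> = b" using b B' by simp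
    also have "b \<in> W" using b C(1) by blast
    finally have "\<delta> b = 0" by (rule uniq[where c = \<delta>, OF _ b(1)])
    then show False by (simp add: \<delta>_def)
  qed
  show "nsym.independent (B \<union> C)"
  proof (rule nsym.independent_if_scalars_zero)
    show "finite (B \<union> C)" using B' C by simp
    fix f x assume "(\<Sum>x\<in>B \<union> C. nsym_scale (f x) x) = 0" and x: "x \<in> B \<union> C"
    then have eq: "(\<Sum>x\<in>B. nsym_scale (f x) x) + (\<Sum>x\<in>C. nsym_scale (f x) x) = 0"
      using disj B' C(4) by (simp add: sum.union_disjoint)
    have "(\<Sum>x\<in>C. nsym_scale (f x) x) \<in> W"
      using C(1) by (intro nsym.subspace_sum[OF W(1)] nsym.subspace_scale[OF W(1)]) auto
    then have "- (\<Sum>x\<in>C. nsym_scale (f x) x) \<in> W" by (rule nsym.subspace_neg[OF W(1)])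
    then have "(\<Sum>x\<in>B. nsym_scale (f x) x) \<in> W"
      unfolding eq_neg_iff_add_eq_0[THEN iffD2, OF eq] .
    then have fB: "f b = 0" if "b \<in> B" for b by (rule uniq[where c = f, OF _ that])
    then have "(\<Sum>x\<in>B. nsym_scale (f x) x) = 0" by (intro sum.neutral) simp
    then have 0: "(\<Sum>x\<in>C. nsym_scale (f x) x) = 0" using eq by simp
    have "f c = 0" if "c \<in> C" for c
      by (rule nsym.independentD[where u = f, OF C(2) C(4) order.refl 0 that])
    then show "f x = 0" using fB x by blast
  qed
  show "nsym.span (B \<union> C) = V"
  proof
    show "nsym.span (B \<union> C) \<subseteq> V" using B' C W by (intro nsym.span_minimal V) auto
    show "V \<subseteq> nsym.span (B \<union> C)"
    proof
      fix v assume v: "v \<in> V"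
      from ex1_implies_ex[OF basis_modD[OF B v]]
      obtain c where "v - (\<Sum>b\<in>B. nsym_scale (c b) b) \<in> W" by (elim exE conjE)
      then have "v - (\<Sum>b\<in>B. nsym_scale (c b) b) \<in> nsym.span (B \<union> C)"
        using C(3) nsym.span_mono[of C "B \<union> C"] by blast
      moreover have "(\<Sum>b\<in>B. nsym_scale (c b) b) \<in> nsym.span (B \<union> C)"
        by (intro nsym.span_sum nsym.span_scale nsym.span_base) auto
      ultimately have "(v - (\<Sum>b\<in>B. nsym_scale (c b) b)) + (\<Sum>b\<in>B. nsym_scale (c b) b)
          \<in> nsym.span (B \<union> C)"
        by (rule nsym.span_add)
      then show "v \<in> nsym.span (B \<union> C)" by simp
    qed
  qed
qed

lemma basis_mod_exists:
  assumes V: "nsym.subspace V" and W: "nsym.subspace W" "W \<subseteq> V" and fin: "finite T" "V \<subseteq> nsym.span T"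
  shows "\<exists>B. basis_mod V W B"
proof -
  obtain C where C: "C \<subseteq> W" "nsym.independent C" "W \<subseteq> nsym.span C" by (rule nsym.basis_exists)
  obtain E where E: "C \<subseteq> E" "E \<subseteq> V" "nsym.independent E" "V \<subseteq> nsym.span E"
    using nsym.maximal_independent_subset_extend[of C V] C W by blast
  have finE: "finite E" using nsym.independent_span_bound[OF fin(1) E(3)] E fin by blast
  let ?B = "E - C"
  have "\<exists>!c. (\<forall>b. b \<notin> ?B \<longrightarrow> c b = 0) \<and> v - (\<Sum>b\<in>?B. nsym_scale (c b) b) \<in> W" if "v \<in> V" for v
  proof (rule ex_ex1I)
    from subsetD[OF E(4) that] obtain u where u: "v = (\<Sum>x\<in>E. nsym_scale (u x) x)"
      unfolding nsym.span_finite[OF finE] by (elim rangeE)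
    define c where "c x = (if x \<in> ?B then u x else 0)" for x
    have "v = (\<Sum>x\<in>?B. nsym_scale (u x) x) + (\<Sum>x\<in>C. nsym_scale (u x) x)"
      unfolding u by (rule sum.subset_diff[OF E(1) finE])
    moreover have "(\<Sum>x\<in>?B. nsym_scale (c x) x) = (\<Sum>x\<in>?B. nsym_scale (u x) x)"
      by (rule sum.cong) (auto simp: c_def)
    ultimately have "v - (\<Sum>x\<in>?B. nsym_scale (c x) x) = (\<Sum>x\<in>C. nsym_scale (u x) x)"
      by simp
    also have "\<dots> \<in> W"
      using C(1) by (intro nsym.subspace_sum[OF W(1)] nsym.subspace_scale[OF W(1)]) auto
    finally have "v - (\<Sum>x\<in>?B. nsym_scale (c x) x) \<in> W" .
    moreover have "\<forall>b. b \<notin> ?B \<longrightarrow> c b = 0" by (simp add: c_def)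
    ultimately show "\<exists>c. (\<forall>b. b \<notin> ?B \<longrightarrow> c b = 0) \<and> v - (\<Sum>b\<in>?B. nsym_scale (c b) b) \<in> W"
      by (intro exI[of _ c] conjI)
  next
    fix c d
    assume c: "(\<forall>b. b \<notin> ?B \<longrightarrow> c b = 0) \<and> v - (\<Sum>b\<in>?B. nsym_scale (c b) b) \<in> W"
      and d: "(\<forall>b. b \<notin> ?B \<longrightarrow> d b = 0) \<and> v - (\<Sum>b\<in>?B. nsym_scale (d b) b) \<in> W"
    have "(\<Sum>b\<in>?B. nsym_scale (c b - d b) b)
          = (v - (\<Sum>b\<in>?B. nsym_scale (d b) b)) - (v - (\<Sum>b\<in>?B. nsym_scale (c b) b))"
      by (simp add: nsym.scale_left_diff_distrib sum_subtractf)
    also have "\<dots> \<in> W" by (rule nsym.subspace_diff[OF W(1) conjunct2[OF d] conjunct2[OF c]])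
    also have "W \<subseteq> nsym.span C" by (rule C(3))
    finally obtain w where w: "(\<Sum>b\<in>?B. nsym_scale (c b - d b) b) = (\<Sum>x\<in>C. nsym_scale (w x) x)"
      unfolding nsym.span_finite[OF finite_subset[OF E(1) finE]] by (elim rangeE)
    define g where "g = (\<lambda>x. if x \<in> C then - w x else c x - d x)"
    have gE: "(\<Sum>x\<in>E. nsym_scale (g x) x) = (\<Sum>x\<in>?B. nsym_scale (g x) x) + (\<Sum>x\<in>C. nsym_scale (g x) x)"
      by (rule sum.subset_diff[OF E(1) finE])
    have gB: "(\<Sum>x\<in>?B. nsym_scale (g x) x) = (\<Sum>b\<in>?B. nsym_scale (c b - d b) b)"
      by (rule sum.cong) (auto simp: g_def)
    have gC: "(\<Sum>x\<in>C. nsym_scale (g x) x) = - (\<Sum>x\<in>C. nsym_scale (w x) x)"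
      by (simp add: g_def sum_negf)
    have 0: "(\<Sum>x\<in>E. nsym_scale (g x) x) = 0" unfolding gE gB gC w by simp
    have g: "g x = 0" if "x \<in> E" for x
      by (rule nsym.independentD[where u = g, OF E(3) finE order.refl 0 that])
    have "c b = d b" for b
    proof (cases "b \<in> ?B")
      case True
      then show ?thesis using g[of b] by (simp add: g_def)
    qed (use c d in simp)
    then show "c = d" by (rule ext)
  qed
  then have "basis_mod V W ?B"
    unfolding basis_mod_def using E(2) finE by (intro conjI ballI) auto
  then show ?thesis by (rule exI)
qed

lemma quotient_dim_eq:
  assumes V: "nsym.subspace V" and W: "nsym.subspace W" "W \<subseteq> V" and fin: "finite T" "V \<subseteq> nsym.span T"
  shows "quotient_dim V W = nsym.dim V - nsym.dim W"
proof -
  obtain C where C: "C \<subseteq> W" "nsym.independent C" "W \<subseteq> nsym.span C" "card C = nsym.dim W" by (rule nsym.basis_exists)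
  have finC: "finite C"
    using nsym.independent_span_bound[OF fin(1) C(2)] C W fin by blast
  have card: "card B = nsym.dim V - nsym.dim W" if B: "basis_mod V W B" for B
  proof -
    note * = basis_mod_Un[OF V W B C(1-3) finC]
    have "nsym.span (B \<union> C) = nsym.span V"
      unfolding *(3) by (rule nsym.span_eq_iff[THEN iffD2, OF V, symmetric])
    then have "nsym.dim V = card (B \<union> C)" using *(2) by (rule nsym.dim_eq_card)
    also have "\<dots> = card B + nsym.dim W"
      using *(1) B finC C(4) by (simp add: card_Un_disjoint basis_mod_def)
    finally show ?thesis by simp
  qed
  then show ?thesis
    unfolding quotient_dim_def
    using basis_mod_exists[OF V W fin] by (intro the_equality) auto
qed

section \<open>Quiver and Cartan invariants\<close>

text \<open>
  As \<open>e\<^sub>\<mu> * D * e\<^sub>\<nu>\<close> is the space of homomorphisms \<open>D * e\<^sub>\<mu> \<rightarrow> D * e\<^sub>\<nu>\<close> of left modules, the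
  index \<open>\<nu>\<close> of the source of an arrow \<open>\<nu> \<rightarrow> \<mu>\<close> is on the right.
\<close>

definition corner :: "nat multiset \<Rightarrow> nsym set \<Rightarrow> nat multiset \<Rightarrow> nsym set" where
  "corner \<mu> X \<nu> = (\<lambda>x. e_idem \<mu> \<star> x \<star> e_idem \<nu>) ` X"

definition cartan :: "nat \<Rightarrow> nat multiset \<Rightarrow> nat multiset \<Rightarrow> nat" where
  "cartan n \<nu> \<mu> = nsym.dim (corner \<mu> (carrier (D0 n)) \<nu>)"

text \<open>A power series in \<open>q\<close>, so that the sum over all \<open>k\<close> needs no finiteness argument.\<close>

definition q_cartan :: "nat \<Rightarrow> nat multiset \<Rightarrow> nat multiset \<Rightarrow> nat fps" where
  "q_cartan n \<nu> \<mu> = Abs_fps (\<lambda>k.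
     quotient_dim (corner \<mu> (rad_power (D0 n) k) \<nu>) (corner \<mu> (rad_power (D0 n) (Suc k)) \<nu>))"

definition arrows :: "nat \<Rightarrow> nat multiset \<Rightarrow> nat multiset \<Rightarrow> nat" where
  "arrows n \<nu> \<mu> = fps_nth (q_cartan n \<nu> \<mu>) 1"

end

theory Submission
  imports Defs "HOL-Library.Product_Plus"
begin

text \<open>
  In the free algebra on the Zassenhaus elements, which are primitive, the splitting formula turns
  the internal product \<open>\<zeta>\<^sup>I * (x\<^sub>1 \<cdots> x\<^sub>s)\<close> with primitive \<open>x\<^sub>k\<close> into a sum over the distributions of the
  factors \<open>x\<^sub>k\<close> to the letters of \<open>I\<close>. Hence right multiplication by \<open>e\<^sub>\<lambda>\<close> is the projection to the span
  of the rearrangements of \<open>\<zeta>\<^sup>\<lambda>\<close>, and each \<open>\<zeta>\<^sub>i\<close> maps products of letters to Lie elements. The number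
  of Lie factors filters every projective module, and the degree \<open>n\<close> part of the commutator
  ideal lowers it by one; this part is therefore nilpotent with split commutative semisimple
  quotient, so it is the radical. Conversely a product of \<open>s\<close> brackets with total content \<open>\<lambda>\<close> lies in the
  power \<open>\<ell>(\<lambda>) - s\<close> of the radical: a nontrivial bracket \<open>[Q, \<zeta>\<^sub>d]\<close> of least degree is obtained from
  \<open>Q\<close> and \<open>\<zeta>\<^sub>d\<close> by a radical element \<open>[\<zeta>\<^sub>q, \<zeta>\<^sub>d] \<cdots>\<close>, up to terms covered by induction. The radical
  filtration of \<open>e\<^sub>\<mu> * D * e\<^sub>\<lambda>\<close> thus jumps only at \<open>\<ell>(\<lambda>) - \<ell>(\<mu>)\<close>.
\<close>

section \<open>Linear extension\<close>

text \<open>The internal product is given by matrix sums, for which not even associativity is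
  evident. On products of primitive elements the matrices disappear: a letter \<open>zeta i\<close>
  annihilates 1 and turns whatever it receives into one Lie element. So a word of r letters needs at
  least r brackets and leaves at most r of them. These two bounds meet in a corner and fix the
  position of its only jump. The hard inclusion is that a product of few brackets lies in a high
  power of the radical. A radical element cannot be aimed at one bracket: a letter
  \<open>zeta q\<close> accepts every bracket of degree q, so coincidences of degree produce
  unwanted terms. Minimality controls them, because every other bracket of small degree is then a
  single letter, and an unwanted term still contains Q itself. The wanted terms all enter with the
  same sign, so their multiplicity is a positive integer, which is invertible over the complex
  numbers. The same positivity replaces the computation of coefficients in the other arguments
  modulo fewer brackets.\<close>

abbreviation single :: "'k \<Rightarrow> 'c :: zero \<Rightarrow> 'k \<Rightarrow>\<^sub>0 'c" where
  "single \<equiv> Poly_Mapping.single"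

lemma nsym_scale_conv_mult: "nsym_scale c F = single 0 c * F"
  by (simp add: nsym_scale_def mult_map_scale_conv_mult)

lemma poly_mapping_conv_sum_single:
  "F = (\<Sum>k\<in>Poly_Mapping.keys F. single k (Poly_Mapping.lookup F k))"
  by (rule poly_mapping_eqI) (auto simp: lookup_sum lookup_single when_def in_keys_iff)

lemma poly_mapping_additive_induct [case_names single add]:
  fixes F :: "'k \<Rightarrow>\<^sub>0 'c :: comm_monoid_add"
  assumes single: "\<And>k c. P (single k c)"
    and add: "\<And>F G. P F \<Longrightarrow> P G \<Longrightarrow> P (F + G)"
  shows "P F"
proof -
  have "P (\<Sum>k\<in>A. single k (Poly_Mapping.lookup F k))" if "finite A" for A
    using that
  proof induction
    case empty
    then show ?case using single[of undefined 0] by simp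
  qed (auto intro: single add)
  from this[of "Poly_Mapping.keys F"] show ?thesis
    by (simp flip: poly_mapping_conv_sum_single)
qed

lemma single_0_commute:
  fixes F :: "'m :: monoid_add \<Rightarrow>\<^sub>0 'c :: comm_semiring_1"
  shows "F * single 0 c = single 0 c * F"
  by (induction F rule: poly_mapping_additive_induct)
     (simp_all add: mult_single algebra_simps)

lemma single_0_left_commute:
  fixes F :: "'m :: monoid_add \<Rightarrow>\<^sub>0 'c :: comm_semiring_1"
  shows "F * (single 0 c * G) = single 0 c * (F * G)"
  by (metis mult.assoc single_0_commute)

lemma single_0_mult_mult:
  fixes F :: "'m :: monoid_add \<Rightarrow>\<^sub>0 'c :: comm_semiring_1"
  shows "single 0 c * (single 0 d * F) = single 0 (c * d) * F"
  by (simp add: mult_single flip: mult.assoc)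

lemma lookup_scale: "Poly_Mapping.lookup (single 0 c * F) k = c * Poly_Mapping.lookup F k"
  for F :: "'m :: monoid_add \<Rightarrow>\<^sub>0 complex"
  by (cases "Poly_Mapping.lookup F k = 0")
     (simp_all add: Poly_Mapping.map.rep_eq when_def flip: mult_map_scale_conv_mult)

text \<open>Scalars are the central elements \<open>single 0 c\<close>, so that one notion of
  linearity serves all the monoid algebras at hand: \<open>nsym\<close>, its tensor square, and the
  commutative polynomials of \<open>abel\<close>.\<close>

definition lin ::
    "(('k :: monoid_add \<Rightarrow>\<^sub>0 complex) \<Rightarrow> ('m :: monoid_add \<Rightarrow>\<^sub>0 complex)) \<Rightarrow> bool" where
  "lin f \<longleftrightarrow> (\<forall>F G. f (F + G) = f F + f G) \<and>
     (\<forall>c F. f (single 0 c * F) = single 0 c * f F)"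

lemma lin_add: "lin f \<Longrightarrow> f (F + G) = f F + f G"
  by (simp add: lin_def)

lemma lin_scale: "lin f \<Longrightarrow> f (single 0 c * F) = single 0 c * f F"
  by (simp add: lin_def)

lemma lin_0: "lin f \<Longrightarrow> f 0 = 0"
  using lin_scale[of f 0 0] by simp

lemma lin_sum: "lin f \<Longrightarrow> f (sum g A) = (\<Sum>x\<in>A. f (g x))"
  by (induction A rule: infinite_finite_induct) (simp_all add: lin_0 lin_add)

lemma lin_uminus: "lin f \<Longrightarrow> f (- F) = - f F"
  using lin_scale[of f "-1" F] by (simp add: single_uminus)

lemma lin_diff: "lin f \<Longrightarrow> f (F - G) = f F - f G"
  using lin_add[of f F "- G"] by (simp add: lin_uminus)

lemma single_conv_scale: "single k (c :: complex) = single 0 c * single k 1"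
  by (simp add: mult_single)

lemma lin_eqI:
  assumes "lin f" "lin g" "\<And>k. f (single k 1) = g (single k 1)"
  shows "f F = g F"
proof (induction F rule: poly_mapping_additive_induct)
  case (single k c)
  show ?case
    by (subst (1 2) single_conv_scale) (simp add: lin_scale assms)
qed (simp add: lin_add assms)

lemma lin_comp: "lin f \<Longrightarrow> lin g \<Longrightarrow> lin (\<lambda>F. f (g F))"
  by (simp add: lin_def)

lemma lin_id: "lin (\<lambda>F. F)"
  by (simp add: lin_def)

lemma lin_mult_left: "lin f \<Longrightarrow> lin (\<lambda>F. G * f F)"
  by (simp add: lin_def distrib_left single_0_left_commute)

lemma lin_mult_right: "lin f \<Longrightarrow> lin (\<lambda>F. f F * G)"
  by (simp add: lin_def distrib_right mult.assoc)

lemma lin_plus: "lin f \<Longrightarrow> lin g \<Longrightarrow> lin (\<lambda>F. f F + g F)"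
  by (simp add: lin_def algebra_simps)

lemma lin_minus: "lin f \<Longrightarrow> lin g \<Longrightarrow> lin (\<lambda>F. f F - g F)"
  by (simp add: lin_def algebra_simps)

lemma lin_zero: "lin (\<lambda>F. 0)"
  by (simp add: lin_def)

lemma lin_sumI: "(\<And>x. x \<in> A \<Longrightarrow> lin (f x)) \<Longrightarrow> lin (\<lambda>F. \<Sum>x\<in>A. f x F)"
  by (induction A rule: infinite_finite_induct) (auto intro: lin_zero lin_plus)

definition ext :: "('k \<Rightarrow> 'm :: monoid_add \<Rightarrow>\<^sub>0 complex) \<Rightarrow> ('k \<Rightarrow>\<^sub>0 complex) \<Rightarrow> ('m \<Rightarrow>\<^sub>0 complex)" where
  "ext f F = (\<Sum>k\<in>Poly_Mapping.keys F. single 0 (Poly_Mapping.lookup F k) * f k)"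

lemma ext_superset:
  assumes "finite A" "Poly_Mapping.keys F \<subseteq> A"
  shows "ext f F = (\<Sum>k\<in>A. single 0 (Poly_Mapping.lookup F k) * f k)"
  unfolding ext_def using assms by (intro sum.mono_neutral_left) (auto simp: in_keys_iff)

lemma ext_single [simp]: "ext f (single k c) = single 0 c * f k"
  by (subst ext_superset[of "{k}"]) auto

lemma lin_ext: "lin (ext f)"
  unfolding lin_def
proof safe
  fix F G :: "'a \<Rightarrow>\<^sub>0 complex" and c
  let ?A = "Poly_Mapping.keys F \<union> Poly_Mapping.keys G"
  have "Poly_Mapping.keys (F + G) \<subseteq> ?A" by (rule Poly_Mapping.keys_add)
  then have "ext f (F + G) = (\<Sum>k\<in>?A. single 0 (Poly_Mapping.lookup (F + G) k) * f k)"
    by (intro ext_superset) auto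
  also have "\<dots> = ext f F + ext f G"
    by (subst (1 2) ext_superset[of ?A]) (auto simp: lookup_add single_add distrib_right sum.distrib)
  finally show "ext f (F + G) = ext f F + ext f G" .
  have "Poly_Mapping.keys (single 0 c * F) \<subseteq> Poly_Mapping.keys F"
    by (auto simp: in_keys_iff lookup_scale)
  then show "ext f (single 0 c * F) = single 0 c * ext f F"
    by (subst (1 2) ext_superset[of "Poly_Mapping.keys F"])
       (auto simp: lookup_scale sum_distrib_left mult_single simp flip: mult.assoc)
qed

lemmas ext_add = lin_add[OF lin_ext]
  and ext_scale = lin_scale[OF lin_ext]
  and ext_0 [simp] = lin_0[OF lin_ext]
  and ext_sum = lin_sum[OF lin_ext]

lemma lin_ext_param:
  assumes "\<And>k. lin (f k)"
  shows "lin (\<lambda>G. ext (\<lambda>k. f k G) F)"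
  unfolding ext_def by (intro lin_sumI lin_mult_left assms)

lemma ext_mult:
  fixes f :: "'k :: monoid_add \<Rightarrow> 'm :: monoid_add \<Rightarrow>\<^sub>0 complex"
  assumes "\<And>a b. f (a + b) = f a * f b"
  shows "ext f (F * G) = ext f F * ext f G"
proof (rule lin_eqI[where f = "\<lambda>F. ext f (F * G)" and g = "\<lambda>F. ext f F * ext f G"])
  fix k
  show "ext f (single k 1 * G) = ext f (single k 1) * ext f G"
    by (rule lin_eqI[where f = "\<lambda>G. ext f (single k 1 * G)"
          and g = "\<lambda>G. ext f (single k 1) * ext f G"])
       (intro lin_comp[OF lin_ext] lin_mult_left lin_ext lin_id | simp add: mult_single assms)+
qed (intro lin_comp[OF lin_ext] lin_mult_right lin_ext lin_id)+

lemma ext_one: "f 0 = 1 \<Longrightarrow> ext f 1 = 1"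
  by (metis ext_single mult_1 single_one)

section \<open>Sums over splittings of lists\<close>

text \<open>The coproduct of \<open>S_word J\<close> has one term for each way to write the vector J
  as a sum m + m'. Zero entries are kept, so that positions stay aligned with the columns of a
  matrix.\<close>

primrec Dsum :: "(nat list \<Rightarrow> nat list \<Rightarrow> 'b :: comm_monoid_add) \<Rightarrow> nat list \<Rightarrow> 'b" where
  "Dsum f [] = f [] []"
| "Dsum f (j # J) = (\<Sum>a\<le>j. Dsum (\<lambda>m m'. f (a # m) ((j - a) # m')) J)"

lemma Dsum_cong:
  assumes "\<And>m m'. sum_list m + sum_list m' = sum_list J \<Longrightarrow> f m m' = g m m'"
  shows "Dsum f J = Dsum g J"
  using assms
proof (induction J arbitrary: f g)
  case (Cons j J)
  show ?case unfolding Dsum.simps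
    by (intro sum.cong refl Cons.IH Cons.prems) auto
qed simp

lemma Dsum_hom:
  assumes "h 0 = 0" "\<And>x y. h (x + y) = h x + h y"
  shows "h (Dsum f J) = Dsum (\<lambda>m m'. h (f m m')) J"
proof (induction J arbitrary: f)
  case (Cons j J)
  have "h (sum g A) = (\<Sum>x\<in>A. h (g x))" for g and A :: "nat set"
    by (induction A rule: infinite_finite_induct) (simp_all add: assms)
  then show ?case by (simp add: Cons.IH)
qed simp

lemma Dsum_zero [simp]: "Dsum (\<lambda>m m'. 0) J = 0"
  by (induction J) simp_all

lemma Dsum_add: "Dsum (\<lambda>m m'. f m m' + g m m') J = Dsum f J + Dsum g J"
  by (induction J arbitrary: f g) (simp_all add: sum.distrib)

lemma Dsum_sum: "Dsum (\<lambda>m m'. \<Sum>x\<in>A. f x m m') J = (\<Sum>x\<in>A. Dsum (f x) J)"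
  by (induction A rule: infinite_finite_induct) (simp_all add: Dsum_add)

text \<open>Coassociativity: both sides range over the ways to write J as a sum of three
  vectors.\<close>

lemma Dsum_assoc:
  "Dsum (\<lambda>r m'. Dsum (\<lambda>a b. f a b m') r) J = Dsum (\<lambda>a r. Dsum (\<lambda>b m'. f a b m') r) J"
proof (induction J arbitrary: f)
  case (Cons j J)
  have "Dsum (\<lambda>r m'. Dsum (\<lambda>a b. f a b m') r) (j # J)
      = (\<Sum>c\<le>j. \<Sum>a\<le>c. Dsum (\<lambda>r m'. Dsum (\<lambda>x y. f (a # x) ((c - a) # y) ((j - c) # m')) r) J)"
    by (simp add: Dsum_sum)
  also have "\<dots> = (\<Sum>c\<le>j. \<Sum>a\<le>c. Dsum (\<lambda>x r. Dsum (\<lambda>y m'. f (a # x) ((c - a) # y) ((j - c) # m')) r) J)"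
    by (simp add: Cons.IH)
  also have "\<dots> = (\<Sum>a\<le>j. \<Sum>b\<le>j - a. Dsum (\<lambda>x r. Dsum (\<lambda>y m'. f (a # x) (b # y) ((j - a - b) # m')) r) J)"
    unfolding sum.Sigma[OF finite_atMost ballI[OF finite_atMost]]
    by (rule sum.reindex_bij_witness[where j = "\<lambda>(c, a). (a, c - a)" and i = "\<lambda>(a, b). (a + b, a)"])
       auto
  finally show ?case by (simp add: Dsum_sum)
qed simp

lemma Dsum_unit_left:
  "Dsum (\<lambda>m m'. if set m \<subseteq> {0} then g m' else 0) J = g J"
proof (induction J arbitrary: g)
  case (Cons j J)
  have "(\<Sum>a\<le>j. Dsum (\<lambda>m m'. if set (a # m) \<subseteq> {0} then g ((j - a) # m') else 0) J)
      = (\<Sum>a\<in>{0}. Dsum (\<lambda>m m'. if set (a # m) \<subseteq> {0} then g ((j - a) # m') else 0) J)"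
    by (rule sum.mono_neutral_right) auto
  then show ?case using Cons.IH[of "\<lambda>m'. g (j # m')"] by (simp cong: if_cong)
qed simp

text \<open>A zero entry of J splits only as 0 + 0, which a function that ignores zeros does not
  notice.\<close>

lemma Dsum_filter:
  assumes "\<And>m m'. f m m' = f (filter ((<) 0) m) (filter ((<) 0) m')"
  shows "Dsum f J = Dsum f (filter ((<) 0) J)"
  using assms
proof (induction J arbitrary: f)
  case (Cons j J)
  have IH: "Dsum (\<lambda>m m'. f (a # m) (b # m')) J
      = Dsum (\<lambda>m m'. f (a # m) (b # m')) (filter ((<) 0) J)" for a b
    by (rule Cons.IH) (subst (1 2) Cons.prems, simp)
  show ?case
  proof (cases "j = 0")
    case True
    have "f (0 # m) (0 # m') = f m m'" for m m'
      by (subst (1 2) Cons.prems) simp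
    then show ?thesis using True IH[of 0 0] by simp
  qed (simp add: IH)
qed simp

text \<open>These are the unshuffles of a list. They describe the coproduct of a product of
  primitive elements, as \<open>Dsum\<close> describes that of a product of the
  \<open>S n\<close>.\<close>

primrec Usum :: "('a list \<Rightarrow> 'a list \<Rightarrow> 'b :: comm_monoid_add) \<Rightarrow> 'a list \<Rightarrow> 'b" where
  "Usum f [] = f [] []"
| "Usum f (x # xs) = Usum (\<lambda>u v. f (x # u) v) xs + Usum (\<lambda>u v. f u (x # v)) xs"

lemma Usum_cong:
  assumes "\<And>u v. mset u + mset v = mset xs \<Longrightarrow> f u v = g u v"
  shows "Usum f xs = Usum g xs"
  using assms
proof (induction xs arbitrary: f g)
  case (Cons x xs)
  have "Usum (\<lambda>u v. f (x # u) v) xs = Usum (\<lambda>u v. g (x # u) v) xs"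
    by (rule Cons.IH, rule Cons.prems) simp
  moreover have "Usum (\<lambda>u v. f u (x # v)) xs = Usum (\<lambda>u v. g u (x # v)) xs"
    by (rule Cons.IH, rule Cons.prems) simp
  ultimately show ?case by simp
qed simp

lemma Usum_hom:
  assumes "\<And>x y. h (x + y) = h x + h y"
  shows "h (Usum f xs) = Usum (\<lambda>u v. h (f u v)) xs"
  by (induction xs arbitrary: f) (simp_all add: assms)

lemma Usum_zero [simp]: "Usum (\<lambda>u v. 0) xs = 0"
  by (induction xs) simp_all

lemma Usum_add: "Usum (\<lambda>u v. f u v + g u v) xs = Usum f xs + Usum g xs"
  by (induction xs arbitrary: f g) (simp_all add: algebra_simps)

lemma Usum_sum: "Usum (\<lambda>u v. \<Sum>x\<in>A. f x u v) xs = (\<Sum>x\<in>A. Usum (f x) xs)"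
  by (induction A rule: infinite_finite_induct) (simp_all add: Usum_add)

lemma Usum_Dsum: "Usum (\<lambda>u v. Dsum (\<lambda>m m'. f m m' u v) J) xs = Dsum (\<lambda>m m'. Usum (f m m') xs) J"
  by (induction xs arbitrary: f) (simp_all add: Dsum_add)

lemma Usum_flip: "Usum (\<lambda>u v. f v u) xs = Usum f xs"
proof (induction xs arbitrary: f)
  case (Cons x xs)
  show ?case
    using Cons.IH[of "\<lambda>u v. f (x # u) v"] Cons.IH[of "\<lambda>u v. f u (x # v)"]
    by (simp add: add.commute)
qed simp

text \<open>Both sides distribute the list over four boxes; those of \<open>a2\<close> and
  \<open>b1\<close> exchange their places in the nesting. This middle exchange makes the coproduct
  compatible with products.\<close>

lemma Usum_four:
  "Usum (\<lambda>a b. Usum (\<lambda>a1 a2. Usum (\<lambda>b1 b2. f a1 a2 b1 b2) b) a) xs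
   = Usum (\<lambda>a b. Usum (\<lambda>a1 b1. Usum (\<lambda>a2 b2. f a1 a2 b1 b2) b) a) xs"
proof (induction xs arbitrary: f)
  case (Cons x xs)
  show ?case
    using Cons.IH[of "\<lambda>a1 a2 b1 b2. f (x # a1) a2 b1 b2"] Cons.IH[of "\<lambda>a1 a2 b1 b2. f a1 (x # a2) b1 b2"]
      Cons.IH[of "\<lambda>a1 a2 b1 b2. f a1 a2 (x # b1) b2"] Cons.IH[of "\<lambda>a1 a2 b1 b2. f a1 a2 b1 (x # b2)"]
    by (simp add: Usum_add add_ac)
qed simp

lemma Usum_closed:
  assumes "\<And>u v. mset u + mset v = mset xs \<Longrightarrow> f u v \<in> V" "\<And>x y. x \<in> V \<Longrightarrow> y \<in> V \<Longrightarrow> x + y \<in> V"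
  shows "Usum f xs \<in> V"
  using assms(1)
proof (induction xs arbitrary: f)
  case (Cons x xs)
  have "Usum (\<lambda>u v. f (x # u) v) xs \<in> V"
    by (rule Cons.IH, rule Cons.prems) simp
  moreover have "Usum (\<lambda>u v. f u (x # v)) xs \<in> V"
    by (rule Cons.IH, rule Cons.prems) simp
  ultimately show ?case using assms(2) by simp
qed simp

section \<open>The internal product and the coproduct\<close>

definition below :: "nat list \<Rightarrow> nat list set" where
  "below J = {m. list_all2 (\<le>) m J}"

lemma below_Nil [simp]: "below [] = {[]}"
  by (auto simp: below_def)

lemma below_Cons: "below (j # J) = (\<lambda>(a, m). a # m) ` ({..j} \<times> below J)"
  by (auto simp: below_def list_all2_Cons2 image_iff)

lemma finite_below: "finite (below J)"
  by (induction J) (simp_all add: below_Cons)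

lemma Dsum_conv_sum: "Dsum f J = (\<Sum>m\<in>below J. f m (map2 (-) J m))"
proof (induction J arbitrary: f)
  case (Cons j J)
  have "inj_on (\<lambda>(a, m). a # m) ({..j} \<times> below J)"
    by (auto simp: inj_on_def)
  then have "(\<Sum>m\<in>below (j # J). f m (map2 (-) (j # J) m))
      = (\<Sum>(a, m)\<in>{..j} \<times> below J. f (a # m) ((j - a) # map2 (-) J m))"
    unfolding below_Cons by (simp add: sum.reindex case_prod_unfold)
  then show ?case
    by (simp add: Cons.IH sum.cartesian_product)
qed simp

text \<open>The rows below the first have the column sums that the first row leaves over. Truncated
  subtraction is harmless, since \<open>below J\<close> bounds m by J entrywise.\<close>

lemma in_matrices_Cons:
  "m # M \<in> matrices (i # I) J \<longleftrightarrow>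
     m \<in> below J \<and> sum_list m = i \<and> M \<in> matrices I (map2 (-) J m)" (is "?L \<longleftrightarrow> ?R")
proof -
  have sum: "(\<Sum>k<length J. m ! k) = sum_list m" if "length m = length J"
    using that by (simp add: sum_list_sum_nth atLeast0LessThan)
  have col: "(\<Sum>k<length (i # I). (m # M) ! k ! j) = m ! j + (\<Sum>k<length I. M ! k ! j)" for j
    by (simp add: sum.lessThan_Suc_shift del: sum.lessThan_Suc)
  have row: "(\<forall>k<length (i # I). (\<Sum>j<length J. (m # M) ! k ! j) = (i # I) ! k)
      \<longleftrightarrow> (\<Sum>j<length J. m ! j) = i \<and> (\<forall>k<length I. (\<Sum>j<length J. M ! k ! j) = I ! k)"
    by (auto simp: less_Suc_eq_0_disj)
  show ?thesis
  proof (cases "length m = length J")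
    case True
    have "(\<forall>j<length J. m ! j + (\<Sum>k<length I. M ! k ! j) = J ! j) \<longleftrightarrow>
        m \<in> below J \<and> (\<forall>j<length J. (\<Sum>k<length I. M ! k ! j) = map2 (-) J m ! j)"
      using True by (fastforce simp: below_def list_all2_conv_all_nth)
    then show ?thesis
      unfolding matrices_def mem_Collect_eq col row using True sum[OF True] by auto
  qed (auto simp: matrices_def below_def list_all2_conv_all_nth)
qed

lemma matrices_Nil: "matrices [] J = (if set J \<subseteq> {0} then {[]} else {})"
proof -
  have "(\<forall>j<length J. J ! j = 0) \<longleftrightarrow> set J \<subseteq> {0}"
    by (auto simp: set_conv_nth)
  then show ?thesis by (auto simp: matrices_def)
qed

lemma matrices_Cons:
  "matrices (i # I) J = (\<lambda>(m, M). m # M) `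
     (SIGMA m:{m \<in> below J. sum_list m = i}. matrices I (map2 (-) J m))"
    (is "?L = ?R")
proof (rule Set.set_eqI)
  fix N
  show "N \<in> ?L \<longleftrightarrow> N \<in> ?R"
  proof (cases N)
    case Nil
    then show ?thesis by (auto simp: matrices_def)
  next
    case (Cons m M)
    then show ?thesis by (auto simp: in_matrices_Cons image_iff)
  qed
qed

lemma finite_matrices: "finite (matrices I J)"
  by (induction I arbitrary: J) (auto simp: matrices_Nil matrices_Cons finite_below)

definition S_word :: "nat list \<Rightarrow> nsym" where
  "S_word J = prod_list (map S J)"

lemma S_word_simps [simp]: "S_word [] = 1" "S_word (j # J) = S j * S_word J" "S_word (I @ J) = S_word I * S_word J"
  by (simp_all add: S_word_def)

lemma S_word_comp_parts: "S_word (comp_parts I) = single I 1"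
proof -
  have "S_word J = single (Composition J) 1" if "0 \<notin> set J" for J
    using that
  proof (induction J)
    case Nil
    then show ?case by (simp flip: zero_composition_def)
  next
    case (Cons j J)
    then have "Composition [j] + Composition J = Composition (j # J)"
      by (simp add: plus_composition_def)
    then show ?case using Cons by (auto simp: S_def mult_single)
  qed
  from this[OF comp_parts_nonzero] show ?thesis by (simp add: comp_parts_inverse)
qed

lemma S_word_filter: "S_word (filter ((<) 0) J) = S_word J"
  by (induction J) (auto simp: S_def)

lemma S_word_Sym: "S_word J \<in> Sym (sum_list J)"
  by (induction J) (simp_all add: Sym_one Sym_mult Sym_S)

definition matrix_sum :: "nat list \<Rightarrow> nat list \<Rightarrow> nsym" where
  "matrix_sum I J = (\<Sum>M\<in>matrices I J. S_matrix M)"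

lemma matrix_sum_Nil: "matrix_sum [] J = (if set J \<subseteq> {0} then 1 else 0)"
  by (simp add: matrix_sum_def matrices_Nil S_matrix_def)

lemma matrix_sum_Cons: "matrix_sum (i # I) J = Dsum (\<lambda>m m'. if sum_list m = i then S_word m * matrix_sum I m' else 0) J"
proof -
  have inj: "inj_on (\<lambda>(m, M). m # M) A" for A :: "(nat list \<times> nat list list) set"
    by (auto simp: inj_on_def)
  have mat: "S_matrix (m # M) = S_word m * S_matrix M" for m M
    by (simp add: S_matrix_def S_word_def)
  have "matrix_sum (i # I) J = (\<Sum>m\<in>{m \<in> below J. sum_list m = i}. S_word m * matrix_sum I (map2 (-) J m))"
    unfolding matrix_sum_def matrices_Cons sum.reindex[OF inj]
    by (subst sum_distrib_left, subst sum.Sigma)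
       (auto simp: finite_below finite_matrices mat intro!: sum.cong)
  then show ?thesis
    by (simp add: Dsum_conv_sum sum.inter_filter finite_below)
qed

text \<open>Cut each matrix below the rows of \<open>I\<close>: the blocks have column sums m and m'
  with m + m' = J, and reading row by row multiplies them. This is the splitting formula on basis
  elements.\<close>

lemma matrix_sum_append: "matrix_sum (I @ I') J = Dsum (\<lambda>m m'. matrix_sum I m * matrix_sum I' m') J"
proof (induction I arbitrary: J)
  case Nil
  show ?case
    using Dsum_unit_left[of "\<lambda>m'. matrix_sum I' m'" J] by (simp add: matrix_sum_Nil if_distrib[of "\<lambda>x. x * _"] cong: if_cong)
next
  case (Cons i I)
  have "matrix_sum ((i # I) @ I') J = Dsum (\<lambda>a r. Dsum (\<lambda>b m'.
      if sum_list a = i then S_word a * (matrix_sum I b * matrix_sum I' m') else 0) r) J"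
    by (simp add: matrix_sum_Cons Cons.IH if_distrib[of "Dsum _"] cong: if_cong)
       (intro Dsum_cong, simp add: Dsum_hom[where h = "\<lambda>x. S_word _ * x"] distrib_left)
  also have "\<dots> = Dsum (\<lambda>r m'. Dsum (\<lambda>a b. if sum_list a = i then S_word a * (matrix_sum I b * matrix_sum I' m') else 0) r) J"
    by (rule Dsum_assoc[symmetric])
  also have "\<dots> = Dsum (\<lambda>r m'. matrix_sum (i # I) r * matrix_sum I' m') J"
    unfolding matrix_sum_Cons
    by (intro Dsum_cong, subst Dsum_hom[where h = "\<lambda>x. x * matrix_sum I' _"])
       (auto simp: distrib_right mult.assoc intro!: Dsum_cong)
  finally show ?case .
qed

text \<open>A column with sum 0 contributes only factors \<open>S 0 = 1\<close>. The coproduct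
  produces vectors with zero entries, which are not compositions, so the formulas must allow
  them.\<close>

lemma matrix_sum_filter: "matrix_sum I (filter ((<) 0) J) = matrix_sum I J"
proof (induction I arbitrary: J)
  case Nil
  show ?case by (auto simp: matrix_sum_Nil)
next
  case (Cons i I)
  have sum: "sum_list (filter ((<) 0) m) = sum_list m" for m :: "nat list"
    by (induction m) auto
  show ?case
    unfolding matrix_sum_Cons
    by (rule Dsum_filter[symmetric]) (simp only: Cons.IH S_word_filter sum)
qed

lemma star_conv_ext:
  "F \<star> G = ext (\<lambda>I. ext (\<lambda>J. matrix_sum (comp_parts I) (comp_parts J)) G) F"
  by (simp add: internal_prod_def ext_def nsym_scale_conv_mult matrix_sum_def sum_distrib_left
      single_0_mult_mult)

lemma lin_star_left: "lin (\<lambda>F. F \<star> G)"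
  unfolding star_conv_ext by (rule lin_ext)

lemma lin_star_right: "lin (\<lambda>G. F \<star> G)"
  unfolding star_conv_ext by (intro lin_ext_param lin_ext)

lemma single_star_S_word: "single I 1 \<star> S_word J = matrix_sum (comp_parts I) J"
proof -
  have "S_word J = single (Composition (filter ((<) 0) J)) 1"
    by (subst S_word_filter[symmetric], subst S_word_comp_parts[symmetric]) simp
  then show ?thesis
    using matrix_sum_filter[of "comp_parts I" J] by (simp add: star_conv_ext)
qed

lemma S_word_star_S_word: "0 \<notin> set I \<Longrightarrow> S_word I \<star> S_word J = matrix_sum I J"
  using single_star_S_word[of "Composition I" J] S_word_comp_parts[of "Composition I"] by simp

section \<open>The tensor square, the coproduct and the splitting formula\<close>

type_synonym nsym2 = "(composition \<times> composition) \<Rightarrow>\<^sub>0 complex"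

definition in1 :: "nsym \<Rightarrow> nsym2" where
  "in1 = ext (\<lambda>I. single (I, 0) 1)"

definition in2 :: "nsym \<Rightarrow> nsym2" where
  "in2 = ext (\<lambda>I. single (0, I) 1)"

text \<open>The monoid algebra of a product of monoids is the tensor square, and
  \<open>tens F G\<close> is a pure tensor; the two embeddings commute by
  \<open>in2_in1_commute\<close>.\<close>

definition tens :: "nsym \<Rightarrow> nsym \<Rightarrow> nsym2" where
  "tens F G = in1 F * in2 G"

definition coprod :: "nsym \<Rightarrow> nsym2" where
  "coprod = ext (\<lambda>J. prod_list (map (\<lambda>n. \<Sum>a\<le>n. tens (S a) (S (n - a))) (comp_parts J)))"

lemma lin_in1: "lin in1" and lin_in2: "lin in2" and lin_coprod: "lin coprod"
  by (simp_all add: in1_def in2_def coprod_def lin_ext)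

lemma in1_mult: "in1 (F * G) = in1 F * in1 G"
  unfolding in1_def by (rule ext_mult) (simp add: mult_single)

lemma in2_mult: "in2 (F * G) = in2 F * in2 G"
  unfolding in2_def by (rule ext_mult) (simp add: mult_single)

lemma coprod_mult: "coprod (F * G) = coprod F * coprod G"
  unfolding coprod_def by (rule ext_mult) simp

lemma in1_one [simp]: "in1 1 = 1"
  unfolding in1_def by (rule ext_one) (simp flip: zero_prod_def)

lemma in2_one [simp]: "in2 1 = 1"
  unfolding in2_def by (rule ext_one) (simp flip: zero_prod_def)

lemma coprod_one [simp]: "coprod 1 = 1"
  unfolding coprod_def by (rule ext_one) simp

lemma in2_in1_commute: "in2 G * in1 F = in1 F * in2 G"
proof (rule lin_eqI[where f = "\<lambda>F. in2 G * in1 F" and g = "\<lambda>F. in1 F * in2 G"])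
  fix k
  show "in2 G * in1 (single k 1) = in1 (single k 1) * in2 G"
    by (rule lin_eqI[where f = "\<lambda>G. in2 G * in1 (single k 1)"
          and g = "\<lambda>G. in1 (single k 1) * in2 G"])
       (intro lin_mult_left lin_mult_right lin_in2 | simp add: in1_def in2_def mult_single)+
qed (intro lin_mult_left lin_mult_right lin_in1)+

lemma tens_mult: "tens F G * tens F' G' = tens (F * F') (G * G')"
  unfolding tens_def in1_mult in2_mult by (metis in2_in1_commute mult.assoc)

lemma tens_one_right: "tens F 1 = in1 F" and tens_one_left: "tens 1 F = in2 F"
  by (simp_all add: tens_def)

lemma tens_add_left: "tens (F + F') G = tens F G + tens F' G"
  and tens_add_right: "tens F (G + G') = tens F G + tens F G'"
  by (simp_all add: tens_def lin_add[OF lin_in1] lin_add[OF lin_in2] algebra_simps)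

lemma tens_zero [simp]: "tens 0 G = 0" "tens F 0 = 0"
  by (simp_all add: tens_def lin_0[OF lin_in1] lin_0[OF lin_in2])

lemma coprod_S: "coprod (S n) = (\<Sum>a\<le>n. tens (S a) (S (n - a)))"
proof (cases "n = 0")
  case True
  then show ?thesis by (simp add: S_def tens_def)
next
  case False
  then show ?thesis by (simp add: S_def[of n] coprod_def)
qed

lemma coprod_S_word: "coprod (S_word J) = Dsum (\<lambda>m m'. tens (S_word m) (S_word m')) J"
proof (induction J)
  case (Cons j J)
  have "coprod (S_word (j # J)) = (\<Sum>a\<le>j. tens (S a) (S (j - a)) * Dsum (\<lambda>m m'. tens (S_word m) (S_word m')) J)"
    by (simp add: coprod_mult coprod_S Cons.IH sum_distrib_right)
  also have "\<dots> = (\<Sum>a\<le>j. Dsum (\<lambda>m m'. tens (S a) (S (j - a)) * tens (S_word m) (S_word m')) J)"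
    by (intro sum.cong refl Dsum_hom) (simp_all add: distrib_left)
  finally show ?case by (simp add: tens_mult)
qed (simp add: tens_def)

text \<open>The internal product with K \<otimes> L in both tensor factors, followed by
  multiplication. Defining it on pairs of compositions makes it linear on all of
  \<open>nsym2\<close>, not only on pure tensors.\<close>

definition tprod :: "nsym \<Rightarrow> nsym \<Rightarrow> nsym2 \<Rightarrow> nsym" where
  "tprod K L = ext (\<lambda>(I, J). (K \<star> single I 1) * (L \<star> single J 1))"

lemma lin_tprod: "lin (tprod K L)"
  by (simp add: tprod_def lin_ext)

lemma tprod_tens: "tprod K L (tens F G) = (K \<star> F) * (L \<star> G)"
proof (rule lin_eqI[where f = "\<lambda>F. tprod K L (tens F G)" and g = "\<lambda>F. (K \<star> F) * (L \<star> G)"])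
  fix k
  show "tprod K L (tens (single k 1) G) = (K \<star> single k 1) * (L \<star> G)"
    by (rule lin_eqI[where f = "\<lambda>G. tprod K L (tens (single k 1) G)"
          and g = "\<lambda>G. (K \<star> single k 1) * (L \<star> G)"])
       (auto simp: tens_def in1_def in2_def tprod_def mult_single
         intro!: lin_comp[OF lin_ext] lin_mult_left lin_ext lin_star_right)
qed (auto simp: tens_def intro!: lin_comp[OF lin_tprod] lin_mult_right lin_in1 lin_star_right)

text \<open>The splitting formula: the columns of H are distributed over the rows of K and those of
  L, which is the coproduct of H. All three arguments enter linearly, so
  \<open>matrix_sum_append\<close> suffices.\<close>

theorem mult_star: "(K * L) \<star> H = tprod K L (coprod H)"
proof -
  have lin_left: "lin (\<lambda>K. tprod K L H)" for L H
    unfolding tprod_def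
    by (intro lin_ext_param) (auto simp: case_prod_unfold intro!: lin_mult_right lin_star_left)
  have lin_right: "lin (\<lambda>L. tprod K L H)" for K H
    unfolding tprod_def
    by (intro lin_ext_param) (auto simp: case_prod_unfold intro!: lin_mult_left lin_star_left)
  have "(single I 1 * single I' 1) \<star> single J 1
      = tprod (single I 1) (single I' 1) (coprod (single J 1))" for I I' J
  proof -
    have "(single I 1 * single I' 1) \<star> single J 1
        = matrix_sum (comp_parts I @ comp_parts I') (comp_parts J)"
      using single_star_S_word[of "I + I'" "comp_parts J"]
      by (simp add: mult_single S_word_comp_parts)
    then show ?thesis
      by (simp add: matrix_sum_append single_star_S_word tprod_tens
          Dsum_hom[where h = "tprod _ _", OF lin_0[OF lin_tprod] lin_add[OF lin_tprod]]
          flip: S_word_comp_parts[of J] add: coprod_S_word)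
  qed
  moreover have "lin (\<lambda>H. K \<star> H)" "lin (\<lambda>H. tprod K L (coprod H))" for K L
    by (rule lin_star_right) (rule lin_comp[OF lin_tprod lin_coprod])
  ultimately have 1: "(single I 1 * single I' 1) \<star> H
      = tprod (single I 1) (single I' 1) (coprod H)" for I I'
    by - (rule lin_eqI[where f = "\<lambda>H. (single I 1 * single I' 1) \<star> H"
          and g = "\<lambda>H. tprod (single I 1) (single I' 1) (coprod H)"]; assumption)
  have l: "lin (\<lambda>L. (K * L) \<star> H)" "lin (\<lambda>K. (K * L) \<star> H)" for K L H
    by (rule lin_comp[OF lin_star_left], rule lin_mult_left[OF lin_id])
       (rule lin_comp[OF lin_star_left], rule lin_mult_right[OF lin_id])
  have 2: "(single I 1 * L) \<star> H = tprod (single I 1) L (coprod H)" for I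
    by (rule lin_eqI[OF l(1) lin_right 1])
  show ?thesis
    by (rule lin_eqI[OF l(2) lin_left 2])
qed

section \<open>Units and degrees of the internal product\<close>

lemma Sym_induct [consumes 1, case_names word add scale zero]:
  assumes "F \<in> Sym n"
    and word: "\<And>I. sum_list (comp_parts I) = n \<Longrightarrow> P (single I 1)"
    and add: "\<And>F G. P F \<Longrightarrow> P G \<Longrightarrow> P (F + G)"
    and scale: "\<And>c F. P F \<Longrightarrow> P (single 0 c * F)" and zero: "P 0"
  shows "P F"
proof -
  have "P (\<Sum>k\<in>A. single k (Poly_Mapping.lookup F k))"
    if "finite A" "A \<subseteq> Poly_Mapping.keys F" for A
    using that
  proof induction
    case (insert k A)
    then have "P (single 0 (Poly_Mapping.lookup F k) * single k 1)"
      using assms(1) by (intro scale word) (auto simp: Sym_def)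
    then show ?case using insert by (simp add: add flip: single_conv_scale)
  qed (simp add: zero)
  from this[of "Poly_Mapping.keys F"] show ?thesis
    by (simp flip: poly_mapping_conv_sum_single)
qed

text \<open>A matrix with one row is the row of its column sums. The case n = 0 is separate because
  \<open>S 0\<close> is the empty word and corresponds to a matrix without rows.\<close>

lemma S_star_S_word: "S n \<star> S_word J = (if sum_list J = n then S_word J else 0)"
proof -
  have *: "Dsum (\<lambda>m m'. if set m' \<subseteq> {0} then g m else 0) J = g J" for g :: "nat list \<Rightarrow> nsym"
  proof (induction J arbitrary: g)
    case (Cons j J)
    have "(\<Sum>a\<le>j. Dsum (\<lambda>m m'. if set ((j - a) # m') \<subseteq> {0} then g (a # m) else 0) J)
        = (\<Sum>a\<in>{j}. Dsum (\<lambda>m m'. if set ((j - a) # m') \<subseteq> {0} then g (a # m) else 0) J)"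
      by (rule sum.mono_neutral_right) auto
    then show ?case using Cons.IH[of "\<lambda>m. g (j # m)"] by (simp cong: if_cong)
  qed simp
  show ?thesis
  proof (cases "n = 0")
    case True
    have "single (0 :: composition) 1 \<star> S_word J = matrix_sum [] J"
      using single_star_S_word[of 0 J] by simp
    moreover have "S_word J = 1" if "set J \<subseteq> {0}"
      using that by (induction J) (auto simp: S_def)
    moreover have "set J \<subseteq> {0} \<longleftrightarrow> sum_list J = 0"
      by auto
    ultimately show ?thesis
      using True by (simp add: S_def matrix_sum_Nil)
  next
    case False
    then have "S n \<star> S_word J = matrix_sum [n] J"
      using S_word_star_S_word[of "[n]" J] by simp
    also have "\<dots> = Dsum (\<lambda>m m'. if set m' \<subseteq> {0} then if sum_list m = n then S_word m else 0 else 0) J"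
      unfolding matrix_sum_Cons matrix_sum_Nil by (intro Dsum_cong) simp
    finally show ?thesis unfolding * .
  qed
qed

lemma S_star:
  assumes "F \<in> Sym m"
  shows "S n \<star> F = (if m = n then F else 0)"
  using assms
proof (induction rule: Sym_induct)
  case (word I)
  then show ?case using S_star_S_word[of n "comp_parts I"] by (simp add: S_word_comp_parts)
qed (auto simp: lin_add[OF lin_star_right] lin_scale[OF lin_star_right]
      lin_0[OF lin_star_right])

lemma star_S:
  assumes "F \<in> Sym m"
  shows "F \<star> S n = (if m = n then F else 0)"
  using assms
proof (induction rule: Sym_induct)
  case (word I)
  have *: "matrix_sum I [n] = (if sum_list I = n then S_word I else 0)" for I n
  proof (induction I arbitrary: n)
    case (Cons i I)
    have "matrix_sum (i # I) [n] = (\<Sum>a\<le>n. if a = i then S i * matrix_sum I [n - i] else 0)"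
      unfolding matrix_sum_Cons by (auto simp: S_word_def intro!: sum.cong)
    then show ?case using Cons.IH by auto
  qed (auto simp: matrix_sum_Nil S_word_def)
  show ?case
    using single_star_S_word[of I "[n]"] word by (simp add: * S_word_comp_parts)
qed (auto simp: lin_add[OF lin_star_left] lin_scale[OF lin_star_left]
      lin_0[OF lin_star_left])

lemma star_Sym:
  assumes "F \<in> Sym n"
  shows "F \<star> G \<in> Sym n"
  using assms
proof (induction rule: Sym_induct)
  case (word I)
  have matrix_sum: "matrix_sum I J \<in> Sym (sum_list I)" for I J
  proof (induction I arbitrary: J)
    case (Cons i I)
    have "Dsum f J \<in> Sym n" if "\<And>m m'. f m m' \<in> Sym n" for f J n
      using that by (induction J arbitrary: f) (auto intro: Sym_sum)
    moreover have "S_word m * matrix_sum I m' \<in> Sym (i + sum_list I)" if "sum_list m = i" for m m'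
      using Sym_mult[OF S_word_Sym[of m] Cons.IH[of m']] that by simp
    ultimately show ?case unfolding matrix_sum_Cons by (auto simp: Sym_zero)
  qed (auto simp: matrix_sum_Nil Sym_one Sym_zero)
  have "single I 1 \<star> G = ext (\<lambda>J. matrix_sum (comp_parts I) (comp_parts J)) G"
    by (simp add: star_conv_ext)
  also have "\<dots> \<in> Sym n"
    unfolding ext_def using matrix_sum[of "comp_parts I"] word
    by (auto simp flip: nsym_scale_conv_mult intro!: Sym_sum Sym_scale)
  finally show ?case .
next
  case (scale c F)
  then show ?case
    using Sym_scale[of "F \<star> G" n c] by (simp add: lin_scale[OF lin_star_left] nsym_scale_conv_mult)
qed (simp_all add: lin_add[OF lin_star_left] lin_0[OF lin_star_left] Sym_zero Sym_add)

section \<open>Primitivity of the Zassenhaus elements\<close>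

definition prim :: "nsym \<Rightarrow> bool" where
  "prim F \<longleftrightarrow> coprod F = in1 F + in2 F"

lemma prim_zero: "prim 0"
  by (simp add: prim_def lin_0[OF lin_coprod] lin_0[OF lin_in1] lin_0[OF lin_in2])

lemma prim_commutator:
  assumes "prim F" "prim G"
  shows "prim (F * G - G * F)"
  using assms unfolding prim_def
  by (simp add: lin_diff[OF lin_coprod] lin_diff[OF lin_in1] lin_diff[OF lin_in2]
      coprod_mult in1_mult in2_mult in2_in1_commute algebra_simps)

section \<open>Group-like power series and exponentials\<close>

definition fps_map :: "('a \<Rightarrow> 'b) \<Rightarrow> 'a :: zero fps \<Rightarrow> 'b :: zero fps" where
  "fps_map h f = Abs_fps (\<lambda>n. h (fps_nth f n))"

lemma fps_map_nth [simp]: "fps_nth (fps_map h f) n = h (fps_nth f n)"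
  by (simp add: fps_map_def)

lemma fps_map_mult:
  fixes h :: "nsym \<Rightarrow> nsym2"
  assumes "lin h" "\<And>F G. h (F * G) = h F * h G"
  shows "fps_map h (f * g) = fps_map h f * fps_map h g"
  by (rule fps_ext) (simp add: fps_mult_nth lin_sum[OF assms(1)] assms(2))

text \<open>The series stands for an element of the completion by degree, with the coproduct taken
  coefficientwise; the equation is \<Delta> f = f \<otimes> f.\<close>

definition grouplike :: "nsym fps \<Rightarrow> bool" where
  "grouplike f \<longleftrightarrow> fps_map coprod f = fps_map in1 f * fps_map in2 f"

lemma grouplike_nth:
  "grouplike f \<Longrightarrow> coprod (fps_nth f n) = (\<Sum>j\<le>n. tens (fps_nth f j) (fps_nth f (n - j)))"
  unfolding grouplike_def
  by (drule arg_cong[of _ _ "\<lambda>f. fps_nth f n"]) (simp add: fps_mult_nth tens_def atLeast0AtMost)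

lemma grouplikeI:
  "(\<And>n. coprod (fps_nth f n) = (\<Sum>j\<le>n. tens (fps_nth f j) (fps_nth f (n - j)))) \<Longrightarrow> grouplike f"
  unfolding grouplike_def by (rule fps_ext) (simp add: fps_mult_nth tens_def atLeast0AtMost)

lemma grouplike_one: "grouplike 1"
proof (rule grouplikeI)
  fix n :: nat
  have "(\<Sum>j\<le>n. tens (fps_nth 1 j) (fps_nth 1 (n - j))) = (\<Sum>j\<in>{0}. tens (fps_nth 1 j) (fps_nth 1 (n - j)))"
    by (rule sum.mono_neutral_right) auto
  then show "coprod (fps_nth 1 n) = (\<Sum>j\<le>n. tens (fps_nth 1 j) (fps_nth 1 (n - j)))"
    by (simp add: lin_0[OF lin_coprod] lin_0[OF lin_in2] tens_one_left)
qed

lemma grouplike_mult: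
  assumes "grouplike f" "grouplike g"
  shows "grouplike (f * g)"
proof -
  have comm: "fps_map in2 f * fps_map in1 g = fps_map in1 g * fps_map in2 f"
  proof (rule fps_ext)
    fix n
    have "(\<Sum>i=0..n. in2 (fps_nth f i) * in1 (fps_nth g (n - i)))
        = (\<Sum>i=0..n. in2 (fps_nth f (n - i)) * in1 (fps_nth g i))"
      by (rule sum.reindex_bij_witness[of _ "\<lambda>i. n - i" "\<lambda>i. n - i"]) auto
    then show "fps_nth (fps_map in2 f * fps_map in1 g) n = fps_nth (fps_map in1 g * fps_map in2 f) n"
      by (simp add: fps_mult_nth in2_in1_commute)
  qed
  have "fps_map coprod (f * g) = fps_map in1 f * (fps_map in2 f * fps_map in1 g) * fps_map in2 g"
    using assms by (simp add: grouplike_def fps_map_mult[OF lin_coprod coprod_mult] mult.assoc)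
  also have "\<dots> = fps_map in1 (f * g) * fps_map in2 (f * g)"
    by (simp add: comm fps_map_mult[OF lin_in1 in1_mult] fps_map_mult[OF lin_in2 in2_mult] mult.assoc)
  finally show ?thesis by (simp add: grouplike_def)
qed

lemma binomial_commuting:
  fixes y z :: "'a :: ring_1"
  assumes "z * y = y * z"
  shows "(y + z) ^ k = (\<Sum>r\<le>k. of_nat (k choose r) * (y ^ r * z ^ (k - r)))"
proof (induction k)
  case (Suc k)
  have zy: "z * y ^ r = y ^ r * z" for r
    by (metis assms power_commuting_commutes)
  have lc: "x * (of_nat n * X) = of_nat n * (x * X)" for x X :: 'a and n
    by (metis mult.assoc mult_of_nat_commute)
  have "(y + z) ^ Suc k = (\<Sum>r\<le>k. (y + z) * (of_nat (k choose r) * (y ^ r * z ^ (k - r))))"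
    by (simp add: Suc sum_distrib_left)
  also have "\<dots> = (\<Sum>r\<le>k. of_nat (k choose r) * (y ^ Suc r * z ^ (k - r)))
      + (\<Sum>r\<le>k. of_nat (k choose r) * (y ^ r * z ^ (Suc k - r)))"
  proof (subst sum.distrib[symmetric], rule sum.cong[OF refl])
    fix r assume "r \<in> {..k}"
    then have "z ^ (Suc k - r) = z * z ^ (k - r)" by (simp add: Suc_diff_le)
    moreover have "z * (y ^ r * z ^ (k - r)) = y ^ r * (z * z ^ (k - r))"
      by (simp add: zy flip: mult.assoc)
    ultimately show "(y + z) * (of_nat (k choose r) * (y ^ r * z ^ (k - r)))
        = of_nat (k choose r) * (y ^ Suc r * z ^ (k - r)) + of_nat (k choose r) * (y ^ r * z ^ (Suc k - r))"
      by (simp add: distrib_right distrib_left lc mult.assoc)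
  qed
  also have "(\<Sum>r\<le>k. of_nat (k choose r) * (y ^ r * z ^ (Suc k - r)))
      = z ^ Suc k + (\<Sum>r\<le>k. of_nat (k choose Suc r) * (y ^ Suc r * z ^ (k - r)))"
  proof -
    have "(\<Sum>r\<le>k. of_nat (k choose r) * (y ^ r * z ^ (Suc k - r)))
        = (\<Sum>r\<le>Suc k. of_nat (k choose r) * (y ^ r * z ^ (Suc k - r)))"
      by (simp add: binomial_eq_0)
    then show ?thesis by (simp add: sum.atMost_Suc_shift del: sum.atMost_Suc)
  qed
  also have "(\<Sum>r\<le>k. of_nat (k choose r) * (y ^ Suc r * z ^ (k - r)))
       + (z ^ Suc k + (\<Sum>r\<le>k. of_nat (k choose Suc r) * (y ^ Suc r * z ^ (k - r))))
      = z ^ Suc k + (\<Sum>r\<le>k. of_nat (Suc k choose Suc r) * (y ^ Suc r * z ^ (k - r)))"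
    by (simp add: sum.distrib distrib_right algebra_simps)
  also have "\<dots> = (\<Sum>r\<le>Suc k. of_nat (Suc k choose r) * (y ^ r * z ^ (Suc k - r)))"
    by (simp add: sum.atMost_Suc_shift del: sum.atMost_Suc)
  finally show ?case .
qed simp

text \<open>Divided powers are the coefficients of the exponential;
  \<open>dpow_add_commuting\<close> is exp (y + z) = exp y exp z for commuting y and z.\<close>

definition dpow :: "nat \<Rightarrow> ('m :: monoid_add \<Rightarrow>\<^sub>0 complex) \<Rightarrow> 'm \<Rightarrow>\<^sub>0 complex" where
  "dpow k F = single 0 (1 / fact k) * F ^ k"

lemma dpow_0 [simp]: "dpow 0 F = 1" and dpow_1 [simp]: "dpow (Suc 0) F = F"
  by (simp_all add: dpow_def)

lemma dpow_add_commuting: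
  assumes "z * y = y * z"
  shows "dpow k (y + z) = (\<Sum>r\<le>k. dpow r y * dpow (k - r) z)"
proof -
  have "single 0 (1 / fact k) * (of_nat (k choose r) * (y ^ r * z ^ (k - r)))
      = dpow r y * dpow (k - r) z" if "r \<le> k" for r
  proof -
    have "(of_nat (k choose r) :: 'a \<Rightarrow>\<^sub>0 complex) = single 0 (of_nat (k choose r))"
      by simp
    moreover have "1 / fact k * of_nat (k choose r) = (1 / fact r * (1 / fact (k - r)) :: complex)"
      using that by (simp add: binomial_fact field_simps)
    ultimately show ?thesis
      by (simp only: dpow_def single_0_mult_mult mult.assoc single_0_left_commute[of "y ^ r"])
  qed
  then show ?thesis
    by (simp add: dpow_def[of k] binomial_commuting[OF assms] sum_distrib_left)
qed

lemma cexp_monom_nth: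
  assumes "i \<ge> 1"
  shows "fps_nth (cexp (fps_const a * fps_X ^ i)) m = (if i dvd m then dpow (m div i) a else 0)"
proof -
  have pow: "(fps_const a * fps_X ^ i) ^ k = fps_const (a ^ k) * fps_X ^ (i * k)" for k
  proof (induction k)
    case (Suc k)
    have "fps_X ^ i * fps_const (a ^ k) = fps_const (a ^ k) * fps_X ^ i"
      by (metis fps_mult_fps_X_power_commute)
    moreover have "fps_const a * fps_X ^ i * (fps_const (a ^ k) * fps_X ^ (i * k))
        = fps_const a * (fps_X ^ i * fps_const (a ^ k)) * fps_X ^ (i * k)"
      by (simp only: mult.assoc)
    ultimately have "fps_const a * fps_X ^ i * (fps_const (a ^ k) * fps_X ^ (i * k))
        = fps_const a * fps_const (a ^ k) * (fps_X ^ i * fps_X ^ (i * k))"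
      by (simp only: mult.assoc)
    then show ?case by (simp add: Suc power_add)
  qed simp
  have "fps_nth (cexp (fps_const a * fps_X ^ i)) m
      = (\<Sum>k\<le>m. nsym_scale (1 / fact k) (fps_nth ((fps_const a * fps_X ^ i) ^ k) m))"
    by (rule cexp_nth) (use assms in simp)
  also have "\<dots> = (\<Sum>k\<le>m. if m = i * k then dpow k a else 0)"
    unfolding pow zeta_term_nth by (intro sum.cong) (auto simp: dpow_def nsym_scale_conv_mult)
  also have "\<dots> = (if i dvd m then dpow (m div i) a else 0)"
  proof (cases "i dvd m")
    case True
    then obtain k where k: "m = i * k" by blast
    then have "(\<Sum>k\<le>m. if m = i * k then dpow k a else 0) = (\<Sum>k'\<in>{k}. if m = i * k' then dpow k' a else 0)"
      using assms by (intro sum.mono_neutral_right) auto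
    then show ?thesis using k assms by simp
  qed (auto intro!: sum.neutral)
  finally show ?thesis .
qed

lemma in1_dpow: "in1 (dpow k F) = dpow k (in1 F)"
proof -
  have "in1 (F ^ k) = in1 F ^ k" by (induction k) (simp_all add: in1_mult)
  then show ?thesis by (simp add: dpow_def lin_scale[OF lin_in1])
qed

lemma in2_dpow: "in2 (dpow k F) = dpow k (in2 F)"
proof -
  have "in2 (F ^ k) = in2 F ^ k" by (induction k) (simp_all add: in2_mult)
  then show ?thesis by (simp add: dpow_def lin_scale[OF lin_in2])
qed

lemma coprod_dpow: "coprod (dpow k F) = dpow k (coprod F)"
proof -
  have "coprod (F ^ k) = coprod F ^ k" by (induction k) (simp_all add: coprod_mult)
  then show ?thesis by (simp add: dpow_def lin_scale[OF lin_coprod])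
qed

text \<open>The coproduct of a primitive element is a sum of two commuting summands, so its
  exponential is the product of the exponentials of both.\<close>

lemma grouplike_cexp:
  assumes "prim a" "i \<ge> 1"
  shows "grouplike (cexp (fps_const a * fps_X ^ i))"
proof (rule grouplikeI)
  fix n
  let ?E = "\<lambda>m. if i dvd m then dpow (m div i) a else 0"
  have "coprod (?E n) = (\<Sum>j\<le>n. tens (?E j) (?E (n - j)))"
  proof (cases "i dvd n")
    case True
    then obtain k where k: "n = i * k" by blast
    have "(\<Sum>j\<le>n. tens (?E j) (?E (n - j))) = (\<Sum>j\<in>(*) i ` {..k}. tens (?E j) (?E (n - j)))"
      using assms(2) k by (intro sum.mono_neutral_right) (auto simp: dvd_def)
    also have "\<dots> = (\<Sum>r\<le>k. tens (dpow r a) (dpow (k - r) a))"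
      using assms(2) k
      by (subst sum.reindex) (auto simp: inj_on_def simp flip: diff_mult_distrib2)
    also have "\<dots> = dpow k (in1 a + in2 a)"
      by (simp add: dpow_add_commuting in2_in1_commute tens_def in1_dpow in2_dpow)
    finally show ?thesis using k assms by (simp add: coprod_dpow prim_def)
  next
    case False
    then have "tens (?E j) (?E (n - j)) = 0" if "j \<le> n" for j
      using that dvd_add[of i j "n - j"] by auto
    then show ?thesis using False by (simp add: lin_0[OF lin_coprod])
  qed
  then show "coprod (fps_nth (cexp (fps_const a * fps_X ^ i)) n) =
      (\<Sum>j\<le>n. tens (fps_nth (cexp (fps_const a * fps_X ^ i)) j)
         (fps_nth (cexp (fps_const a * fps_X ^ i)) (n - j)))"
    by (simp only: cexp_monom_nth[OF assms(2)])
qed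

lemma grouplike_zassenhaus_prod:
  assumes "\<And>i. 1 \<le> i \<Longrightarrow> i \<le> N \<Longrightarrow> prim (z i)"
  shows "grouplike (zassenhaus_prod z N)"
  using assms
  by (induction N)
     (auto simp: zassenhaus_prod_0 zassenhaus_prod_Suc grouplike_one intro!: grouplike_mult grouplike_cexp
        simp del: power_Suc)

lemma zeta_0: "zeta 0 = 0"
  and zeta_Sym: "zeta i \<in> Sym i"
  and zeta_Suc: "zeta (Suc m) = S (Suc m) - fps_nth (zassenhaus_prod zeta m) (Suc m)"
proof -
  show *: "zeta 0 = 0" "zeta (Suc m) = S (Suc m) - fps_nth (zassenhaus_prod zeta m) (Suc m)"
    using is_zassenhaus_zeta by (simp_all add: is_zassenhaus_iff)
  show "zeta i \<in> Sym i"
    using is_zassenhaus_zeta *(1) by (cases "i = 0") (auto simp: is_zassenhaus_iff Sym_zero)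
qed

lemma zassenhaus_prod_zeta_nth:
  assumes "m \<le> N"
  shows "fps_nth (zassenhaus_prod zeta N) m = S m"
proof (cases m)
  case 0
  then show ?thesis by (simp add: zassenhaus_prod_nth_0 S_def)
next
  case (Suc k)
  then show ?thesis
    using zassenhaus_prod_stable[OF assms, of zeta]
    by (simp add: zassenhaus_prod_Suc_nth zassenhaus_prod_nth_0 zeta_Suc)
qed

text \<open>By induction the product of the first m exponentials is group-like, and it agrees with
  the series of the \<open>S j\<close> in degrees up to m. So in the coproduct of the difference in
  degree m + 1 all mixed terms cancel and only the two end terms remain.\<close>

lemma prim_zeta: "prim (zeta n)"
proof (induction n rule: less_induct)
  case (less n)
  show ?case
  proof (cases n)
    case 0
    then show ?thesis by (simp add: zeta_0 prim_zero)
  next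
    case (Suc m)
    let ?Z = "fps_nth (zassenhaus_prod zeta m)"
    have "grouplike (zassenhaus_prod zeta m)"
      by (rule grouplike_zassenhaus_prod) (use less Suc in auto)
    from grouplike_nth[OF this, of n]
    have "coprod (zeta n) = (\<Sum>j\<le>n. tens (S j) (S (n - j))) - (\<Sum>j\<le>n. tens (?Z j) (?Z (n - j)))"
      by (simp add: Suc zeta_Suc lin_diff[OF lin_coprod] coprod_S del: sum.atMost_Suc)
    also have "\<dots> = (\<Sum>j\<in>{0, n}. tens (S j) (S (n - j)) - tens (?Z j) (?Z (n - j)))"
      unfolding sum_subtractf[symmetric]
      by (rule sum.mono_neutral_right) (auto simp: Suc zassenhaus_prod_zeta_nth)
    also have "\<dots> = in2 (S n) - in2 (?Z n) + (in1 (S n) - in1 (?Z n))"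
      using Suc by (simp add: zassenhaus_prod_nth_0 S_def[of 0] tens_one_left tens_one_right)
    finally show ?thesis
      by (simp add: prim_def Suc zeta_Suc lin_diff[OF lin_in1] lin_diff[OF lin_in2])
  qed
qed

section \<open>The basis of Zassenhaus words\<close>

text \<open>With \<open>z = zeta\<close> this is \<open>e_idem\<close>. The generators are a
  parameter so that algebra homomorphisms can be applied, by \<open>hom_emon\<close>.\<close>

definition emon :: "(nat \<Rightarrow> nsym) \<Rightarrow> nat multiset \<Rightarrow> nsym" where
  "emon z \<nu> = single 0 (1 / (\<Prod>i\<in>set_mset \<nu>. fact (count \<nu> i)))
     * prod_list (map z (sorted_list_of_multiset \<nu>))"

lemma e_idem_conv_emon: "e_idem \<nu> = emon zeta \<nu>"
  by (simp add: e_idem_def emon_def nsym_scale_conv_mult)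

lemma emon_add:
  assumes "\<And>x y. x \<in># \<mu> \<Longrightarrow> y \<in># \<nu> \<Longrightarrow> x < y"
  shows "emon z (\<mu> + \<nu>) = emon z \<mu> * emon z \<nu>"
proof -
  have "sorted (sorted_list_of_multiset \<mu> @ sorted_list_of_multiset \<nu>)"
    using assms by (auto simp: sorted_append less_imp_le)
  moreover have "\<mu> + \<nu> = mset (sorted_list_of_multiset \<mu> @ sorted_list_of_multiset \<nu>)"
    by simp
  ultimately have "sorted_list_of_multiset (\<mu> + \<nu>) = sorted_list_of_multiset \<mu> @ sorted_list_of_multiset \<nu>"
    by (simp only: sorted_list_of_multiset_mset sorted_sort_id)
  moreover have "(\<Prod>i\<in>set_mset (\<mu> + \<nu>). fact (count (\<mu> + \<nu>) i))
      = (\<Prod>i\<in>set_mset \<mu>. fact (count \<mu> i)) * (\<Prod>i\<in>set_mset \<nu>. fact (count \<nu> i) :: complex)"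
  proof -
    have disj: "set_mset \<mu> \<inter> set_mset \<nu> = {}" using assms by blast
    then have "count \<nu> i = 0" if "i \<in># \<mu>" for i using that by (metis disjoint_iff not_in_iff)
    moreover have "count \<mu> i = 0" if "i \<in># \<nu>" for i using that disj by (metis disjoint_iff not_in_iff)
    ultimately show ?thesis using disj by (simp add: prod.union_disjoint)
  qed
  moreover have "single 0 c * P * (single 0 d * Q)
      = single 0 (c * d) * (P * Q)" for c d and P Q :: nsym
    by (simp only: mult.assoc single_0_left_commute[of P] single_0_mult_mult)
  ultimately show ?thesis
    by (simp add: emon_def)
qed

lemma emon_replicate: "emon z (replicate_mset k a) = dpow k (z a)"
proof -
  have "sorted_list_of_multiset (mset (replicate k a)) = replicate k a"
    by (simp only: sorted_list_of_multiset_mset) (simp add: sorted_sort_id)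
  moreover have "prod_list (replicate k (z a)) = z a ^ k"
    by (induction k) simp_all
  ultimately show ?thesis by (cases "k = 0") (simp_all add: emon_def dpow_def)
qed

definition parts :: "nat \<Rightarrow> nat \<Rightarrow> nat multiset set" where
  "parts N m = {\<nu>. set_mset \<nu> \<subseteq> {1..N} \<and> sum_mset \<nu> = m}"

text \<open>The multiplicity of the largest part N + 1 is determined by the weight m - j that the
  smaller parts leave over. The factor it describes is the last one of the Zassenhaus
  product.\<close>

lemma parts_Suc_bij:
  "bij_betw (\<lambda>(j, \<nu>). \<nu> + replicate_mset ((m - j) div Suc N) (Suc N))
     (SIGMA j:{j \<in> {..m}. Suc N dvd m - j}. parts N j) (parts (Suc N) m)"
proof (rule bij_betw_byWitness[where f' = "\<lambda>\<nu>. (sum_mset (filter_mset (\<lambda>x. x \<le> N) \<nu>), filter_mset (\<lambda>x. x \<le> N) \<nu>)"])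
  have filt: "filter_mset (\<lambda>x. x \<le> N) \<nu> = \<nu>" if "set_mset \<nu> \<subseteq> {1..N}" for \<nu>
    using that by (auto simp: filter_mset_eq_conv)
  show "\<forall>x\<in>SIGMA j:{j \<in> {..m}. Suc N dvd m - j}. parts N j.
     (\<lambda>\<nu>. (sum_mset (filter_mset (\<lambda>x. x \<le> N) \<nu>), filter_mset (\<lambda>x. x \<le> N) \<nu>))
       ((\<lambda>(j, \<nu>). \<nu> + replicate_mset ((m - j) div Suc N) (Suc N)) x) = x"
    by (auto simp: parts_def filt)
  have split: "\<nu> = filter_mset (\<lambda>x. x \<le> N) \<nu> + replicate_mset (count \<nu> (Suc N)) (Suc N)"
    if "set_mset \<nu> \<subseteq> {1..Suc N}" for \<nu>
  proof (rule multiset_eqI)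
    fix x
    show "count \<nu> x = count (filter_mset (\<lambda>x. x \<le> N) \<nu> + replicate_mset (count \<nu> (Suc N)) (Suc N)) x"
      using that by (cases "x \<in># \<nu>") (auto simp: not_in_iff)
  qed
  have m: "m = sum_mset (filter_mset (\<lambda>x. x \<le> N) \<nu>) + count \<nu> (Suc N) * Suc N"
    if "\<nu> \<in> parts (Suc N) m" for \<nu>
    using arg_cong[OF split, of \<nu> sum_mset] that by (simp add: parts_def sum_mset_replicate_mset)
  show "\<forall>\<nu>\<in>parts (Suc N) m. (\<lambda>(j, \<nu>). \<nu> + replicate_mset ((m - j) div Suc N) (Suc N))
     (sum_mset (filter_mset (\<lambda>x. x \<le> N) \<nu>), filter_mset (\<lambda>x. x \<le> N) \<nu>) = \<nu>"
  proof
    fix \<nu> assume \<nu>: "\<nu> \<in> parts (Suc N) m"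
    have "(m - sum_mset (filter_mset (\<lambda>x. x \<le> N) \<nu>)) div Suc N = count \<nu> (Suc N)"
      using m[OF \<nu>] by (metis diff_add_inverse div_mult_self_is_m zero_less_Suc)
    then show "(\<lambda>(j, \<nu>). \<nu> + replicate_mset ((m - j) div Suc N) (Suc N))
       (sum_mset (filter_mset (\<lambda>x. x \<le> N) \<nu>), filter_mset (\<lambda>x. x \<le> N) \<nu>) = \<nu>"
      using split[of \<nu>] \<nu> by (simp add: parts_def)
  qed
  show "(\<lambda>(j, \<nu>). \<nu> + replicate_mset ((m - j) div Suc N) (Suc N)) `
      (SIGMA j:{j \<in> {..m}. Suc N dvd m - j}. parts N j) \<subseteq> parts (Suc N) m"
    by (auto simp: parts_def sum_mset_replicate_mset div_mult_self_is_m simp del: mult_Suc_right split: if_splits)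
  show "(\<lambda>\<nu>. (sum_mset (filter_mset (\<lambda>x. x \<le> N) \<nu>), filter_mset (\<lambda>x. x \<le> N) \<nu>)) ` parts (Suc N) m
      \<subseteq> (SIGMA j:{j \<in> {..m}. Suc N dvd m - j}. parts N j)"
  proof
    fix x assume "x \<in> (\<lambda>\<nu>. (sum_mset (filter_mset (\<lambda>x. x \<le> N) \<nu>), filter_mset (\<lambda>x. x \<le> N) \<nu>)) ` parts (Suc N) m"
    then obtain \<nu> where \<nu>: "\<nu> \<in> parts (Suc N) m"
      and x: "x = (sum_mset (filter_mset (\<lambda>x. x \<le> N) \<nu>), filter_mset (\<lambda>x. x \<le> N) \<nu>)" by blast
    let ?j = "sum_mset (filter_mset (\<lambda>x. x \<le> N) \<nu>)"
    have "?j \<le> m" "m - ?j = count \<nu> (Suc N) * Suc N"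
      using m[OF \<nu>] by linarith+
    moreover have "filter_mset (\<lambda>x. x \<le> N) \<nu> \<in> parts N ?j"
      using \<nu> by (auto simp: parts_def)
    ultimately show "x \<in> (SIGMA j:{j \<in> {..m}. Suc N dvd m - j}. parts N j)"
      unfolding x by (simp del: mult_Suc_right)
  qed
qed

lemma parts_0: "parts 0 m = (if m = 0 then {{#}} else {})"
  by (auto simp: parts_def)

lemma finite_parts: "finite (parts N m)"
proof (induction N arbitrary: m)
  case (Suc N)
  have "finite (SIGMA j:{j \<in> {..m}. Suc N dvd m - j}. parts N j)"
    by (intro finite_SigmaI Suc) auto
  then show ?case using bij_betw_finite[OF parts_Suc_bij] by blast
qed (simp add: parts_0)

lemma zassenhaus_prod_nth: "fps_nth (zassenhaus_prod z N) m = (\<Sum>\<nu>\<in>parts N m. emon z \<nu>)"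
proof (induction N arbitrary: m)
  case 0
  then show ?case by (simp add: zassenhaus_prod_0 parts_0 emon_def)
next
  case (Suc N)
  have "fps_nth (zassenhaus_prod z (Suc N)) m
      = (\<Sum>j\<le>m. fps_nth (zassenhaus_prod z N) j * (if Suc N dvd m - j then dpow ((m - j) div Suc N) (z (Suc N)) else 0))"
    unfolding zassenhaus_prod_Suc fps_mult_nth atLeast0AtMost
    by (simp only: cexp_monom_nth[of "Suc N"] le_add1 plus_1_eq_Suc)
  also have "\<dots> = (\<Sum>j\<in>{j \<in> {..m}. Suc N dvd m - j}. \<Sum>\<nu>\<in>parts N j. emon z \<nu> * dpow ((m - j) div Suc N) (z (Suc N)))"
    unfolding sum.inter_filter[OF finite_atMost] Suc
    by (intro sum.cong) (auto simp: sum_distrib_right)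
  also have "\<dots> = (\<Sum>(j, \<nu>)\<in>(SIGMA j:{j \<in> {..m}. Suc N dvd m - j}. parts N j).
      emon z (\<nu> + replicate_mset ((m - j) div Suc N) (Suc N)))"
  proof -
    have "emon z (\<nu> + replicate_mset k (Suc N)) = emon z \<nu> * dpow k (z (Suc N))"
      if "\<nu> \<in> parts N j" for j \<nu> k
      unfolding emon_replicate[symmetric] by (rule emon_add) (use that in \<open>auto simp: parts_def split: if_splits\<close>)
    then show ?thesis
      by (subst sum.Sigma) (auto simp: finite_parts intro!: sum.cong)
  qed
  also have "\<dots> = (\<Sum>\<nu>\<in>parts (Suc N) m. emon z \<nu>)"
    using sum.reindex_bij_betw[OF parts_Suc_bij, of "emon z" m N] by (simp add: case_prod_unfold)
  finally show ?case .
qed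

text \<open>The ordered product of exponentials expands into one term for each partition. As
  \<open>S n\<close> is the unit of degree n for \<star>, this becomes its decomposition into
  idempotents.\<close>

lemma S_conv_sum_e_idem: "S n = (\<Sum>\<nu>\<in>parts n n. e_idem \<nu>)"
  using zassenhaus_prod_zeta_nth[of n n] by (simp add: zassenhaus_prod_nth e_idem_conv_emon)

section \<open>Change of generators\<close>

definition letter :: "nat \<Rightarrow> nsym" where
  "letter i = (if i = 0 then 0 else S i)"

definition zword :: "nat list \<Rightarrow> nsym" where
  "zword w = prod_list (map zeta w)"

lemma zword_simps [simp]: "zword [] = 1" "zword (i # w) = zeta i * zword w" "zword (u @ v) = zword u * zword v"
  by (simp_all add: zword_def)

lemma zword_Sym: "zword w \<in> Sym (sum_list w)"
  by (induction w) (simp_all add: Sym_one Sym_mult zeta_Sym)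

definition to_zeta :: "nsym \<Rightarrow> nsym" where
  "to_zeta = ext (\<lambda>I. zword (comp_parts I))"

text \<open>What \<open>S n\<close> becomes when each \<open>zeta i\<close> in its expansion is
  replaced by a free generator, with \<open>letter 0 = 0\<close> to match \<open>zeta 0 = 0\<close>.
  Sending \<open>S n\<close> to it inverts \<open>to_zeta\<close>, so \<open>of_zeta\<close> reads
  off coordinates with respect to Zassenhaus words.\<close>

definition letter_S :: "nat \<Rightarrow> nsym" where
  "letter_S n = (\<Sum>\<nu>\<in>parts n n. emon letter \<nu>)"

definition of_zeta :: "nsym \<Rightarrow> nsym" where
  "of_zeta = ext (\<lambda>I. prod_list (map letter_S (comp_parts I)))"

lemma lin_to_zeta: "lin to_zeta" and lin_of_zeta: "lin of_zeta"
  by (simp_all add: to_zeta_def of_zeta_def lin_ext)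

lemma to_zeta_mult: "to_zeta (F * G) = to_zeta F * to_zeta G"
  unfolding to_zeta_def by (rule ext_mult) simp

lemma of_zeta_mult: "of_zeta (F * G) = of_zeta F * of_zeta G"
  unfolding of_zeta_def by (rule ext_mult) simp

lemma to_zeta_one [simp]: "to_zeta 1 = 1" and of_zeta_one [simp]: "of_zeta 1 = 1"
  unfolding to_zeta_def of_zeta_def by (simp_all add: ext_one)

lemma hom_prod_list:
  fixes h :: "nsym \<Rightarrow> nsym"
  assumes "h 1 = 1" "\<And>F G. h (F * G) = h F * h G"
  shows "h (prod_list (map z w)) = prod_list (map (\<lambda>i. h (z i)) w)"
  by (induction w) (simp_all add: assms)

lemma hom_emon:
  assumes "lin h" "h 1 = 1" "\<And>F G. h (F * G) = h F * h G"
  shows "h (emon z \<nu>) = emon (\<lambda>i. h (z i)) \<nu>"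
  by (simp add: emon_def lin_scale[OF assms(1)] hom_prod_list[OF assms(2,3)])

lemma to_zeta_letter: "to_zeta (letter i) = zeta i"
  by (simp add: letter_def S_def to_zeta_def zeta_0)

lemma to_zeta_letter_S: "to_zeta (letter_S n) = S n"
  by (simp add: letter_S_def lin_sum[OF lin_to_zeta] hom_emon[OF lin_to_zeta to_zeta_one to_zeta_mult]
      to_zeta_letter S_conv_sum_e_idem e_idem_conv_emon)

lemma of_zeta_S: "of_zeta (S n) = letter_S n"
proof (cases "n = 0")
  case True
  then show ?thesis by (simp add: S_def letter_S_def parts_0 emon_def)
qed (simp add: S_def of_zeta_def)

lemma to_zeta_of_zeta: "to_zeta (of_zeta F) = F"
proof (rule lin_eqI[where f = "\<lambda>F. to_zeta (of_zeta F)" and g = "\<lambda>F. F"])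
  fix I
  have "to_zeta (of_zeta (S_word J)) = S_word J" for J
    by (induction J) (simp_all add: of_zeta_mult to_zeta_mult of_zeta_S to_zeta_letter_S)
  then show "to_zeta (of_zeta (single I 1)) = single I 1"
    by (simp flip: S_word_comp_parts)
qed (intro lin_comp[OF lin_to_zeta] lin_of_zeta lin_id)+

lemma parts_lessI:
  assumes "\<nu> \<in> parts n n" "\<nu> \<noteq> {#n#}" "i \<in># \<nu>"
  shows "i < n"
proof -
  obtain \<mu> where \<mu>: "\<nu> = add_mset i \<mu>" using assms(3) by (meson multi_member_split)
  have "sum_mset \<mu> \<noteq> 0" if "\<mu> \<noteq> {#}"
  proof -
    obtain j where "j \<in># \<mu>" using \<open>\<mu> \<noteq> {#}\<close> by (meson multiset_nonemptyE)
    moreover have "j \<noteq> 0" using assms(1) \<mu> calculation by (auto simp: parts_def)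
    ultimately show ?thesis by (metis sum_mset_0_iff)
  qed
  then show ?thesis using assms(1,2) \<mu> by (cases "\<mu> = {#}") (auto simp: parts_def simp del: sum_mset_0_iff)
qed

lemma sum_emon_singleton:
  assumes "n \<ge> 1"
  shows "(\<Sum>\<nu>\<in>parts n n. emon z \<nu>) = z n + (\<Sum>\<nu>\<in>parts n n - {{#n#}}. emon z \<nu>)"
  using assms by (subst sum.remove[OF finite_parts, of "{#n#}"]) (auto simp: parts_def emon_def)

text \<open>In the expansion of \<open>S n\<close> only the partition with one part involves
  \<open>zeta n\<close>. The other terms involve smaller indices and are known by induction, so the
  comparison with \<open>letter_S n\<close> leaves \<open>letter n\<close>.\<close>

lemma of_zeta_zeta: "of_zeta (zeta n) = letter n"
proof (induction n rule: less_induct)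
  case (less n)
  show ?case
  proof (cases "n = 0")
    case True
    then show ?thesis by (simp add: zeta_0 letter_def lin_0[OF lin_of_zeta])
  next
    case False
    have "letter_S n = of_zeta (\<Sum>\<nu>\<in>parts n n. emon zeta \<nu>)"
      by (simp add: S_conv_sum_e_idem e_idem_conv_emon flip: of_zeta_S)
    also have "\<dots> = of_zeta (zeta n) + (\<Sum>\<nu>\<in>parts n n - {{#n#}}. emon (\<lambda>i. of_zeta (zeta i)) \<nu>)"
      using False by (simp add: sum_emon_singleton lin_add[OF lin_of_zeta] lin_sum[OF lin_of_zeta]
          hom_emon[OF lin_of_zeta of_zeta_one of_zeta_mult])
    also have "(\<Sum>\<nu>\<in>parts n n - {{#n#}}. emon (\<lambda>i. of_zeta (zeta i)) \<nu>)
        = (\<Sum>\<nu>\<in>parts n n - {{#n#}}. emon letter \<nu>)"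
    proof (rule sum.cong[OF refl])
      fix \<nu> assume "\<nu> \<in> parts n n - {{#n#}}"
      then have "map (\<lambda>i. of_zeta (zeta i)) (sorted_list_of_multiset \<nu>) = map letter (sorted_list_of_multiset \<nu>)"
        by (auto intro!: less parts_lessI)
      then show "emon (\<lambda>i. of_zeta (zeta i)) \<nu> = emon letter \<nu>" by (simp only: emon_def)
    qed
    finally show ?thesis using False by (simp add: letter_S_def sum_emon_singleton)
  qed
qed

lemma of_zeta_zword:
  assumes "0 \<notin> set w"
  shows "of_zeta (zword w) = single (Composition w) 1"
proof -
  have "of_zeta (zword w) = S_word w"
    using assms by (induction w) (auto simp: of_zeta_mult of_zeta_zeta letter_def)
  then show ?thesis using S_word_comp_parts[of "Composition w"] assms by simp
qed

text \<open>Zassenhaus words span because \<open>to_zeta\<close> is onto;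
  \<open>of_zeta_zword\<close> supplies their independence.\<close>

lemma lin_eqI_zword:
  assumes f: "lin f" and g: "lin g" and eq: "\<And>w. 0 \<notin> set w \<Longrightarrow> f (zword w) = g (zword w)"
  shows "f F = g F"
proof -
  have "f (to_zeta G) = g (to_zeta G)" for G
    by (rule lin_eqI[where f = "\<lambda>F. f (to_zeta F)" and g = "\<lambda>F. g (to_zeta F)"])
       (simp_all add: lin_comp[OF f lin_to_zeta] lin_comp[OF g lin_to_zeta], simp add: to_zeta_def eq comp_parts_nonzero)
  from this[of "of_zeta F"] show ?thesis by (simp add: to_zeta_of_zeta)
qed

section \<open>Products of brackets\<close>

text \<open>Left-normed brackets. The value at the empty list is 0 and not 1, so that every
  \<open>br w\<close> is primitive.\<close>

fun br :: "nat list \<Rightarrow> nsym" where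
  "br [] = 0"
| "br (a # ds) = foldl (\<lambda>Q d. Q * zeta d - zeta d * Q) (zeta a) ds"

lemma br_snoc: "ds \<noteq> [] \<Longrightarrow> br (ds @ [d]) = br ds * zeta d - zeta d * br ds"
  by (cases ds) simp_all

lemma prim_br: "prim (br w)"
proof (induction w rule: rev_induct)
  case (snoc d w)
  then show ?case
    by (cases "w = []") (simp_all add: br_snoc prim_commutator prim_zeta del: br.simps(2), simp add: prim_zeta)
qed (simp add: prim_zero)

lemma br_Sym: "br w \<in> Sym (sum_list w)"
proof (induction w rule: rev_induct)
  case (snoc d w)
  show ?case
  proof (cases "w = []")
    case False
    have "br w * zeta d + - (zeta d * br w) \<in> Sym (sum_list w + d)"
      using Sym_mult[OF snoc zeta_Sym[of d]] Sym_mult[OF zeta_Sym[of d] snoc]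
      by (intro Sym_add Sym_uminus) (simp_all add: add.commute)
    then show ?thesis using False by (simp add: br_snoc)
  qed (simp add: zeta_Sym)
qed (simp add: Sym_zero)

definition pr :: "nat list list \<Rightarrow> nsym" where
  "pr bs = prod_list (map br bs)"

lemma pr_simps [simp]: "pr [] = 1" "pr (w # bs) = br w * pr bs" "pr (bs @ cs) = pr bs * pr cs"
  by (simp_all add: pr_def)

lemma pr_singletons: "pr (map (\<lambda>a. [a]) w) = zword w"
  by (simp add: pr_def zword_def comp_def)

lemma pr_Sym: "pr bs \<in> Sym (sum_list (concat bs))"
  by (induction bs) (simp_all add: Sym_one Sym_mult br_Sym)

lemma coprod_pr: "coprod (pr bs) = Usum (\<lambda>u v. tens (pr u) (pr v)) bs"
proof (induction bs)
  case (Cons w bs)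
  have "in1 (br w) * Usum (\<lambda>u v. tens (pr u) (pr v)) bs = Usum (\<lambda>u v. tens (pr (w # u)) (pr v)) bs"
    by (subst Usum_hom) (simp_all add: distrib_left tens_mult flip: tens_one_right)
  moreover have "in2 (br w) * Usum (\<lambda>u v. tens (pr u) (pr v)) bs = Usum (\<lambda>u v. tens (pr u) (pr (w # v))) bs"
    by (subst Usum_hom) (simp_all add: distrib_left tens_mult flip: tens_one_left)
  ultimately show ?case
    using prim_br[of w] by (simp add: coprod_mult prim_def Cons distrib_right)
qed (simp add: tens_def)

text \<open>The working form of the splitting formula: each primitive factor goes undivided to K or
  to L.\<close>

lemma mult_star_pr:
  "(K * L) \<star> pr bs = Usum (\<lambda>u v. (K \<star> pr u) * (L \<star> pr v)) bs"
  by (simp add: mult_star coprod_pr Usum_hom[where h = "tprod K L", OF lin_add[OF lin_tprod]] tprod_tens)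

lemma S_star_pr: "S n \<star> pr bs = (if sum_list (concat bs) = n then pr bs else 0)"
  by (rule S_star[OF pr_Sym])

section \<open>Associativity of the internal product\<close>

lemma sum_concat_eq:
  assumes "mset u + mset v = mset (bs :: nat list list)"
  shows "sum_list (concat u) + sum_list (concat v) = sum_list (concat bs)"
proof -
  have "sum_list (concat cs) = sum_mset (image_mset sum_list (mset cs))" for cs :: "nat list list"
    by (induction cs) simp_all
  then show ?thesis using assms by (metis image_mset_union sum_mset.union)
qed

text \<open>A case of the compatibility of the coproduct with \<star>. A given unshuffle contributes
  only when c is the degree of its first half, so the total degree j is all that is left of the
  condition.\<close>

lemma coprod_S_star_pr:
  "coprod (S j \<star> pr bs) = (\<Sum>c\<le>j. Usum (\<lambda>u v. tens (S c \<star> pr u) (S (j - c) \<star> pr v)) bs)"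
proof -
  have "(\<Sum>c\<le>j. tens (S c \<star> pr u) (S (j - c) \<star> pr v))
      = (if sum_list (concat bs) = j then tens (pr u) (pr v) else 0)"
    if "mset u + mset v = mset bs" for u v
  proof -
    let ?a = "sum_list (concat u)" and ?b = "sum_list (concat v)"
    have eq: "?a + ?b = sum_list (concat bs)" by (rule sum_concat_eq[OF that])
    have "(\<Sum>c\<le>j. tens (S c \<star> pr u) (S (j - c) \<star> pr v))
        = (\<Sum>c\<le>j. if c = ?a then if ?b = j - ?a then tens (pr u) (pr v) else 0 else 0)"
      by (intro sum.cong) (auto simp: S_star_pr)
    also have "\<dots> = (if ?a \<le> j \<and> ?b = j - ?a then tens (pr u) (pr v) else 0)"
      by simp
    also have "?a \<le> j \<and> ?b = j - ?a \<longleftrightarrow> sum_list (concat bs) = j"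
      using eq by linarith
    finally show ?thesis .
  qed
  then have "(\<Sum>c\<le>j. Usum (\<lambda>u v. tens (S c \<star> pr u) (S (j - c) \<star> pr v)) bs)
      = Usum (\<lambda>u v. if sum_list (concat bs) = j then tens (pr u) (pr v) else 0) bs"
    by (subst Usum_sum[symmetric]) (rule Usum_cong)
  then show ?thesis
    by (simp add: S_star_pr coprod_pr lin_0[OF lin_coprod])
qed

lemma tens_Usum_left: "tens (Usum f xs) G = Usum (\<lambda>u v. tens (f u v) G) xs"
  by (rule Usum_hom[where h = "\<lambda>F. tens F G"]) (rule tens_add_left)

lemma tens_Usum_right: "tens F (Usum f xs) = Usum (\<lambda>u v. tens F (f u v)) xs"
  by (rule Usum_hom) (rule tens_add_right)

text \<open>Taking the coproduct after splitting off the letter j distributes the brackets over four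
  boxes; \<open>Usum_four\<close> regroups them by tensor factor.\<close>

lemma coprod_S_word_star_pr:
  "coprod (S_word J \<star> pr bs) = Dsum (\<lambda>m m'. Usum (\<lambda>u v. tens (S_word m \<star> pr u) (S_word m' \<star> pr v)) bs) J"
proof (induction J arbitrary: bs)
  case Nil
  show ?case using coprod_S_star_pr[of 0 bs] by (simp add: S_def)
next
  case (Cons j J)
  let ?T = "\<lambda>c m m' a1 a2 b1 b2. tens ((S c \<star> pr a1) * (S_word m \<star> pr b1)) ((S (j - c) \<star> pr a2) * (S_word m' \<star> pr b2))"
  have "coprod (S_word (j # J) \<star> pr bs) = Usum (\<lambda>a b. coprod (S j \<star> pr a) * coprod (S_word J \<star> pr b)) bs"
    by (simp add: mult_star_pr Usum_hom[where h = coprod, OF lin_add[OF lin_coprod]] coprod_mult)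
  also have "\<dots> = Usum (\<lambda>a b. \<Sum>c\<le>j. Dsum (\<lambda>m m'. Usum (\<lambda>a1 a2. Usum (\<lambda>b1 b2. ?T c m m' a1 a2 b1 b2) b) a) J) bs"
  proof (rule Usum_cong)
    fix a b
    have "tens F G * Dsum (\<lambda>m m'. Usum (\<lambda>u v. tens (S_word m \<star> pr u) (S_word m' \<star> pr v)) b) J
        = Dsum (\<lambda>m m'. Usum (\<lambda>u v. tens (F * (S_word m \<star> pr u)) (G * (S_word m' \<star> pr v))) b) J" for F G
      by (simp add: Dsum_hom[where h = "\<lambda>x. tens F G * x"] Usum_hom[where h = "\<lambda>x. tens F G * x"]
          distrib_left tens_mult)
    then have "Usum (\<lambda>a1 a2. tens (S c \<star> pr a1) (S (j - c) \<star> pr a2)) a *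
        Dsum (\<lambda>m m'. Usum (\<lambda>u v. tens (S_word m \<star> pr u) (S_word m' \<star> pr v)) b) J
      = Dsum (\<lambda>m m'. Usum (\<lambda>a1 a2. Usum (\<lambda>b1 b2. ?T c m m' a1 a2 b1 b2) b) a) J" for c
      by (simp add: Usum_hom[where h = "\<lambda>x. x * _"] distrib_right Usum_Dsum)
    then show "coprod (S j \<star> pr a) * coprod (S_word J \<star> pr b)
        = (\<Sum>c\<le>j. Dsum (\<lambda>m m'. Usum (\<lambda>a1 a2. Usum (\<lambda>b1 b2. ?T c m m' a1 a2 b1 b2) b) a) J)"
      by (simp add: coprod_S_star_pr Cons.IH sum_distrib_right)
  qed
  also have "\<dots> = (\<Sum>c\<le>j. Dsum (\<lambda>m m'. Usum (\<lambda>a b. Usum (\<lambda>a1 a2. Usum (\<lambda>b1 b2. ?T c m m' a1 a2 b1 b2) b) a) bs) J)"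
    by (simp add: Usum_sum Usum_Dsum)
  also have "\<dots> = (\<Sum>c\<le>j. Dsum (\<lambda>m m'. Usum (\<lambda>a b. Usum (\<lambda>a1 b1. Usum (\<lambda>a2 b2. ?T c m m' a1 a2 b1 b2) b) a) bs) J)"
    by (subst Usum_four) (rule refl)
  also have "\<dots> = (\<Sum>c\<le>j. Dsum (\<lambda>m m'. Usum (\<lambda>a b. tens (S_word (c # m) \<star> pr a) (S_word ((j - c) # m') \<star> pr b)) bs) J)"
  proof -
    have "Usum (\<lambda>a1 b1. Usum (\<lambda>a2 b2. ?T c m m' a1 a2 b1 b2) b) a
        = tens (S_word (c # m) \<star> pr a) (S_word ((j - c) # m') \<star> pr b)" for c m m' a b
      unfolding S_word_simps mult_star_pr tens_Usum_left
      unfolding tens_Usum_right ..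
    then show ?thesis by simp
  qed
  finally show ?case by simp
qed

text \<open>The splitting formula on both sides reduces the claim to a single letter
  \<open>S i\<close>, which is the projection to degree i.\<close>

lemma S_word_S_word_pr_assoc: "(S_word I \<star> S_word J) \<star> pr bs = S_word I \<star> (S_word J \<star> pr bs)"
proof -
  have S_assoc: "(S i \<star> S_word J) \<star> pr bs = S i \<star> (S_word J \<star> pr bs)" for i J bs
    using S_star[OF star_Sym[OF S_word_Sym[of J], of "pr bs"], of i]
    by (simp add: S_star_S_word lin_0[OF lin_star_left])
  show ?thesis
  proof (induction I arbitrary: J bs)
    case Nil
    show ?case using S_assoc[of 0] by (simp add: S_def)
  next
    case (Cons i I)
    have "(S_word (i # I) \<star> S_word J) \<star> pr bs = Dsum (\<lambda>m m'. ((S i \<star> S_word m) * (S_word I \<star> S_word m')) \<star> pr bs) J"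
      by (simp add: mult_star coprod_S_word tprod_tens
          Dsum_hom[where h = "tprod _ _", OF lin_0[OF lin_tprod] lin_add[OF lin_tprod]]
          Dsum_hom[where h = "\<lambda>F. F \<star> _", OF lin_0[OF lin_star_left] lin_add[OF lin_star_left]])
    also have "\<dots> = Dsum (\<lambda>m m'. Usum (\<lambda>u v. (S i \<star> (S_word m \<star> pr u)) * (S_word I \<star> (S_word m' \<star> pr v))) bs) J"
      by (simp add: mult_star_pr S_assoc Cons.IH)
    also have "\<dots> = S_word (i # I) \<star> (S_word J \<star> pr bs)"
      by (simp add: mult_star coprod_S_word_star_pr tprod_tens
          Dsum_hom[where h = "tprod _ _", OF lin_0[OF lin_tprod] lin_add[OF lin_tprod]]
          Usum_hom[where h = "tprod _ _", OF lin_add[OF lin_tprod]])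
    finally show ?case .
  qed
qed

text \<open>Zassenhaus words span, so the third factor may be a product of primitive elements; the
  matrix sums themselves never have to be composed.\<close>

theorem star_assoc: "(F \<star> G) \<star> H = F \<star> (G \<star> H)"
proof -
  note l = lin_star_left and r = lin_star_right
  have 1: "(S_word I \<star> S_word J) \<star> H = S_word I \<star> (S_word J \<star> H)" for I J
    by (rule lin_eqI_zword[OF r lin_comp[OF r r]]) (use S_word_S_word_pr_assoc in \<open>simp flip: pr_singletons\<close>)
  have 2: "(S_word I \<star> G) \<star> H = S_word I \<star> (G \<star> H)" for I
    by (rule lin_eqI[OF lin_comp[OF l r] lin_comp[OF r l]]) (simp add: 1 flip: S_word_comp_parts)
  show ?thesis
    by (rule lin_eqI[OF lin_comp[OF l l] l]) (simp add: 2 flip: S_word_comp_parts)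
qed

section \<open>The grading by content\<close>

lemma nsym_induct [case_names S_word add scale]:
  assumes "\<And>J. P (S_word J)" "\<And>F G. P F \<Longrightarrow> P G \<Longrightarrow> P (F + G)"
    "\<And>c F. P F \<Longrightarrow> P (nsym_scale c F)"
  shows "P F"
proof (induction F rule: poly_mapping_additive_induct)
  case (single k c)
  show ?case
    using assms(3)[OF assms(1)[of "comp_parts k"], of c]
    by (simp add: S_word_comp_parts nsym_scale_conv_mult mult_single)
qed (rule assms(2))

lemma nsym_lin_scale: "lin f \<Longrightarrow> f (nsym_scale c F) = nsym_scale c (f F)"
  for f :: "nsym \<Rightarrow> nsym"
  by (simp add: nsym_scale_conv_mult lin_scale)

lemma subspace_vimage:
  fixes f :: "nsym \<Rightarrow> nsym"
  assumes "lin f" "nsym.subspace V"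
  shows "nsym.subspace {x. f x \<in> V}"
  using assms by (auto simp: nsym.subspace_def lin_0 lin_add nsym_lin_scale)

lemma lin_span:
  fixes f :: "nsym \<Rightarrow> nsym"
  assumes "x \<in> nsym.span A" "lin f" "nsym.subspace V" "\<And>a. a \<in> A \<Longrightarrow> f a \<in> V"
  shows "f x \<in> V"
  using nsym.span_induct[OF assms(1) subspace_vimage[OF assms(2,3)]] assms(4) by blast

lemma bilin_span:
  fixes f :: "nsym \<Rightarrow> nsym \<Rightarrow> nsym"
  assumes "x \<in> nsym.span A" "y \<in> nsym.span B" "\<And>x. lin (f x)" "\<And>y. lin (\<lambda>x. f x y)"
    "nsym.subspace V" "\<And>a b. a \<in> A \<Longrightarrow> b \<in> B \<Longrightarrow> f a b \<in> V"
  shows "f x y \<in> V"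
  by (rule lin_span[OF assms(1,4,5)], rule lin_span[OF assms(2,3,5)], rule assms(6))

lemma subspace_zero: "nsym.subspace {0}"
  by (simp add: nsym.subspace_def nsym_scale_conv_mult)

lemma subspace_scale_cancel:
  assumes "nsym.subspace V" "nsym_scale c x \<in> V" "c \<noteq> 0"
  shows "x \<in> V"
  using nsym.subspace_scale[OF assms(1,2), of "1 / c"] assms(3) by simp

lemma Usum_subspace:
  assumes "nsym.subspace V" "\<And>u v. mset u + mset v = mset xs \<Longrightarrow> f u v \<in> V"
  shows "Usum f xs \<in> V"
  by (rule Usum_closed[OF assms(2)]) (auto intro: nsym.subspace_add[OF assms(1)])

text \<open>A letter \<open>S j\<close> keeps the factors that it receives, in their order, or
  annihilates them. So a word in these letters only rearranges the brackets.\<close>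

lemma star_pr_in_span:
  "F \<star> pr bs \<in> nsym.span {pr cs | cs. mset cs = mset bs}"
proof (induction F rule: nsym_induct)
  case (S_word J)
  show ?case
  proof (induction J arbitrary: bs)
    case Nil
    show ?case
      using S_star_pr[of 0 bs] by (auto simp: S_def intro: nsym.span_base nsym.span_zero)
  next
    case (Cons j J)
    have "(S j \<star> pr u) * (S_word J \<star> pr v) \<in> nsym.span {pr cs | cs. mset cs = mset bs}"
      if "mset u + mset v = mset bs" for u v
    proof (cases "sum_list (concat u) = j")
      case True
      have "pr u * pr cs \<in> nsym.span {pr cs | cs. mset cs = mset bs}" if "mset cs = mset v" for cs
        using that \<open>mset u + mset v = mset bs\<close>
        by (intro nsym.span_base CollectI exI[of _ "u @ cs"]) simp
      then show ?thesis
        using True lin_span[OF Cons.IH[of v] lin_mult_left[OF lin_id, of "pr u"] nsym.subspace_span]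
        by (auto simp: S_star_pr)
    qed (simp add: S_star_pr nsym.span_zero)
    then show ?case
      by (auto simp: mult_star_pr intro: Usum_subspace[OF nsym.subspace_span])
  qed
qed (simp_all add: lin_add[OF lin_star_left] nsym_lin_scale[OF lin_star_left]
      nsym.span_add nsym.span_scale)

definition content_space :: "nat multiset \<Rightarrow> nsym set" where
  "content_space \<nu> = nsym.span {zword w | w. mset w = \<nu>}"

lemma subspace_content_space: "nsym.subspace (content_space \<nu>)"
  by (simp add: content_space_def)

lemma star_content_space:
  assumes "x \<in> content_space \<nu>"
  shows "F \<star> x \<in> content_space \<nu>"
  using assms unfolding content_space_def
proof (rule lin_span[OF _ lin_star_right nsym.subspace_span])
  fix x assume "x \<in> {zword w | w. mset w = \<nu>}"
  then obtain w where w: "mset w = \<nu>" "x = zword w" by blast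
  have "pr cs \<in> {zword w | w. mset w = \<nu>}" if "mset cs = mset (map (\<lambda>a. [a]) w)" for cs
  proof -
    have "set cs = set (map (\<lambda>a. [a]) w)" using that by (metis set_mset_mset)
    then have cs: "cs = map (\<lambda>a. [a]) (map hd cs)"
      by (auto intro!: map_idI[symmetric] simp: comp_def)
    have "mset (map hd cs) = image_mset hd (mset (map (\<lambda>a. [a]) w))"
      using that by simp
    also have "\<dots> = \<nu>" using w(1) by (simp add: multiset.map_comp comp_def)
    finally show ?thesis
      using pr_singletons[of "map hd cs"] cs by auto
  qed
  then have "{pr cs | cs. mset cs = mset (map (\<lambda>a. [a]) w)} \<subseteq> {zword w | w. mset w = \<nu>}"
    by blast
  from subsetD[OF nsym.span_mono[OF this] star_pr_in_span]
  show "F \<star> x \<in> nsym.span {zword w | w. mset w = \<nu>}"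
    unfolding w(2) pr_singletons .
qed

lemma e_idem_conv_zword:
  "e_idem \<nu> = nsym_scale (1 / (\<Prod>i\<in>set_mset \<nu>. fact (count \<nu> i))) (zword (sorted_list_of_multiset \<nu>))"
  by (simp add: e_idem_def zword_def)

lemma e_idem_content_space: "e_idem \<nu> \<in> content_space \<nu>"
  unfolding e_idem_conv_zword content_space_def
  by (intro nsym.span_scale nsym.span_base) auto

section \<open>Content projections and idempotents\<close>

definition content_proj :: "nat multiset \<Rightarrow> nsym \<Rightarrow> nsym" where
  "content_proj \<nu> F = ext (\<lambda>I. if mset (comp_parts I) = \<nu> then zword (comp_parts I) else 0) (of_zeta F)"

lemma lin_content_proj: "lin (content_proj \<nu>)"
  unfolding content_proj_def by (rule lin_comp[OF lin_ext lin_of_zeta])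

lemma content_proj_zword:
  "0 \<notin> set w \<Longrightarrow> content_proj \<nu> (zword w) = (if mset w = \<nu> then zword w else 0)"
  by (simp add: content_proj_def of_zeta_zword)

lemma content_proj_content_space:
  assumes "x \<in> content_space \<mu>" "0 \<notin># \<mu>"
  shows "content_proj \<nu> x = (if \<mu> = \<nu> then x else 0)"
proof -
  have "lin (\<lambda>x. content_proj \<nu> x - (if \<mu> = \<nu> then x else 0))"
    by (cases "\<mu> = \<nu>") (auto intro!: lin_minus lin_content_proj lin_id lin_zero)
  then have "content_proj \<nu> x - (if \<mu> = \<nu> then x else 0) \<in> {0}"
    by (rule lin_span[OF assms(1)[unfolded content_space_def]])
       (use assms(2) in \<open>auto simp: content_proj_zword nsym.subspace_def nsym_scale_conv_mult\<close>)
  then show ?thesis by simp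
qed

lemma parts_no_zero: "\<nu> \<in> parts N n \<Longrightarrow> 0 \<notin># \<nu>"
  by (auto simp: parts_def)

lemma in_parts_iff: "\<nu> \<in> parts n n \<longleftrightarrow> 0 \<notin># \<nu> \<and> sum_mset \<nu> = n"
proof -
  have "x \<in># \<nu> \<Longrightarrow> x \<le> sum_mset \<nu>" for x
    by (metis le_add1 multi_member_split sum_mset.add_mset)
  then show ?thesis by (auto simp: parts_def not_less_eq_eq Suc_le_eq intro!: gr0I)
qed

text \<open>Expand F = F \<star> \<open>S n\<close> over the idempotents. Each term lies in its own
  content space, so the term of \<nu> is the component of content \<nu>.\<close>

lemma star_e_idem:
  assumes "F \<in> Sym n" "\<nu> \<in> parts n n"
  shows "F \<star> e_idem \<nu> = content_proj \<nu> F"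
proof -
  have "content_proj \<nu> F = content_proj \<nu> (F \<star> S n)"
    using assms(1) by (simp add: star_S)
  also have "\<dots> = (\<Sum>\<mu>\<in>parts n n. content_proj \<nu> (F \<star> e_idem \<mu>))"
    by (simp add: S_conv_sum_e_idem lin_sum[OF lin_star_right] lin_sum[OF lin_content_proj])
  also have "\<dots> = (\<Sum>\<mu>\<in>parts n n. if \<mu> = \<nu> then F \<star> e_idem \<mu> else 0)"
    by (intro sum.cong refl content_proj_content_space star_content_space e_idem_content_space
        parts_no_zero)
  finally show ?thesis using assms(2) by (simp add: finite_parts)
qed

lemma e_idem_Sym: "sum_mset \<nu> = n \<Longrightarrow> e_idem \<nu> \<in> Sym n"
  unfolding e_idem_conv_zword
  using zword_Sym[of "sorted_list_of_multiset \<nu>"]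
  by (auto intro: Sym_scale simp flip: sum_mset_sum_list)

lemma e_idem_orthogonal:
  assumes "\<mu> \<in> parts n n" "\<nu> \<in> parts n n"
  shows "e_idem \<mu> \<star> e_idem \<nu> = (if \<mu> = \<nu> then e_idem \<nu> else 0)"
  using star_e_idem[OF e_idem_Sym assms(2), of \<mu>]
    content_proj_content_space[OF e_idem_content_space parts_no_zero[OF assms(1)]] assms
  by (auto simp: in_parts_iff)

lemma star_diff_degree:
  assumes "F \<in> Sym m" "G \<in> Sym n" "m \<noteq> n"
  shows "F \<star> G = 0"
proof -
  have "F \<star> G = F \<star> (S m \<star> G)"
    using assms by (simp add: star_S flip: star_assoc)
  also have "\<dots> = 0"
    using assms by (simp add: S_star lin_0[OF lin_star_right])
  finally show ?thesis .
qed

section \<open>Lie elements\<close>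

text \<open>
  Lie monomials are combinations of left-normed brackets that start with any given one of their
  letters. The choice of a largest letter \<open>a\<close> ensures that in \<open>[Q, \<zeta>\<^sub>d]\<close> the degree of \<open>Q\<close> exceeds
  \<open>d\<close> unless the bracket is \<open>[\<zeta>\<^sub>a, \<zeta>\<^sub>a] = 0\<close>.
\<close>

definition valid :: "nat list \<Rightarrow> bool" where
  "valid w \<longleftrightarrow> w \<noteq> [] \<and> 0 \<notin> set w \<and> (\<forall>d\<in>set w. d \<le> hd w)"

definition Lie :: "nat multiset \<Rightarrow> nsym set" where
  "Lie \<nu> = nsym.span {br w | w. valid w \<and> mset w = \<nu>}"

text \<open>The strict bound on the number of factors makes \<open>Lprod 0\<close> trivial, even for content \<open>{#}\<close>.\<close>

definition Lprod :: "nat \<Rightarrow> nat multiset \<Rightarrow> nsym set" where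
  "Lprod s \<nu> = nsym.span {pr bs | bs. list_all valid bs \<and> mset (concat bs) = \<nu> \<and> length bs < s}"

lemma subspace_Lie: "nsym.subspace (Lie \<nu>)" and subspace_Lprod: "nsym.subspace (Lprod s \<nu>)"
  by (simp_all add: Lie_def Lprod_def)

lemma pr_in_Lprod:
  "list_all valid bs \<Longrightarrow> mset (concat bs) = \<nu> \<Longrightarrow> length bs < s \<Longrightarrow> pr bs \<in> Lprod s \<nu>"
  unfolding Lprod_def by (rule nsym.span_base) blast

lemma Lprod_mono: "s \<le> t \<Longrightarrow> Lprod s \<nu> \<subseteq> Lprod t \<nu>"
  unfolding Lprod_def by (rule nsym.span_mono) auto

lemma Lprod_0 [simp]: "Lprod 0 \<nu> = {0}"
  by (simp add: Lprod_def)

lemma Lie_subset_Lprod: "Lie \<nu> \<subseteq> Lprod 2 \<nu>"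
  unfolding Lie_def
proof (rule nsym.span_minimal[OF _ subspace_Lprod], safe)
  fix w assume "valid w"
  then show "br w \<in> Lprod 2 (mset w)" using pr_in_Lprod[of "[w]" "mset w" 2] by simp
qed

lemma Lprod_mult:
  assumes "x \<in> Lprod s \<mu>" "y \<in> Lprod t \<nu>"
  shows "x * y \<in> Lprod (s + t - 1) (\<mu> + \<nu>)"
proof (rule bilin_span[OF assms[unfolded Lprod_def] _ _ subspace_Lprod])
  show "\<And>x :: nsym. lin ((*) x)" "\<And>y :: nsym. lin (\<lambda>x. x * y)"
    by (intro lin_mult_left lin_mult_right lin_id)+
  fix a b assume "a \<in> {pr bs | bs. list_all valid bs \<and> mset (concat bs) = \<mu> \<and> length bs < s}"
    "b \<in> {pr bs | bs. list_all valid bs \<and> mset (concat bs) = \<nu> \<and> length bs < t}"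
  then obtain bs cs where "a = pr bs" "b = pr cs" "list_all valid (bs @ cs)" "length (bs @ cs) < s + t - 1"
    "mset (concat (bs @ cs)) = \<mu> + \<nu>" by auto
  then show "a * b \<in> Lprod (s + t - 1) (\<mu> + \<nu>)"
    using pr_in_Lprod[of "bs @ cs"] by simp
qed

lemma Lprod_mult':
  "x \<in> Lprod s \<mu> \<Longrightarrow> y \<in> Lprod t \<nu> \<Longrightarrow> s + t - 1 = r \<Longrightarrow> \<mu> + \<nu> = \<pi> \<Longrightarrow> x * y \<in> Lprod r \<pi>"
  using Lprod_mult by blast

lemma valid_snoc: "w \<noteq> [] \<Longrightarrow> valid (w @ [d]) \<longleftrightarrow> valid w \<and> d \<noteq> 0 \<and> d \<le> hd w"
  by (cases w) (auto simp: valid_def)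

lemma hd_max: "valid w \<Longrightarrow> d \<in># mset w \<Longrightarrow> d \<le> hd w"
  by (simp add: valid_def)

text \<open>Jacobi identity in the form [X, [Q, z]] = [[X, Q], z] - [[X, z], Q]. The larger head has
  to be that of w, so that letters of v may be appended without exceeding the first letter.\<close>

lemma br_commutator_in_Lie:
  assumes "valid w" "valid v" "hd v \<le> hd w"
  shows "br w * br v - br v * br w \<in> Lie (mset w + mset v)"
  using assms
proof (induction v arbitrary: w rule: rev_induct)
  case Nil
  then show ?case by (simp add: valid_def)
next
  case (snoc e v)
  show ?case
  proof (cases "v = []")
    case True
    then have "valid (w @ [e])" "mset (w @ [e]) = mset w + mset (v @ [e])"
      using snoc.prems by (auto simp: valid_snoc valid_def)
    moreover have "br w * br (v @ [e]) - br (v @ [e]) * br w = br (w @ [e])"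
      using True snoc.prems(1) by (simp add: br_snoc valid_def)
    ultimately show ?thesis
      unfolding Lie_def by (intro nsym.span_base CollectI exI[of _ "w @ [e]"] conjI) simp_all
  next
    case False
    then have v: "valid v" "e \<noteq> 0" "e \<le> hd v" "hd v \<le> hd w" and w: "w \<noteq> []"
      using snoc.prems by (auto simp: valid_snoc valid_def)
    let ?X = "br w" and ?Q = "br v" and ?z = "zeta e"
    have 1: "?X * ?Q - ?Q * ?X \<in> Lie (mset w + mset v)"
      by (rule snoc.IH) (use v snoc.prems in auto)
    have "x * ?z - ?z * x \<in> Lie (mset w + mset (v @ [e]))" if "x \<in> Lie (mset w + mset v)" for x
      using that unfolding Lie_def
    proof (rule lin_span[OF _ _ nsym.subspace_span])
      show "lin (\<lambda>x. x * ?z - ?z * x)"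
        by (intro lin_minus lin_mult_left lin_mult_right lin_id)
      fix a assume "a \<in> {br u | u. valid u \<and> mset u = mset w + mset v}"
      then obtain u where u: "a = br u" "valid u" "mset u = mset w + mset v" by blast
      \<comment> \<open>The head of u is its largest letter, and the letters of v, among them one
        that is at least e, occur in u.\<close>
      have "hd v \<in># mset u" using u(3) v(1) by (simp add: valid_def)
      then have "e \<le> hd u" using hd_max[OF u(2)] v(3) by (meson le_trans)
      moreover have "u \<noteq> []" using u(2) by (simp add: valid_def)
      ultimately have "valid (u @ [e])" "a * ?z - ?z * a = br (u @ [e])"
        "mset (u @ [e]) = mset w + mset (v @ [e])"
        using u v by (auto simp: valid_snoc br_snoc)
      then show "a * ?z - ?z * a \<in> nsym.span {br u | u. valid u \<and> mset u = mset w + mset (v @ [e])}"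
        by (intro nsym.span_base CollectI exI[of _ "u @ [e]"] conjI)
    qed
    from this[OF 1] have 2: "(?X * ?Q - ?Q * ?X) * ?z - ?z * (?X * ?Q - ?Q * ?X)
        \<in> Lie (mset w + mset (v @ [e]))" .
    have "valid (w @ [e])" using snoc.prems(1) v w by (auto simp: valid_snoc)
    then have "br (w @ [e]) * ?Q - ?Q * br (w @ [e]) \<in> Lie (mset (w @ [e]) + mset v)"
      by (rule snoc.IH) (use v w in auto)
    then have 3: "(?X * ?z - ?z * ?X) * ?Q - ?Q * (?X * ?z - ?z * ?X) \<in> Lie (mset w + mset (v @ [e]))"
      using w by (simp add: br_snoc)
    have "br w * br (v @ [e]) - br (v @ [e]) * br w
        = ((?X * ?Q - ?Q * ?X) * ?z - ?z * (?X * ?Q - ?Q * ?X))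
          - ((?X * ?z - ?z * ?X) * ?Q - ?Q * (?X * ?z - ?z * ?X))"
      using False by (simp add: br_snoc algebra_simps)
    then show ?thesis using nsym.subspace_diff[OF subspace_Lie 2 3] by simp
  qed
qed

lemma Lie_commutator:
  assumes "x \<in> Lie \<mu>" "y \<in> Lie \<nu>"
  shows "x * y - y * x \<in> Lie (\<mu> + \<nu>)"
proof (rule bilin_span[OF assms[unfolded Lie_def] _ _ subspace_Lie])
  show "\<And>x :: nsym. lin (\<lambda>y. x * y - y * x)" "\<And>y :: nsym. lin (\<lambda>x. x * y - y * x)"
    by (intro lin_minus lin_mult_left lin_mult_right lin_id)+
  fix a b assume "a \<in> {br w | w. valid w \<and> mset w = \<mu>}" "b \<in> {br w | w. valid w \<and> mset w = \<nu>}"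
  then obtain w v where w: "a = br w" "valid w" "mset w = \<mu>" and v: "b = br v" "valid v" "mset v = \<nu>"
    by blast
  show "a * b - b * a \<in> Lie (\<mu> + \<nu>)"
  proof (cases "hd v \<le> hd w")
    case True
    then show ?thesis using br_commutator_in_Lie[OF w(2) v(2)] w v by simp
  next
    case False
    then have "b * a - a * b \<in> Lie (\<nu> + \<mu>)"
      using br_commutator_in_Lie[OF v(2) w(2)] w v by simp
    then show ?thesis using nsym.subspace_neg[OF subspace_Lie] by (fastforce simp: add.commute)
  qed
qed

lemma br_in_Lie: "valid w \<Longrightarrow> br w \<in> Lie (mset w)"
  unfolding Lie_def by (rule nsym.span_base) blast

text \<open>Each exchange of neighbours costs a commutator that replaces two brackets by one Lie
  element.\<close>

lemma br_pr_commute: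
  assumes "valid w" "list_all valid cs"
  shows "br w * pr cs - pr cs * br w \<in> Lprod (Suc (length cs)) (mset w + mset (concat cs))"
  using assms(2)
proof (induction cs)
  case Nil
  show ?case by (simp add: nsym.subspace_0[OF subspace_Lprod])
next
  case (Cons c cs)
  have "(br w * br c - br c * br w) * pr cs \<in> Lprod (Suc (length (c # cs))) (mset w + mset (concat (c # cs)))"
  proof (rule Lprod_mult')
    show "br w * br c - br c * br w \<in> Lprod 2 (mset w + mset c)"
      using Lie_subset_Lprod Lie_commutator[OF br_in_Lie br_in_Lie] assms Cons.prems by auto
    show "pr cs \<in> Lprod (Suc (length cs)) (mset (concat cs))"
      using Cons.prems by (intro pr_in_Lprod) auto
  qed auto
  moreover have "br c * (br w * pr cs - pr cs * br w)
      \<in> Lprod (Suc (length (c # cs))) (mset w + mset (concat (c # cs)))"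
  proof (rule Lprod_mult'[OF _ Cons.IH])
    show "br c \<in> Lprod 2 (mset c)"
      using Lie_subset_Lprod br_in_Lie Cons.prems by auto
  qed (use Cons.prems in auto)
  ultimately have "(br w * br c - br c * br w) * pr cs + br c * (br w * pr cs - pr cs * br w)
      \<in> Lprod (Suc (length (c # cs))) (mset w + mset (concat (c # cs)))"
    by (rule nsym.subspace_add[OF subspace_Lprod])
  then show ?case by (simp add: algebra_simps)
qed

text \<open>Modulo products of fewer brackets, brackets commute.\<close>

lemma pr_perm:
  assumes "mset bs = mset cs" "list_all valid bs"
  shows "pr bs - pr cs \<in> Lprod (length bs) (mset (concat bs))"
  using assms
proof (induction bs arbitrary: cs)
  case Nil
  then show ?case by simp
next
  case (Cons w bs)
  then have "w \<in> set cs" by (metis list.set_intros(1) set_mset_mset)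
  then obtain c1 c2 where cs: "cs = c1 @ w # c2" by (meson split_list)
  have bs: "mset bs = mset (c1 @ c2)" using Cons.prems cs by simp
  have valid: "valid w" "list_all valid bs" "list_all valid c1" "list_all valid c2"
    using Cons.prems(2) mset_eq_setD[OF bs] by (auto simp: list_all_iff)
  have conc: "mset (concat bs) = mset (concat c1) + mset (concat c2)"
    using arg_cong[OF bs, of "\<lambda>M. \<Sum>\<^sub># (image_mset mset M)"]
    by (simp add: mset_concat flip: sum_mset_sum_list)
  have "br w * (pr bs - pr (c1 @ c2)) \<in> Lprod (length (w # bs)) (mset (concat (w # bs)))"
  proof (rule Lprod_mult'[OF _ Cons.IH[OF bs valid(2)]])
    show "br w \<in> Lprod 2 (mset w)"
      using Lie_subset_Lprod br_in_Lie[OF valid(1)] by auto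
  qed auto
  moreover have "(br w * pr c1 - pr c1 * br w) * pr c2 \<in> Lprod (length (w # bs)) (mset (concat (w # bs)))"
    by (rule Lprod_mult'[OF br_pr_commute[OF valid(1,3)] pr_in_Lprod[OF valid(4) refl lessI]])
       (use conc mset_eq_length[OF bs] in auto)
  ultimately have "br w * (pr bs - pr (c1 @ c2)) + (br w * pr c1 - pr c1 * br w) * pr c2
      \<in> Lprod (length (w # bs)) (mset (concat (w # bs)))"
    by (rule nsym.subspace_add[OF subspace_Lprod])
  then show ?case by (simp add: cs algebra_simps)
qed

section \<open>Words acting on products of brackets\<close>

lemma zeta_star_one: "zeta i \<star> 1 = 0"
proof (cases "i = 0")
  case False
  then show ?thesis using star_S[OF zeta_Sym[of i], of 0] by (simp add: S_def)
qed (simp add: zeta_0 lin_0[OF lin_star_left])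

lemma length_split: "mset u + mset v = mset bs \<Longrightarrow> length u + length v = length bs"
  by (metis mset_append mset_eq_length length_append)

text \<open>Every letter of I must receive at least one bracket, because \<open>zeta i\<close>
  annihilates 1.\<close>

lemma zword_star_short:
  "length bs < length I \<Longrightarrow> zword I \<star> pr bs = 0"
proof (induction I arbitrary: bs)
  case (Cons i I)
  have "(zeta i \<star> pr u) * (zword I \<star> pr v) = 0" if "mset u + mset v = mset bs" for u v
  proof (cases "u = []")
    case False
    have "length u + length v = length bs" using that by (rule length_split)
    then have "length v < length I" using False Cons.prems by (cases u) auto
    then show ?thesis by (simp add: Cons.IH)
  qed (simp add: zeta_star_one)
  then have "zword (i # I) \<star> pr bs = Usum (\<lambda>u v. 0) bs"
    unfolding zword_simps mult_star_pr by (rule Usum_cong)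
  then show ?case by simp
qed simp

lemma size_parts_ge_2:
  assumes "\<nu> \<in> parts n n" "\<nu> \<noteq> {#n#}" "n \<ge> 1"
  shows "size \<nu> \<ge> 2"
proof (rule ccontr)
  assume "\<not> size \<nu> \<ge> 2"
  then have "size \<nu> = 0 \<or> size \<nu> = 1" by linarith
  then consider "\<nu> = {#}" | a where "\<nu> = {#a#}" by (metis size_1_singleton_mset size_eq_0_iff_empty)
  then show False using assms by cases (auto simp: in_parts_iff)
qed

text \<open>\<open>S i\<close> is the sum of the \<open>e_idem \<nu>\<close>, and those with at
  least two letters annihilate a single bracket. So \<open>zeta i\<close> acts on it like the
  projection \<open>S i\<close>.\<close>

lemma zeta_star_br:
  assumes "i \<ge> 1"
  shows "zeta i \<star> br w = (if sum_list w = i then br w else 0)"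
proof -
  have "e_idem \<nu> \<star> br w = 0" if "\<nu> \<in> parts i i - {{#i#}}" for \<nu>
    using zword_star_short[of "[w]" "sorted_list_of_multiset \<nu>"] size_parts_ge_2[of \<nu> i] that assms
    by (simp add: e_idem_conv_zword nsym_lin_scale[OF lin_star_left] flip: size_mset)
  then have "S i \<star> br w = zeta i \<star> br w"
    using sum_emon_singleton[OF assms, of zeta]
    by (simp add: S_conv_sum_e_idem e_idem_conv_emon lin_add[OF lin_star_left]
        lin_sum[OF lin_star_left])
  then show ?thesis using S_star_pr[of i "[w]"] by simp
qed

section \<open>Words with as many letters as there are brackets\<close>

primrec picks :: "'a list \<Rightarrow> ('a \<times> 'a list) list" where
  "picks [] = []"
| "picks (x # xs) = (x, xs) # map (\<lambda>(y, ys). (y, x # ys)) (picks xs)"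

lemma picks_mset: "(x, ys) \<in> set (picks xs) \<Longrightarrow> mset xs = add_mset x (mset ys)"
  by (induction xs arbitrary: ys) auto

lemma picks_ex: "x \<in> set xs \<Longrightarrow> \<exists>ys. (x, ys) \<in> set (picks xs)"
  by (induction xs) (auto simp: image_iff, force)

lemma Usum_empty:
  assumes "\<And>u v. u \<noteq> [] \<Longrightarrow> mset u + mset v = mset xs \<Longrightarrow> f u v = 0"
  shows "Usum f xs = f [] xs"
  using assms
proof (induction xs arbitrary: f)
  case (Cons x xs)
  have "Usum (\<lambda>u v. f (x # u) v) xs = Usum (\<lambda>u v. 0) xs"
    by (rule Usum_cong) (simp add: Cons.prems)
  moreover have "Usum (\<lambda>u v. f u (x # v)) xs = f [] (x # xs)"
    by (rule Cons.IH) (simp add: Cons.prems)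
  ultimately show ?case by simp
qed simp

lemma Usum_picks:
  assumes "\<And>u v. length u \<noteq> 1 \<Longrightarrow> mset u + mset v = mset xs \<Longrightarrow> f u v = 0"
  shows "Usum f xs = (\<Sum>(x, ys)\<leftarrow>picks xs. f [x] ys)"
  using assms
proof (induction xs arbitrary: f)
  case (Cons x xs)
  have "Usum (\<lambda>u v. f (x # u) v) xs = f [x] xs"
    by (rule Usum_empty) (simp add: Cons.prems)
  moreover have "Usum (\<lambda>u v. f u (x # v)) xs = (\<Sum>(y, ys)\<leftarrow>picks xs. f [y] (x # ys))"
    by (rule Cons.IH) (simp add: Cons.prems)
  ultimately show ?case by (simp add: comp_def case_prod_unfold)
qed simp

text \<open>Each letter must receive a bracket and there is none to spare, so the first letter
  receives exactly one, of its own degree.\<close>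

lemma zword_Cons_star_same_length:
  assumes "length bs = Suc (length I)" "i \<ge> 1"
  shows "zword (i # I) \<star> pr bs
      = (\<Sum>(w, cs)\<leftarrow>picks bs. if sum_list w = i then br w * (zword I \<star> pr cs) else 0)"
proof -
  have "(zeta i \<star> pr u) * (zword I \<star> pr v) = 0" if "length u \<noteq> 1" "mset u + mset v = mset bs" for u v
  proof (cases "u = []")
    case False
    moreover have "length u > 1" using False that by (cases u) auto
    ultimately have "length v < length I" using length_split[OF that(2)] assms by simp
    then show ?thesis by (simp add: zword_star_short)
  qed (simp add: zeta_star_one)
  then have "zword (i # I) \<star> pr bs = (\<Sum>(w, cs)\<leftarrow>picks bs. (zeta i \<star> pr [w]) * (zword I \<star> pr cs))"
    unfolding zword_simps mult_star_pr by (rule Usum_picks)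
  also have "\<dots> = (\<Sum>(w, cs)\<leftarrow>picks bs. if sum_list w = i then br w * (zword I \<star> pr cs) else 0)"
    using zeta_star_br[OF assms(2)] by (intro arg_cong[of _ _ sum_list] map_cong) auto
  finally show ?thesis .
qed

text \<open>A list and not a set: equal brackets give the same arrangement repeatedly, and the
  repetitions are the coefficients.\<close>

fun arrangements :: "nat list \<Rightarrow> nat list list \<Rightarrow> nat list list list" where
  "arrangements [] bs = [[]]"
| "arrangements (i # I) bs =
     concat (map (\<lambda>(w, cs). if sum_list w = i then map ((#) w) (arrangements I cs) else []) (picks bs))"

lemma sum_list_concat_map: "sum_list (concat (map f xs)) = (\<Sum>x\<leftarrow>xs. sum_list (f x))"
  by (induction xs) simp_all

lemma zword_star_same_length:
  assumes "length I = length bs" "0 \<notin> set I"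
  shows "zword I \<star> pr bs = (\<Sum>cs\<leftarrow>arrangements I bs. pr cs)"
  using assms
proof (induction I arbitrary: bs)
  case Nil
  then show ?case using S_star_pr[of 0 "[]"] by (simp add: S_def)
next
  case (Cons i I)
  have "zword (i # I) \<star> pr bs = (\<Sum>(w, cs)\<leftarrow>picks bs. if sum_list w = i then br w * (zword I \<star> pr cs) else 0)"
    by (rule zword_Cons_star_same_length) (use Cons.prems in auto)
  also have "\<dots> = (\<Sum>(w, cs)\<leftarrow>picks bs.
      sum_list (map pr (if sum_list w = i then map ((#) w) (arrangements I cs) else [])))"
  proof (intro arg_cong[of _ _ sum_list] map_cong refl, clarify)
    fix w cs assume "(w, cs) \<in> set (picks bs)"
    from mset_eq_length[of bs "w # cs"] picks_mset[OF this] have "length I = length cs"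
      using Cons.prems by simp
    then have "zword I \<star> pr cs = (\<Sum>cs\<leftarrow>arrangements I cs. pr cs)"
      using Cons.prems by (intro Cons.IH) auto
    then show "(if sum_list w = i then br w * (zword I \<star> pr cs) else 0)
        = sum_list (map pr (if sum_list w = i then map ((#) w) (arrangements I cs) else []))"
      by (simp add: comp_def sum_list_const_mult)
  qed
  finally show ?case
    by (simp add: map_concat sum_list_concat_map comp_def case_prod_unfold)
qed

lemma mset_arrangements:
  "length I = length bs \<Longrightarrow> cs \<in> set (arrangements I bs) \<Longrightarrow> mset cs = mset bs"
proof (induction I arbitrary: bs cs)
  case (Cons i I)
  then obtain w ds es where *: "(w, ds) \<in> set (picks bs)" "cs = w # es" "es \<in> set (arrangements I ds)"
    by (auto split: if_splits)
  have "length I = length ds"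
    using mset_eq_length[of bs "w # ds"] picks_mset[OF *(1)] Cons.prems by simp
  then show ?case using Cons.IH[OF _ *(3)] picks_mset[OF *(1)] *(2) by simp
qed simp

lemma arrangements_nonempty_iff:
  "length I = length bs \<Longrightarrow> arrangements I bs \<noteq> [] \<longleftrightarrow> mset I = mset (map sum_list bs)"
proof (induction I arbitrary: bs)
  case (Cons i I)
  have *: "arrangements I cs \<noteq> [] \<longleftrightarrow> mset (i # I) = mset (map sum_list bs)"
    if "(w, cs) \<in> set (picks bs)" "sum_list w = i" for w cs
  proof -
    have "length I = length cs"
      using mset_eq_length[of bs "w # cs"] picks_mset[OF that(1)] Cons.prems by simp
    then show ?thesis
      using Cons.IH picks_mset[OF that(1)] that(2) by simp
  qed
  have "arrangements (i # I) bs \<noteq> [] \<longleftrightarrow>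
      (\<exists>(w, cs)\<in>set (picks bs). sum_list w = i \<and> arrangements I cs \<noteq> [])"
    by (force split: if_splits)
  also have "\<dots> \<longleftrightarrow> mset (i # I) = mset (map sum_list bs)"
  proof
    assume eq: "mset (i # I) = mset (map sum_list bs)"
    then have "i \<in> set (map sum_list bs)" by (metis list.set_intros(1) set_mset_mset)
    then obtain w where w: "w \<in> set bs" "sum_list w = i" by auto
    from picks_ex[OF w(1)] obtain cs where "(w, cs) \<in> set (picks bs)" by blast
    then show "\<exists>(w, cs)\<in>set (picks bs). sum_list w = i \<and> arrangements I cs \<noteq> []"
      using * w(2) eq by fast
  qed (use * in fast)
  finally show ?case .
qed simp

lemma sum_list_mset_diff_in_subspace:
  assumes "nsym.subspace V" "\<And>x. x \<in> set xs \<Longrightarrow> f x - g \<in> V"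
  shows "sum_list (map f xs) - nsym_scale (of_nat (length xs)) g \<in> V"
  using assms(2)
proof (induction xs)
  case (Cons x xs)
  have "sum_list (map f (x # xs)) - nsym_scale (of_nat (length (x # xs))) g
      = (f x - g) + (sum_list (map f xs) - nsym_scale (of_nat (length xs)) g)"
    by (simp add: nsym.scale_left_distrib)
  also have "\<dots> \<in> V"
    by (rule nsym.subspace_add[OF assms(1)]) (use Cons in auto)
  finally show ?case .
qed (use nsym.subspace_0[OF assms(1)] in simp)

lemma sum_list_valid_pos: "valid w \<Longrightarrow> sum_list w > 0"
  by (cases w) (auto simp: valid_def)

lemma sum_list_valid: "list_all valid bs \<Longrightarrow> 0 \<notin> set (map sum_list bs)"
proof
  assume "list_all valid bs" "0 \<in> set (map sum_list bs)"
  then obtain w where "valid w" "sum_list w = 0" by (auto simp: list_all_iff)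
  then show False using sum_list_valid_pos[of w] by linarith
qed

text \<open>
  Let \<open>\<kappa>\<close> consist of the degrees of \<open>r \<ge> 2\<close> brackets. Then \<open>e\<^sub>\<kappa>\<close> multiplies their product by a nonzero
  number modulo products of fewer brackets, and \<open>\<zeta>\<^sub>i\<close> annihilates \<open>e\<^sub>\<kappa>\<close>.
\<close>

lemma zeta_star_pr_in_Lie:
  assumes "list_all valid bs" "bs \<noteq> []"
  shows "zeta i \<star> pr bs \<in> Lie (mset (concat bs))"
  using assms
proof (induction "length bs" arbitrary: bs rule: less_induct)
  case less
  let ?n = "sum_list (concat bs)"
  consider "i \<noteq> ?n" | w where "bs = [w]" "i = ?n" | "length bs \<ge> 2" "i = ?n"
  proof -
    have "\<exists>w. bs = [w]" if "\<not> length bs \<ge> 2"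
      using that less.prems(2) by (cases bs) (auto simp: not_le less_Suc_eq)
    then show thesis using that by blast
  qed
  then show ?case
  proof cases
    case 1
    then show ?thesis
      using star_diff_degree[OF zeta_Sym pr_Sym] nsym.subspace_0[OF subspace_Lie] by simp
  next
    case (2 w)
    then have "valid w" using less.prems by simp
    then have "i \<ge> 1" using 2 sum_list_valid_pos[of w] by simp
    then show ?thesis using 2 zeta_star_br[of i w] br_in_Lie[OF \<open>valid w\<close>] by simp
  next
    case 3
    let ?V = "Lie (mset (concat bs))"
    define \<kappa> where "\<kappa> = mset (map sum_list bs)"
    define I where "I = sorted_list_of_multiset \<kappa>"
    have \<kappa>: "\<kappa> \<in> parts i i" "size \<kappa> \<ge> 2"
      using sum_list_valid[OF less.prems(1)] 3 sum_mset_sum_list[of "map sum_list bs"]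
      by (auto simp: \<kappa>_def in_parts_iff sum_mset_sum_list sum_list_concat_map[of "\<lambda>x. x", simplified])
    have I: "length I = length bs" "0 \<notin> set I" "mset I = mset (map sum_list bs)"
      using sum_list_valid[OF less.prems(1)] by (auto simp: I_def \<kappa>_def simp flip: size_mset)
    have "i \<noteq> 0"
      using \<kappa> by (metis in_parts_iff sum_mset_0_iff multiset_nonemptyE size_empty not_numeral_le_zero)
    then have "{#i#} \<in> parts i i" by (simp add: in_parts_iff)
    then have "e_idem {#i#} \<star> e_idem \<kappa> = 0"
      using e_idem_orthogonal[OF _ \<kappa>(1)] \<kappa>(2) by auto
    moreover have "e_idem {#i#} = zeta i" by (simp add: e_idem_def)
    moreover have "(\<Prod>i\<in>set_mset \<kappa>. fact (count \<kappa> i)) \<noteq> (0 :: complex)" by simp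
    ultimately have "zeta i \<star> zword I = 0"
      by (simp add: e_idem_conv_zword I_def nsym_lin_scale[OF lin_star_right])
    then have "zeta i \<star> (zword I \<star> pr bs) = 0"
      by (simp add: lin_0[OF lin_star_left] flip: star_assoc)
    then have 0: "(\<Sum>cs\<leftarrow>arrangements I bs. zeta i \<star> pr cs) = 0"
    proof -
      have "zeta i \<star> sum_list (map pr xs) = (\<Sum>cs\<leftarrow>xs. zeta i \<star> pr cs)" for xs
        by (induction xs) (simp_all add: lin_0[OF lin_star_right] lin_add[OF lin_star_right])
      then show ?thesis
        using \<open>zeta i \<star> (zword I \<star> pr bs) = 0\<close> zword_star_same_length[OF I(1,2)] by simp
    qed
    have "zeta i \<star> x \<in> ?V" if "x \<in> Lprod (length bs) (mset (concat bs))" for x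
      using that unfolding Lprod_def
    proof (rule lin_span[OF _ lin_star_right subspace_Lie])
      fix a assume "a \<in> {pr cs | cs. list_all valid cs \<and> mset (concat cs) = mset (concat bs) \<and> length cs < length bs}"
      then obtain cs where cs: "a = pr cs" "list_all valid cs" "mset (concat cs) = mset (concat bs)"
        "length cs < length bs" by blast
      have "concat bs \<noteq> []" using less.prems by (auto simp: list_all_iff valid_def neq_Nil_conv)
      then have "cs \<noteq> []" using cs(3) by auto
      then show "zeta i \<star> a \<in> ?V" using less.hyps[OF cs(4,2)] cs(1,3) by simp
    qed
    then have "zeta i \<star> pr cs - zeta i \<star> pr bs \<in> ?V" if "cs \<in> set (arrangements I bs)" for cs
    proof -
      have "zeta i \<star> (pr bs - pr cs) \<in> ?V"
        using that \<open>\<And>x. x \<in> Lprod _ _ \<Longrightarrow> _\<close> pr_perm[OF _ less.prems(1)] mset_arrangements[OF I(1)] by metis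
      then show ?thesis
        using nsym.subspace_neg[OF subspace_Lie] by (fastforce simp: lin_diff[OF lin_star_right])
    qed
    \<comment> \<open>The sum over the arrangements is 0 and each summand agrees with
      \<open>zeta i \<star> pr bs\<close> modulo \<open>?V\<close>, so a positive integer multiple
      of the latter lies in \<open>?V\<close>.\<close>
    then have "0 - nsym_scale (of_nat (length (arrangements I bs))) (zeta i \<star> pr bs) \<in> ?V"
      using sum_list_mset_diff_in_subspace[OF subspace_Lie, of "arrangements I bs" "\<lambda>cs. zeta i \<star> pr cs"] 0
      by simp
    moreover have "length (arrangements I bs) \<noteq> 0"
      using arrangements_nonempty_iff[OF I(1)] I(3) by simp
    ultimately show ?thesis
      using nsym.subspace_neg[OF subspace_Lie] by (fastforce intro: subspace_scale_cancel[OF subspace_Lie])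
  qed
qed

text \<open>The empty product \<open>pr []\<close> is 1, which is not a Lie element. Annihilating it
  removes all terms of a commutator in which one half of the unshuffle is empty.\<close>

definition Lie_valued :: "nsym \<Rightarrow> bool" where
  "Lie_valued X \<longleftrightarrow> X \<star> 1 = 0 \<and>
     (\<forall>bs. list_all valid bs \<longrightarrow> bs \<noteq> [] \<longrightarrow> X \<star> pr bs \<in> Lie (mset (concat bs)))"

lemma Lie_valued_zeta: "Lie_valued (zeta i)"
  by (simp add: Lie_valued_def zeta_star_one zeta_star_pr_in_Lie)

text \<open>Cocommutativity, as \<open>Usum_flip\<close>, lets both halves of the commutator run
  over the same unshuffles, so that the values are commutated term by term.\<close>

lemma commutator_star_pr:
  "(X * Y - Y * X) \<star> pr bs = Usum (\<lambda>u v. (X \<star> pr u) * (Y \<star> pr v) - (Y \<star> pr v) * (X \<star> pr u)) bs"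
proof -
  have "(X * Y - Y * X) \<star> pr bs = Usum (\<lambda>u v. (X \<star> pr u) * (Y \<star> pr v)) bs
      - Usum (\<lambda>u v. (Y \<star> pr v) * (X \<star> pr u)) bs"
    by (simp add: lin_diff[OF lin_star_left] mult_star_pr
        Usum_flip[of "\<lambda>u v. (Y \<star> pr u) * (X \<star> pr v)"])
  also have "\<dots> = Usum (\<lambda>u v. (X \<star> pr u) * (Y \<star> pr v)) bs
      + Usum (\<lambda>u v. - ((Y \<star> pr v) * (X \<star> pr u))) bs"
    using Usum_hom[of uminus "\<lambda>u v. (Y \<star> pr v) * (X \<star> pr u)" bs] by simp
  finally show ?thesis by (simp flip: Usum_add)
qed

lemma mset_concat_split:
  assumes "mset u + mset v = mset (bs :: 'a list list)"
  shows "mset (concat u) + mset (concat v) = mset (concat bs)"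
proof -
  have "mset (concat cs) = \<Sum>\<^sub># (image_mset mset (mset cs))" for cs :: "'a list list"
    by (induction cs) simp_all
  then show ?thesis using assms by (metis image_mset_union sum_mset.union)
qed

lemma list_all_split:
  assumes "mset u + mset v = mset bs"
  shows "list_all P bs \<longleftrightarrow> list_all P u \<and> list_all P v"
proof -
  have "set bs = set u \<union> set v" using assms by (metis set_mset_mset set_mset_union)
  then show ?thesis by (auto simp: list_all_iff)
qed

lemma Lie_valued_commutator:
  assumes "Lie_valued X" "Lie_valued Y"
  shows "Lie_valued (X * Y - Y * X)"
    and "length bs < 2 \<Longrightarrow> (X * Y - Y * X) \<star> pr bs = 0"
proof -
  show 1: "(X * Y - Y * X) \<star> pr bs = 0" if "length bs < 2" for bs
  proof -
    have "(X * Y - Y * X) \<star> pr bs = Usum (\<lambda>u v. 0) bs"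
      unfolding commutator_star_pr
    proof (rule Usum_cong)
      fix u v assume "mset u + mset v = mset bs"
      then have "u = [] \<or> v = []" using that length_split[of u v bs] by (cases u; cases v) auto
      then show "(X \<star> pr u) * (Y \<star> pr v) - (Y \<star> pr v) * (X \<star> pr u) = 0"
        using assms by (auto simp: Lie_valued_def)
    qed
    then show ?thesis by simp
  qed
  have "(X * Y - Y * X) \<star> pr bs \<in> Lie (mset (concat bs))" if "list_all valid bs" for bs
    unfolding commutator_star_pr
  proof (rule Usum_subspace[OF subspace_Lie])
    fix u v assume uv: "mset u + mset v = mset bs"
    show "(X \<star> pr u) * (Y \<star> pr v) - (Y \<star> pr v) * (X \<star> pr u) \<in> Lie (mset (concat bs))"
    proof (cases "u = [] \<or> v = []")
      case True
      then show ?thesis using assms nsym.subspace_0[OF subspace_Lie] by (auto simp: Lie_valued_def)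
    next
      case False
      then show ?thesis
        using assms Lie_commutator[of "X \<star> pr u" _ "Y \<star> pr v"] that
        by (simp add: Lie_valued_def list_all_split[OF uv] flip: mset_concat_split[OF uv])
    qed
  qed
  then show "Lie_valued (X * Y - Y * X)"
    using 1[of "[]"] by (simp add: Lie_valued_def)
qed

lemma Lie_valued_br: "w \<noteq> [] \<Longrightarrow> Lie_valued (br w)"
proof (induction w rule: rev_induct)
  case (snoc d w)
  then show ?case
    using Lie_valued_commutator(1)[OF _ Lie_valued_zeta, of "br w" d]
    by (cases "w = []") (simp_all add: br_snoc Lie_valued_zeta)
qed simp

lemma star_pr_in_Lprod:
  assumes "list_all valid bs"
  shows "F \<star> pr bs \<in> Lprod (Suc (length bs)) (mset (concat bs))"
proof -
  have "pr cs \<in> Lprod (Suc (length bs)) (mset (concat bs))" if "mset cs = mset bs" for cs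
    using that assms list_all_split[of cs "[]" bs] mset_concat_split[of cs "[]" bs] length_split[of cs "[]" bs]
    by (intro pr_in_Lprod) simp_all
  then have "{pr cs | cs. mset cs = mset bs} \<subseteq> Lprod (Suc (length bs)) (mset (concat bs))"
    by blast
  then show ?thesis
    using star_pr_in_span nsym.span_minimal[OF _ subspace_Lprod] by blast
qed

lemma star_Lprod:
  assumes "x \<in> Lprod s \<nu>"
  shows "F \<star> x \<in> Lprod s \<nu>"
proof (rule lin_span[OF assms[unfolded Lprod_def] lin_star_right subspace_Lprod])
  fix a assume "a \<in> {pr bs | bs. list_all valid bs \<and> mset (concat bs) = \<nu> \<and> length bs < s}"
  then obtain bs where bs: "a = pr bs" "list_all valid bs" "mset (concat bs) = \<nu>" "Suc (length bs) \<le> s"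
    by auto
  then show "F \<star> a \<in> Lprod s \<nu>"
    using star_pr_in_Lprod[OF bs(2), of F] Lprod_mono[OF bs(4)] by blast
qed

text \<open>The commutator annihilates fewer than two brackets and turns more of them into one Lie
  element, while K and L do not increase the number of factors. So at least one factor is
  lost.\<close>

lemma commutator_star_in_Lprod:
  assumes "Lie_valued X" "Lie_valued Y" "list_all valid bs"
  shows "(K * (X * Y - Y * X) * L) \<star> pr bs \<in> Lprod (length bs) (mset (concat bs))"
proof -
  have C: "(X * Y - Y * X) \<star> pr b \<in> Lprod (length b) (mset (concat b))" if "list_all valid b" for b
  proof (cases "length b < 2")
    case True
    then show ?thesis
      using Lie_valued_commutator(2)[OF assms(1,2)] nsym.subspace_0[OF subspace_Lprod] by simp
  next
    case False
    then have "b \<noteq> []" "2 \<le> length b" by auto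
    then show ?thesis
      using Lie_valued_commutator(1)[OF assms(1,2)] that Lie_subset_Lprod Lprod_mono[of 2 "length b"]
      unfolding Lie_valued_def by blast
  qed
  have KC: "(K * (X * Y - Y * X)) \<star> pr b \<in> Lprod (length b) (mset (concat b))" if "list_all valid b" for b
    unfolding mult_star_pr
  proof (rule Usum_subspace[OF subspace_Lprod])
    fix u v assume uv: "mset u + mset v = mset b"
    then show "(K \<star> pr u) * ((X * Y - Y * X) \<star> pr v) \<in> Lprod (length b) (mset (concat b))"
      using that by (intro Lprod_mult'[OF star_pr_in_Lprod C])
        (auto simp: list_all_split[OF uv] mset_concat_split[OF uv] length_split[OF uv])
  qed
  show ?thesis
    unfolding mult_star_pr[of "K * (X * Y - Y * X)"]
  proof (rule Usum_subspace[OF subspace_Lprod])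
    fix u v assume uv: "mset u + mset v = mset bs"
    then show "((K * (X * Y - Y * X)) \<star> pr u) * (L \<star> pr v) \<in> Lprod (length bs) (mset (concat bs))"
      using assms(3) by (intro Lprod_mult'[OF KC star_pr_in_Lprod])
        (auto simp: list_all_split[OF uv] mset_concat_split[OF uv] length_split[OF uv])
  qed
qed

lemma nontrivial_bracket:
  assumes "list_all valid bs" "length bs < size (mset (concat bs))"
  shows "\<exists>w\<in>set bs. length w \<ge> 2"
proof (rule ccontr)
  assume "\<not> ?thesis"
  then have "length (concat bs) \<le> length bs"
    by (induction bs) (auto simp: not_le less_Suc_eq)
  then show False using assms(2) by simp
qed

lemma pr_nontrivial_decomp:
  assumes "w \<in> set bs" "length w \<ge> 2"
  shows "\<exists>K X d L. pr bs = K * (br X * zeta d - zeta d * br X) * L \<and> X \<noteq> []"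
proof -
  obtain as cs where bs: "bs = as @ w # cs" using assms(1) by (meson split_list)
  obtain X d where w: "w = X @ [d]" using assms(2) by (cases w rule: rev_cases) auto
  then have "X \<noteq> []" using assms(2) by auto
  then have "pr bs = pr as * (br X * zeta d - zeta d * br X) * pr cs"
    by (simp add: bs w br_snoc mult.assoc)
  then show ?thesis using \<open>X \<noteq> []\<close> by blast
qed

text \<open>
  The space \<open>Lprod (size \<mu>) \<mu>\<close> is the component of content \<open>\<mu>\<close> of the commutator ideal.
\<close>

lemma Lprod_star_Lprod:
  assumes "x \<in> Lprod (size \<mu>) \<mu>" "y \<in> Lprod s \<nu>"
  shows "x \<star> y \<in> Lprod (s - 1) \<nu>"
proof (rule bilin_span[OF assms[unfolded Lprod_def] lin_star_right lin_star_left subspace_Lprod])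
  fix a b assume "a \<in> {pr bs | bs. list_all valid bs \<and> mset (concat bs) = \<mu> \<and> length bs < size \<mu>}"
    and "b \<in> {pr bs | bs. list_all valid bs \<and> mset (concat bs) = \<nu> \<and> length bs < s}"
  then obtain cs bs where cs: "a = pr cs" "list_all valid cs" "mset (concat cs) = \<mu>" "length cs < size \<mu>"
    and bs: "b = pr bs" "list_all valid bs" "mset (concat bs) = \<nu>" "length bs < s" by blast
  obtain w where w: "w \<in> set cs" "length w \<ge> 2"
    using nontrivial_bracket[OF cs(2)] cs(3,4) by blast
  from pr_nontrivial_decomp[OF w] obtain K X d L
    where "pr cs = K * (br X * zeta d - zeta d * br X) * L" "X \<noteq> []" by blast
  then have "a \<star> b \<in> Lprod (length bs) \<nu>"
    using commutator_star_in_Lprod[OF Lie_valued_br[of X] Lie_valued_zeta[of d] bs(2), of K L] cs(1) bs(1,3)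
    by simp
  then show "a \<star> b \<in> Lprod (s - 1) \<nu>"
    by (rule subsetD[OF Lprod_mono, rotated]) (use bs(4) in simp)
qed

text \<open>Each letter of I contributes one Lie element, whatever it receives. This bounds the
  factors by the letters, whereas \<open>star_pr_in_Lprod\<close> bounds them by the brackets put
  in.\<close>

lemma zword_star_in_Lprod:
  assumes "list_all valid bs"
  shows "zword I \<star> pr bs \<in> Lprod (Suc (length I)) (mset (concat bs))"
  using assms
proof (induction I arbitrary: bs)
  case Nil
  have "bs = []" if "sum_list (concat bs) = 0"
    using that Nil by (cases bs) (auto simp: valid_def, metis all_not_in_conv set_empty)
  then have "zword [] \<star> pr bs = 0 \<or> bs = [] \<and> zword [] \<star> pr bs = pr bs"
    using S_star_pr[of 0 bs] by (auto simp: S_def)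
  then show ?case
    using pr_in_Lprod[of "[]" "{#}" 1] nsym.subspace_0[OF subspace_Lprod] by auto
next
  case (Cons i I)
  show ?case
    unfolding zword_simps mult_star_pr
  proof (rule Usum_subspace[OF subspace_Lprod])
    fix u v assume uv: "mset u + mset v = mset bs"
    show "(zeta i \<star> pr u) * (zword I \<star> pr v) \<in> Lprod (Suc (length (i # I))) (mset (concat bs))"
    proof (cases "u = []")
      case True
      then show ?thesis by (simp add: zeta_star_one nsym.subspace_0[OF subspace_Lprod])
    next
      case False
      have "zeta i \<star> pr u \<in> Lprod 2 (mset (concat u))"
        using False Cons.prems zeta_star_pr_in_Lie[of u i] Lie_subset_Lprod
        by (auto simp: list_all_split[OF uv])
      then show ?thesis
        by (rule Lprod_mult'[OF _ Cons.IH])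
           (use Cons.prems in \<open>auto simp: list_all_split[OF uv] mset_concat_split[OF uv]\<close>)
    qed
  qed
qed

section \<open>Rings with split commutative semisimple quotient\<close>

context left_module
begin

lemma smult_l_null: "x \<in> carrier M \<Longrightarrow> \<zero> \<odot>\<^bsub>M\<^esub> x = \<zero>\<^bsub>M\<^esub>"
  using smult_l_distr[of \<zero> \<zero> x] smult_closed[of \<zero> x] by (simp add: M.r_neg2 M.add.r_cancel_one')

lemma smult_l_minus:
  assumes "a \<in> carrier R" "x \<in> carrier M"
  shows "(\<ominus> a) \<odot>\<^bsub>M\<^esub> x = \<ominus>\<^bsub>M\<^esub> (a \<odot>\<^bsub>M\<^esub> x)"
proof (rule M.minus_equality[symmetric])
  show "(\<ominus> a) \<odot>\<^bsub>M\<^esub> x \<oplus>\<^bsub>M\<^esub> a \<odot>\<^bsub>M\<^esub> x = \<zero>\<^bsub>M\<^esub>"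
    using assms by (simp add: smult_l_null R.l_neg flip: smult_l_distr)
qed (use assms in \<open>auto intro: smult_closed\<close>)

lemma submodule_smult_image:
  assumes "left_ideal I R" "x \<in> carrier M"
  shows "submodule ((\<lambda>a. a \<odot>\<^bsub>M\<^esub> x) ` I) R M"
proof -
  interpret I: additive_subgroup I R using assms(1) by (simp add: left_ideal_def)
  have I: "a \<in> I \<Longrightarrow> a \<in> carrier R" for a using I.a_subset by blast
  have "subgroup ((\<lambda>a. a \<odot>\<^bsub>M\<^esub> x) ` I) (add_monoid M)"
  proof (rule M.add.subgroupI)
    show "(\<lambda>a. a \<odot>\<^bsub>M\<^esub> x) ` I \<subseteq> carrier M" using assms I by (auto intro: smult_closed)
    show "(\<lambda>a. a \<odot>\<^bsub>M\<^esub> x) ` I \<noteq> {}" using I.zero_closed by blast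
  next
    fix y assume "y \<in> (\<lambda>a. a \<odot>\<^bsub>M\<^esub> x) ` I"
    then obtain a where a: "a \<in> I" "y = a \<odot>\<^bsub>M\<^esub> x" by blast
    then have "\<ominus>\<^bsub>M\<^esub> y = (\<ominus> a) \<odot>\<^bsub>M\<^esub> x" using assms I by (simp add: smult_l_minus)
    then show "\<ominus>\<^bsub>M\<^esub> y \<in> (\<lambda>a. a \<odot>\<^bsub>M\<^esub> x) ` I" using I.a_inv_closed[OF a(1)] by blast
  next
    fix y z assume "y \<in> (\<lambda>a. a \<odot>\<^bsub>M\<^esub> x) ` I" "z \<in> (\<lambda>a. a \<odot>\<^bsub>M\<^esub> x) ` I"
    then obtain a b where ab: "a \<in> I" "b \<in> I" "y = a \<odot>\<^bsub>M\<^esub> x" "z = b \<odot>\<^bsub>M\<^esub> x" by blast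
    then have "y \<oplus>\<^bsub>M\<^esub> z = (a \<oplus> b) \<odot>\<^bsub>M\<^esub> x" using assms I by (simp add: smult_l_distr)
    then show "y \<oplus>\<^bsub>M\<^esub> z \<in> (\<lambda>a. a \<odot>\<^bsub>M\<^esub> x) ` I" using I.a_closed[OF ab(1,2)] by blast
  qed
  moreover have "a \<odot>\<^bsub>M\<^esub> y \<in> (\<lambda>a. a \<odot>\<^bsub>M\<^esub> x) ` I" if a: "a \<in> carrier R" and y: "y \<in> (\<lambda>a. a \<odot>\<^bsub>M\<^esub> x) ` I" for a y
  proof -
    from y obtain b where b: "b \<in> I" "y = b \<odot>\<^bsub>M\<^esub> x" by blast
    then have "a \<odot>\<^bsub>M\<^esub> y = (a \<otimes> b) \<odot>\<^bsub>M\<^esub> x" using a assms I by (simp add: smult_assoc)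
    then show ?thesis using assms(1) b(1) a by (auto simp: left_ideal_def)
  qed
  ultimately show ?thesis by (simp add: submodule_def submodule_axioms_def)
qed

end

lemma (in ring) left_idealI:
  assumes "I \<subseteq> carrier R" "I \<noteq> {}" "\<And>x. x \<in> I \<Longrightarrow> \<ominus> x \<in> I" "\<And>x y. x \<in> I \<Longrightarrow> y \<in> I \<Longrightarrow> x \<oplus> y \<in> I"
    "\<And>a x. a \<in> carrier R \<Longrightarrow> x \<in> I \<Longrightarrow> a \<otimes> x \<in> I"
  shows "left_ideal I R"
proof -
  have "subgroup I (add_monoid R)"
    by (rule add.subgroupI) (use assms in auto)
  then show ?thesis
    using assms(5) by (simp add: left_ideal_def additive_subgroup_def)
qed

lemma (in ring) left_ideal_carrier: "left_ideal (carrier R) R"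
  by (rule left_idealI) auto

text \<open>
  The elements \<open>u \<nu> c\<close> play the role of the scalar multiples of the idempotents, so that no
  algebra structure is needed. The assumption \<open>one_mem\<close> replaces the equation between the unit
  and the sum of the idempotents.
\<close>

locale split_basic_ring = ring R
  for R :: "('a, 'c) ring_scheme" (structure) +
  fixes P :: "'i set" and \<chi> :: "'i \<Rightarrow> 'a \<Rightarrow> 'f :: field" and u :: "'i \<Rightarrow> 'f \<Rightarrow> 'a"
  assumes u_closed: "\<nu> \<in> P \<Longrightarrow> u \<nu> c \<in> carrier R"
    and u_add: "\<nu> \<in> P \<Longrightarrow> u \<nu> c \<oplus> u \<nu> d = u \<nu> (c + d)"
    and u_mult: "\<nu> \<in> P \<Longrightarrow> u \<nu> c \<otimes> u \<nu> d = u \<nu> (c * d)"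
    and one_mem: "left_ideal I R \<Longrightarrow> (\<And>\<nu>. \<nu> \<in> P \<Longrightarrow> u \<nu> 1 \<in> I) \<Longrightarrow> \<one> \<in> I"
    and chi_u: "\<mu> \<in> P \<Longrightarrow> \<nu> \<in> P \<Longrightarrow> \<chi> \<mu> (u \<nu> c) = (if \<mu> = \<nu> then c else 0)"
    and chi_add: "\<nu> \<in> P \<Longrightarrow> x \<in> carrier R \<Longrightarrow> y \<in> carrier R \<Longrightarrow> \<chi> \<nu> (x \<oplus> y) = \<chi> \<nu> x + \<chi> \<nu> y"
    and chi_mult: "\<nu> \<in> P \<Longrightarrow> x \<in> carrier R \<Longrightarrow> y \<in> carrier R \<Longrightarrow> \<chi> \<nu> (x \<otimes> y) = \<chi> \<nu> x * \<chi> \<nu> y"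
    and nil: "x \<in> carrier R \<Longrightarrow> (\<And>\<nu>. \<nu> \<in> P \<Longrightarrow> \<chi> \<nu> x = 0) \<Longrightarrow> \<exists>k :: nat. x [^] k = \<zero>"
begin

lemma chi_zero: "\<nu> \<in> P \<Longrightarrow> \<chi> \<nu> \<zero> = 0"
proof -
  assume "\<nu> \<in> P"
  then have "\<chi> \<nu> \<zero> = \<chi> \<nu> \<zero> + \<chi> \<nu> \<zero>" by (metis chi_add l_zero zero_closed)
  then show "\<chi> \<nu> \<zero> = 0" by (simp only: add_cancel_right_right)
qed

lemma chi_neg: "\<nu> \<in> P \<Longrightarrow> x \<in> carrier R \<Longrightarrow> \<chi> \<nu> (\<ominus> x) = - \<chi> \<nu> x"
  using chi_add[of \<nu> "\<ominus> x" x] by (simp add: l_neg chi_zero eq_neg_iff_add_eq_0)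

lemma chi_minus: "\<nu> \<in> P \<Longrightarrow> x \<in> carrier R \<Longrightarrow> y \<in> carrier R \<Longrightarrow> \<chi> \<nu> (x \<ominus> y) = \<chi> \<nu> x - \<chi> \<nu> y"
  by (simp add: a_minus_def chi_add chi_neg)

lemma u_zero: "\<nu> \<in> P \<Longrightarrow> u \<nu> 0 = \<zero>"
  using u_add[of \<nu> 0 0] u_closed[of \<nu> 0] by (simp add: add.r_cancel_one')

section \<open>The radical as the common kernel of the characters\<close>

definition N :: "'a set" where
  "N = {x \<in> carrier R. \<forall>\<nu>\<in>P. \<chi> \<nu> x = 0}"

lemma N_nil:
  assumes "x \<in> N"
  shows "\<exists>k :: nat. x [^] k = \<zero>"
proof (rule nil)
  show "x \<in> carrier R" using assms by (simp add: N_def)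
  show "\<chi> \<nu> x = 0" if "\<nu> \<in> P" for \<nu> using assms that by (simp add: N_def)
qed

lemma ideal_N: "ideal N R"
proof (rule idealI)
  show "ring R" by (rule ring_axioms)
  show "subgroup N (add_monoid R)"
    by (rule add.subgroupI) (use zero_closed in \<open>auto simp: N_def chi_zero chi_neg chi_add\<close>)
qed (auto simp: N_def chi_mult)

lemma minus_add_cancel: "x \<in> carrier R \<Longrightarrow> y \<in> carrier R \<Longrightarrow> (x \<ominus> y) \<oplus> y = x"
  by (simp add: a_minus_def a_assoc l_neg)

lemma maximal_left_ideal_ker:
  assumes \<nu>: "\<nu> \<in> P"
  shows "maximal_left_ideal {x \<in> carrier R. \<chi> \<nu> x = 0} R" (is "maximal_left_ideal ?K R")
  unfolding maximal_left_ideal_def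
proof (intro conjI allI impI)
  show "left_ideal ?K R"
    by (rule left_idealI) (use \<nu> zero_closed in \<open>auto simp: chi_zero chi_neg chi_add chi_mult\<close>)
  have "u \<nu> 1 \<in> carrier R" "u \<nu> 1 \<notin> ?K" using \<nu> by (auto simp: u_closed chi_u)
  then show "?K \<noteq> carrier R" by blast
next
  fix J assume J: "left_ideal J R \<and> ?K \<subseteq> J"
  then interpret J: additive_subgroup J R by (simp add: left_ideal_def)
  show "J = ?K \<or> J = carrier R"
  proof (cases "J \<subseteq> ?K")
    case False
    then obtain x where x: "x \<in> J" "x \<in> carrier R" "\<chi> \<nu> x \<noteq> 0" using J.a_subset by blast
    have "y \<in> J" if y: "y \<in> carrier R" for y
    proof -
      \<comment> \<open>The multiple of x that has the same character as y.\<close>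
      let ?z = "u \<nu> (\<chi> \<nu> y / \<chi> \<nu> x) \<otimes> x"
      have z: "?z \<in> J" using J x \<nu> by (auto simp: left_ideal_def u_closed)
      then have zc: "?z \<in> carrier R" using J.a_subset by blast
      have "\<chi> \<nu> (y \<ominus> ?z) = 0"
        using \<nu> x y zc by (simp add: chi_minus chi_mult u_closed chi_u)
      then have "y \<ominus> ?z \<in> J" using J y zc by auto
      then have "(y \<ominus> ?z) \<oplus> ?z \<in> J" using z by (rule J.a_closed)
      then show ?thesis using y zc by (simp add: minus_add_cancel)
    qed
    then show ?thesis using J.a_subset by blast
  qed (use J in blast)
qed

text \<open>Otherwise N + I is the whole ring, so 1 - x lies in I for some nilpotent x. Then I
  contains 1 - x^k for all k by the geometric series, hence 1.\<close>

lemma N_subset_maximal: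
  assumes "maximal_left_ideal I R"
  shows "N \<subseteq> I"
proof (rule ccontr)
  assume "\<not> N \<subseteq> I"
  have I: "left_ideal I R" "I \<noteq> carrier R" using assms by (auto simp: maximal_left_ideal_def)
  interpret I: additive_subgroup I R using I(1) by (simp add: left_ideal_def)
  interpret N: ideal N R by (rule ideal_N)
  have Ic: "x \<in> I \<Longrightarrow> x \<in> carrier R" for x using I.a_subset by blast
  let ?J = "{x \<oplus> y | x y. x \<in> N \<and> y \<in> I}"
  have "left_ideal ?J R"
  proof (rule left_idealI)
    show "?J \<subseteq> carrier R" using Ic N.Icarr by auto
    show "?J \<noteq> {}" using N.zero_closed I.zero_closed by blast
  next
    fix x assume "x \<in> ?J"
    then obtain a b where ab: "x = a \<oplus> b" "a \<in> N" "b \<in> I" by blast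
    then have "\<ominus> x = \<ominus> a \<oplus> \<ominus> b" by (simp add: minus_add N.Icarr Ic a_comm)
    then show "\<ominus> x \<in> ?J" using N.a_inv_closed[OF ab(2)] I.a_inv_closed[OF ab(3)] by blast
  next
    fix x y assume "x \<in> ?J" "y \<in> ?J"
    then obtain a b a' b' where ab: "x = a \<oplus> b" "a \<in> N" "b \<in> I" "y = a' \<oplus> b'" "a' \<in> N" "b' \<in> I" by blast
    then have "x \<oplus> y = (a \<oplus> a') \<oplus> (b \<oplus> b')" by (simp add: N.Icarr Ic a_ac)
    then show "x \<oplus> y \<in> ?J" using N.a_closed[OF ab(2,5)] I.a_closed[OF ab(3,6)] by blast
  next
    fix a x assume a: "a \<in> carrier R" and "x \<in> ?J"
    then obtain b c where bc: "x = b \<oplus> c" "b \<in> N" "c \<in> I" by blast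
    then have "a \<otimes> x = (a \<otimes> b) \<oplus> (a \<otimes> c)" using a by (simp add: r_distr N.Icarr Ic)
    then show "a \<otimes> x \<in> ?J" using N.I_l_closed[OF bc(2) a] I(1) bc(3) a by (auto simp: left_ideal_def)
  qed
  moreover have "I \<subseteq> ?J"
  proof
    fix x assume "x \<in> I"
    then have "x = \<zero> \<oplus> x" using Ic by simp
    then show "x \<in> ?J" using N.zero_closed \<open>x \<in> I\<close> by blast
  qed
  moreover have "N \<subseteq> ?J"
  proof
    fix x assume "x \<in> N"
    then have "x = x \<oplus> \<zero>" using N.Icarr by simp
    then show "x \<in> ?J" using I.zero_closed \<open>x \<in> N\<close> by blast
  qed
  moreover have max: "J = I \<or> J = carrier R" if "left_ideal J R" "I \<subseteq> J" for J
    using assms that by (simp add: maximal_left_ideal_def)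
  ultimately have "N \<subseteq> ?J" "?J = I \<or> ?J = carrier R" by (simp, intro max)
  then have "?J = carrier R"
  proof (elim disjE)
    assume "N \<subseteq> ?J" "?J = I"
    then have "N \<subseteq> I" by (simp only:)
    then show ?thesis using \<open>\<not> N \<subseteq> I\<close> by contradiction
  qed
  then have "\<one> \<in> ?J" by simp
  then obtain x m where x: "\<one> = x \<oplus> m" "x \<in> N" "m \<in> I" by blast
  have xc: "x \<in> carrier R" using x(2) N.Icarr by blast
  have "m = (m \<oplus> x) \<ominus> x"
    using xc Ic[OF x(3)] by (simp add: a_minus_def a_assoc r_neg)
  also have "m \<oplus> x = \<one>"
    unfolding x(1) by (rule a_comm[OF Ic[OF x(3)] xc])
  finally have m: "m = \<one> \<ominus> x" .
  have "\<one> \<ominus> x [^] (k :: nat) \<in> I" for k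
  proof (induction k)
    case 0
    then show ?case using I.zero_closed by (simp add: a_minus_def r_neg)
  next
    case (Suc k)
    have "x [^] k \<otimes> (\<one> \<ominus> x) \<in> I" using I(1) x(3) xc m by (auto simp: left_ideal_def)
    then have "(\<one> \<ominus> x [^] k) \<oplus> x [^] k \<otimes> (\<one> \<ominus> x) \<in> I" using Suc by (intro I.a_closed)
    moreover have "(\<one> \<ominus> x [^] k) \<oplus> x [^] k \<otimes> (\<one> \<ominus> x) = \<one> \<ominus> x [^] Suc k"
      using xc by (simp add: a_minus_def r_distr r_minus a_assoc r_neg1)
    ultimately show ?case by simp
  qed
  moreover note N_nil[OF x(2)]
  ultimately have "\<one> \<ominus> \<zero> \<in> I" by metis
  then have "\<one> \<in> I" by (simp add: a_minus_def)
  then have "a \<in> I" if "a \<in> carrier R" for a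
    using I(1) that unfolding left_ideal_def by (metis r_one)
  then show False using I(2) I.a_subset by blast
qed

lemma jacobson_radical_eq: "jacobson_radical R = N"
proof
  show "jacobson_radical R \<subseteq> N"
    using maximal_left_ideal_ker by (fastforce simp: jacobson_radical_def N_def)
  show "N \<subseteq> jacobson_radical R"
    using N_subset_maximal by (auto simp: jacobson_radical_def N_def)
qed

text \<open>The elements of R \<open>u \<nu> 1\<close> with character c form one coset of its
  radical part. So the top module is a copy of the field, on which R acts through
  \<open>\<chi> \<nu>\<close>.\<close>

definition cls :: "'i \<Rightarrow> 'f \<Rightarrow> 'a set" where
  "cls \<nu> c = {x \<in> carrier R. x \<otimes> u \<nu> 1 = x \<and> \<chi> \<nu> x = c}"

lemma u_in_cls: "\<nu> \<in> P \<Longrightarrow> u \<nu> c \<in> cls \<nu> c"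
  by (simp add: cls_def u_closed u_mult chi_u)

lemma cls_eq_iff: "\<nu> \<in> P \<Longrightarrow> cls \<nu> c = cls \<nu> d \<longleftrightarrow> c = d"
  using u_in_cls[of \<nu> c] by (auto simp: cls_def)

lemma cls_mult: "\<nu> \<in> P \<Longrightarrow> a \<in> carrier R \<Longrightarrow> x \<in> cls \<nu> c \<Longrightarrow> a \<otimes> x \<in> cls \<nu> (\<chi> \<nu> a * c)"
  by (auto simp: cls_def chi_mult m_assoc u_closed)

lemma cls_add: "\<nu> \<in> P \<Longrightarrow> x \<in> cls \<nu> c \<Longrightarrow> y \<in> cls \<nu> d \<Longrightarrow> x \<oplus> y \<in> cls \<nu> (c + d)"
  by (auto simp: cls_def chi_add l_distr u_closed)

lemma cls_minus: "\<nu> \<in> P \<Longrightarrow> x \<in> cls \<nu> c \<Longrightarrow> y \<in> cls \<nu> d \<Longrightarrow> x \<ominus> y \<in> cls \<nu> (c - d)"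
  by (auto simp: cls_def chi_minus a_minus_def l_distr l_minus u_closed chi_add chi_neg)

lemma radical_part: "\<nu> \<in> P \<Longrightarrow> (\<lambda>x. x \<otimes> u \<nu> 1) ` N = cls \<nu> 0"
proof (intro subset_antisym subsetI)
  fix x assume \<nu>: "\<nu> \<in> P" and x: "x \<in> cls \<nu> 0"
  have "\<chi> \<mu> x = 0" if "\<mu> \<in> P" for \<mu>
  proof (cases "\<mu> = \<nu>")
    case False
    have "\<chi> \<mu> (x \<otimes> u \<nu> 1) = 0"
      using x \<nu> that False by (subst chi_mult) (auto simp: cls_def u_closed chi_u)
    then show ?thesis using x by (simp add: cls_def)
  qed (use x in \<open>auto simp: cls_def\<close>)
  then show "x \<in> (\<lambda>x. x \<otimes> u \<nu> 1) ` N" using x by (force simp: cls_def N_def)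
qed (auto simp: cls_def N_def chi_mult u_closed m_assoc u_mult)

lemma coset_eq_cls:
  assumes \<nu>: "\<nu> \<in> P" and x: "x \<in> cls \<nu> c"
  shows "cls \<nu> 0 +>\<^bsub>principal_module R (u \<nu> 1)\<^esub> x = cls \<nu> c"
proof -
  have "cls \<nu> 0 +>\<^bsub>principal_module R (u \<nu> 1)\<^esub> x = (\<lambda>h. h \<oplus> x) ` cls \<nu> 0"
    by (auto simp: a_r_coset_def r_coset_def principal_module_def)
  also have "\<dots> = cls \<nu> c"
  proof (intro subset_antisym subsetI)
    fix y assume y: "y \<in> cls \<nu> c"
    then have "y = (y \<ominus> x) \<oplus> x" using x by (simp add: cls_def minus_add_cancel)
    moreover have "y \<ominus> x \<in> cls \<nu> 0" using cls_minus[OF \<nu> y x] by simp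
    ultimately show "y \<in> (\<lambda>h. h \<oplus> x) ` cls \<nu> 0" by blast
  qed (use cls_add[OF \<nu> _ x, of _ 0] in auto)
  finally show ?thesis .
qed

lemma top_module_simps:
  assumes \<nu>: "\<nu> \<in> P"
  shows "carrier (top_module R (u \<nu> 1)) = range (cls \<nu>)" (is ?A)
    and "\<zero>\<^bsub>top_module R (u \<nu> 1)\<^esub> = cls \<nu> 0" (is ?B)
    and "cls \<nu> c \<oplus>\<^bsub>top_module R (u \<nu> 1)\<^esub> cls \<nu> d = cls \<nu> (c + d)" (is ?C)
    and "a \<in> carrier R \<Longrightarrow> a \<odot>\<^bsub>top_module R (u \<nu> 1)\<^esub> cls \<nu> c = cls \<nu> (\<chi> \<nu> a * c)"
proof -
  let ?P = "principal_module R (u \<nu> 1)"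
  have T: "top_module R (u \<nu> 1) = quotient_module R ?P (cls \<nu> 0)"
    by (simp add: top_module_def jacobson_radical_eq radical_part[OF \<nu>])
  have P: "carrier ?P = (\<Union>c. cls \<nu> c)"
    using \<nu> by (auto simp: principal_module_def cls_def u_closed u_mult m_assoc image_iff) metis
  show ?B by (simp add: T quotient_module_def)
  have "carrier (top_module R (u \<nu> 1)) = (\<lambda>x. cls \<nu> 0 +>\<^bsub>?P\<^esub> x) ` carrier ?P"
    by (auto simp: T quotient_module_def A_RCOSETS_def RCOSETS_def a_r_coset_def)
  also have "\<dots> = range (cls \<nu>)"
    unfolding P
  proof (intro subset_antisym subsetI)
    fix X assume "X \<in> range (cls \<nu>)"
    then obtain c where "X = cls \<nu> c" by blast
    then show "X \<in> (\<lambda>x. cls \<nu> 0 +>\<^bsub>?P\<^esub> x) ` (\<Union>c. cls \<nu> c)"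
      using coset_eq_cls[OF \<nu> u_in_cls[OF \<nu>, of c]] u_in_cls[OF \<nu>, of c] by blast
  qed (auto simp: coset_eq_cls[OF \<nu>])
  finally show ?A .
  have "cls \<nu> c \<oplus>\<^bsub>top_module R (u \<nu> 1)\<^esub> cls \<nu> d = {x \<oplus> y | x y. x \<in> cls \<nu> c \<and> y \<in> cls \<nu> d}"
    by (auto simp: T quotient_module_def set_add_def set_mult_def principal_module_def)
  also have "\<dots> = cls \<nu> (c + d)"
  proof (intro subset_antisym subsetI)
    fix y assume y: "y \<in> cls \<nu> (c + d)"
    then have "y \<ominus> u \<nu> d \<in> cls \<nu> c" using cls_minus[OF \<nu> y u_in_cls[OF \<nu>, of d]] by simp
    moreover have "y = (y \<ominus> u \<nu> d) \<oplus> u \<nu> d"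
      using y \<nu> by (simp add: minus_add_cancel u_closed cls_def)
    ultimately show "y \<in> {x \<oplus> y | x y. x \<in> cls \<nu> c \<and> y \<in> cls \<nu> d}" using u_in_cls[OF \<nu>] by blast
  qed (auto intro: cls_add[OF \<nu>])
  finally show ?C .
  assume a: "a \<in> carrier R"
  have "a \<odot>\<^bsub>top_module R (u \<nu> 1)\<^esub> cls \<nu> c = (\<Union>x\<in>cls \<nu> c. cls \<nu> 0 +>\<^bsub>?P\<^esub> (a \<otimes> x))"
    by (simp add: T quotient_module_def principal_module_def)
  also have "\<dots> = (\<Union>x\<in>cls \<nu> c. cls \<nu> (\<chi> \<nu> a * c))"
    using coset_eq_cls[OF \<nu> cls_mult[OF \<nu> a]] by (intro SUP_cong) auto
  also have "\<dots> = cls \<nu> (\<chi> \<nu> a * c)" using u_in_cls[OF \<nu>, of c] by auto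
  finally show "a \<odot>\<^bsub>top_module R (u \<nu> 1)\<^esub> cls \<nu> c = cls \<nu> (\<chi> \<nu> a * c)" .
qed

lemma chi_one: "\<nu> \<in> P \<Longrightarrow> \<chi> \<nu> \<one> = 1"
  using chi_mult[of \<nu> \<one> "u \<nu> 1"] by (simp add: u_closed chi_u)

lemma simple_top_module:
  assumes \<nu>: "\<nu> \<in> P"
  shows "simple_module R (top_module R (u \<nu> 1))"
proof -
  let ?T = "top_module R (u \<nu> 1)"
  note T = top_module_simps[OF \<nu>]
  have "abelian_group ?T"
    by (rule abelian_groupI) (auto simp: T add_ac cls_eq_iff[OF \<nu>], metis add.right_inverse)
  then have "left_module R ?T"
    unfolding left_module_def left_module_axioms_def using ring_axioms \<nu>
    by (auto simp: T chi_add chi_mult chi_one algebra_simps)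
  moreover have "carrier ?T \<noteq> {\<zero>\<^bsub>?T\<^esub>}"
    using cls_eq_iff[OF \<nu>, of 1 0] by (auto simp: T)
  moreover have "H = {\<zero>\<^bsub>?T\<^esub>} \<or> H = carrier ?T" if "submodule H R ?T" for H
  proof -
    interpret H: submodule H R ?T by (rule that)
    have sub: "H \<subseteq> range (cls \<nu>)" using H.subset T(1) by simp
    have zero: "cls \<nu> 0 \<in> H" using H.one_closed T(2) by simp
    show ?thesis
    proof (cases "H \<subseteq> {cls \<nu> 0}")
      case False
      then obtain c where c: "cls \<nu> c \<in> H" "c \<noteq> 0" using sub by blast
      have "cls \<nu> d \<in> H" for d
        using H.smult_closed[OF u_closed[OF \<nu>, of "d / c"] c(1)] c(2) \<nu> by (simp add: T u_closed chi_u)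
      then show ?thesis using sub T(1) by auto
    qed (use zero T(2) in auto)
  qed
  ultimately show ?thesis by (simp add: simple_module_def)
qed

text \<open>\<open>u \<nu> 1\<close> acts as the identity on the top of \<nu> and as 0 on that of
  any other index.\<close>

lemma top_module_iso_imp_eq:
  assumes \<nu>: "\<nu> \<in> P" and \<mu>: "\<mu> \<in> P"
    and iso: "module_iso R (top_module R (u \<nu> 1)) (top_module R (u \<mu> 1))"
  shows "\<nu> = \<mu>"
proof (rule ccontr)
  assume neq: "\<nu> \<noteq> \<mu>"
  note T = top_module_simps[OF \<nu>] and T' = top_module_simps[OF \<mu>]
  obtain f where f: "bij_betw f (range (cls \<nu>)) (range (cls \<mu>))"
    and smult: "\<And>a c. a \<in> carrier R \<Longrightarrow> f (cls \<nu> (\<chi> \<nu> a * c)) = a \<odot>\<^bsub>top_module R (u \<mu> 1)\<^esub> f (cls \<nu> c)"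
    using iso by (auto simp: module_iso_def T T')
  obtain d where d: "f (cls \<nu> 1) = cls \<mu> d" using bij_betwE[OF f] by blast
  have "f (cls \<nu> 1) = cls \<mu> 0"
    using smult[of "u \<nu> 1" 1] \<nu> \<mu> neq by (simp add: u_closed chi_u d T')
  moreover have "f (cls \<nu> 0) = cls \<mu> 0"
    using smult[of \<zero> 1] \<nu> \<mu> by (simp add: chi_zero d T')
  ultimately have "cls \<nu> 1 = cls \<nu> 0"
    using f by (metis bij_betw_imp_inj_on inj_onD rangeI)
  then show False using cls_eq_iff[OF \<nu>] by simp
qed

text \<open>Some idempotent maps x to a nonzero y. Then R y is the whole module, but N y is not,
  since a y = y contradicts the nilpotency of a. So N y = 0, and R acts on y through the character
  of that idempotent.\<close>

lemma simple_module_iso_top: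
  assumes M: "simple_module R M"
  shows "\<exists>\<nu>\<in>P. module_iso R M (top_module R (u \<nu> 1))"
proof -
  interpret M: left_module R M using M by (simp add: simple_module_def)
  have sub: "H = {\<zero>\<^bsub>M\<^esub>} \<or> H = carrier M" if "submodule H R M" for H
    using M that by (simp add: simple_module_def)
  obtain x where x: "x \<in> carrier M" "x \<noteq> \<zero>\<^bsub>M\<^esub>"
    using M M.M.zero_closed by (auto simp: simple_module_def)
  have "left_ideal {a \<in> carrier R. a \<odot>\<^bsub>M\<^esub> x = \<zero>\<^bsub>M\<^esub>} R"
  proof (rule left_idealI)
    show "{a \<in> carrier R. a \<odot>\<^bsub>M\<^esub> x = \<zero>\<^bsub>M\<^esub>} \<noteq> {}" using M.smult_l_null[OF x(1)] by blast
    have "a \<odot>\<^bsub>M\<^esub> \<zero>\<^bsub>M\<^esub> = \<zero>\<^bsub>M\<^esub>" if "a \<in> carrier R" for a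
      using M.smult_assoc[of a \<zero> x] that x by (simp add: M.smult_l_null)
    then show "a \<otimes> y \<in> {a \<in> carrier R. a \<odot>\<^bsub>M\<^esub> x = \<zero>\<^bsub>M\<^esub>}"
      if "a \<in> carrier R" "y \<in> {a \<in> carrier R. a \<odot>\<^bsub>M\<^esub> x = \<zero>\<^bsub>M\<^esub>}" for a y
      using that x by (simp add: M.smult_assoc)
  qed (use x in \<open>auto simp: M.smult_l_minus M.smult_l_distr\<close>)
  moreover have "\<one> \<odot>\<^bsub>M\<^esub> x \<noteq> \<zero>\<^bsub>M\<^esub>" using x by (simp add: M.smult_one)
  ultimately obtain \<nu> where \<nu>: "\<nu> \<in> P" "u \<nu> 1 \<odot>\<^bsub>M\<^esub> x \<noteq> \<zero>\<^bsub>M\<^esub>"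
    using one_mem[of "{a \<in> carrier R. a \<odot>\<^bsub>M\<^esub> x = \<zero>\<^bsub>M\<^esub>}"] u_closed by blast
  define y where "y = u \<nu> 1 \<odot>\<^bsub>M\<^esub> x"
  have y: "y \<in> carrier M" "y \<noteq> \<zero>\<^bsub>M\<^esub>"
    using \<nu> x by (auto simp: y_def u_closed intro: M.smult_closed)
  have uy: "(a \<otimes> u \<nu> 1) \<odot>\<^bsub>M\<^esub> y = a \<odot>\<^bsub>M\<^esub> y" if "a \<in> carrier R" for a
    using that \<nu> x by (simp add: y_def u_closed m_assoc u_mult flip: M.smult_assoc)
  have "submodule ((\<lambda>a. a \<odot>\<^bsub>M\<^esub> y) ` carrier R) R M"
    by (rule M.submodule_smult_image[OF left_ideal_carrier y(1)])
  moreover have "y \<in> (\<lambda>a. a \<odot>\<^bsub>M\<^esub> y) ` carrier R"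
    using M.smult_one[OF y(1)] by (metis image_eqI one_closed)
  ultimately have orbit: "(\<lambda>a. a \<odot>\<^bsub>M\<^esub> y) ` carrier R = carrier M"
    using y(2) by (metis sub singletonD)
  interpret N: ideal N R by (rule ideal_N)
  have "left_ideal N R"
    using N.additive_subgroup_axioms N.I_l_closed by (simp add: left_ideal_def)
  then have "submodule ((\<lambda>a. a \<odot>\<^bsub>M\<^esub> y) ` N) R M" by (rule M.submodule_smult_image[OF _ y(1)])
  moreover have "(\<lambda>a. a \<odot>\<^bsub>M\<^esub> y) ` N \<noteq> carrier M"
  proof
    assume "(\<lambda>a. a \<odot>\<^bsub>M\<^esub> y) ` N = carrier M"
    then obtain a where a: "a \<in> N" "a \<odot>\<^bsub>M\<^esub> y = y" using y(1) by (metis (no_types, lifting) imageE)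
    have ac: "a \<in> carrier R" using a(1) N.Icarr by blast
    have pow: "a [^] (k :: nat) \<odot>\<^bsub>M\<^esub> y = y" for k
    proof (induction k)
      case (Suc k)
      have "(a [^] k \<otimes> a) \<odot>\<^bsub>M\<^esub> y = a [^] k \<odot>\<^bsub>M\<^esub> (a \<odot>\<^bsub>M\<^esub> y)"
        by (rule M.smult_assoc) (use ac y(1) in auto)
      then show ?case using a(2) Suc by simp
    qed (simp add: M.smult_one[OF y(1)])
    from N_nil[OF a(1)] obtain k :: nat where "a [^] k = \<zero>" ..
    with pow[of k] have "\<zero> \<odot>\<^bsub>M\<^esub> y = y" by simp
    then show False using y M.smult_l_null[OF y(1)] by simp
  qed
  ultimately have "(\<lambda>a. a \<odot>\<^bsub>M\<^esub> y) ` N = {\<zero>\<^bsub>M\<^esub>}" by (metis sub)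
  then have Ny: "a \<odot>\<^bsub>M\<^esub> y = \<zero>\<^bsub>M\<^esub>" if "a \<in> N" for a using that by blast
  define g where "g c = u \<nu> c \<odot>\<^bsub>M\<^esub> y" for c
  have gc: "g c \<in> carrier M" for c using \<nu> y by (simp add: g_def u_closed M.smult_closed)
  have act: "a \<odot>\<^bsub>M\<^esub> y = g (\<chi> \<nu> a)" if a: "a \<in> carrier R" for a
  proof -
    \<comment> \<open>Both terms are fixed by right multiplication with \<open>u \<nu> 1\<close> and
      have the same character, so they differ by an element of the radical.\<close>
    let ?n = "a \<otimes> u \<nu> 1 \<ominus> u \<nu> (\<chi> \<nu> a)"
    have "?n \<in> cls \<nu> (\<chi> \<nu> a * 1 - \<chi> \<nu> a)"
      by (intro cls_minus cls_mult u_in_cls \<nu>(1) a)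
    then have "?n \<in> (\<lambda>x. x \<otimes> u \<nu> 1) ` N" using radical_part[OF \<nu>(1)] by simp
    then have n: "?n \<in> N" by (rule imageE) (simp only: N.I_r_closed u_closed \<nu>(1))
    have "a \<otimes> u \<nu> 1 = ?n \<oplus> u \<nu> (\<chi> \<nu> a)" using a \<nu> by (simp add: minus_add_cancel u_closed)
    then have "a \<odot>\<^bsub>M\<^esub> y = (?n \<oplus> u \<nu> (\<chi> \<nu> a)) \<odot>\<^bsub>M\<^esub> y" using uy[OF a] by simp
    also have "\<dots> = g (\<chi> \<nu> a)"
      using n N.Icarr \<nu> y gc by (subst M.smult_l_distr) (auto simp: u_closed Ny g_def)
    finally show ?thesis .
  qed
  have range_g: "carrier M = range g"
  proof
    show "carrier M \<subseteq> range g" unfolding orbit[symmetric] using act by auto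
    show "range g \<subseteq> carrier M" using gc by auto
  qed
  have g_add: "g c \<oplus>\<^bsub>M\<^esub> g d = g (c + d)" for c d
    using \<nu> y by (simp add: g_def u_closed flip: M.smult_l_distr u_add)
  have g_smult: "a \<odot>\<^bsub>M\<^esub> g c = g (\<chi> \<nu> a * c)" if "a \<in> carrier R" for a c
    using act[of "a \<otimes> u \<nu> c"] that \<nu> y by (simp add: g_def u_closed chi_mult chi_u M.smult_assoc)
  have inj: "inj g"
  proof (rule injI)
    fix c d assume "g c = g d"
    then have "g c \<oplus>\<^bsub>M\<^esub> g (- d) = g d \<oplus>\<^bsub>M\<^esub> g (- d)" by simp
    then have 0: "g (c - d) = \<zero>\<^bsub>M\<^esub>"
      using \<nu> y by (simp add: g_add) (simp add: g_def u_zero M.smult_l_null)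
    show "c = d"
    proof (rule ccontr)
      assume "c \<noteq> d"
      then have "g 1 = u \<nu> (1 / (c - d)) \<odot>\<^bsub>M\<^esub> g (c - d)" using \<nu> by (simp add: g_smult u_closed chi_u)
      also have "\<dots> = u \<nu> (1 / (c - d)) \<odot>\<^bsub>M\<^esub> g 0" using 0 \<nu> y by (simp add: g_def[of 0] u_zero M.smult_l_null)
      also have "\<dots> = \<zero>\<^bsub>M\<^esub>" using \<nu> y by (simp add: g_smult u_closed) (simp add: g_def u_zero M.smult_l_null)
      finally have "\<one> \<odot>\<^bsub>M\<^esub> y = \<zero>\<^bsub>M\<^esub>" using act[OF one_closed] chi_one[OF \<nu>(1)] by simp
      then show False using y by (simp add: M.smult_one)
    qed
  qed
  let ?f = "\<lambda>z. cls \<nu> (inv_into UNIV g z)"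
  note T = top_module_simps[OF \<nu>(1)]
  have fg: "?f (g c) = cls \<nu> c" for c using inj by simp
  have "bij_betw ?f (carrier M) (carrier (top_module R (u \<nu> 1)))"
    unfolding T range_g
  proof (rule bij_betw_imageI)
    show "inj_on ?f (range g)" using fg cls_eq_iff[OF \<nu>(1)] by (auto intro!: inj_onI simp: inj)
    show "?f ` range g = range (cls \<nu>)" using fg by (auto simp: image_image)
  qed
  then have "module_iso R M (top_module R (u \<nu> 1))"
    unfolding module_iso_def range_g
    by (intro exI[of _ ?f] conjI) (auto simp: range_g g_add g_smult fg T inj)
  then show ?thesis using \<nu>(1) by blast
qed

end

section \<open>The algebra of Zassenhaus words without the letter 1\<close>

lemma zeta_1: "zeta 1 = S 1"
  using zeta_Suc[of 0] by (simp add: zassenhaus_prod_0)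

lemma dpow_uminus: "dpow k (- F) = single 0 ((- 1) ^ k / fact k) * F ^ k"
proof (cases "even k")
  case False
  then show ?thesis by (simp add: dpow_def single_uminus)
qed (simp add: dpow_def)

lemma partitions_no1_conv: "partitions_no1 n = {\<nu> \<in> parts n n. 1 \<notin># \<nu>}"
  by (auto simp: partitions_no1_def in_parts_iff)

lemma finite_partitions_no1: "finite (partitions_no1 n)"
  by (simp add: partitions_no1_conv finite_parts)

lemma no1_parts: "\<nu> \<in> partitions_no1 n \<Longrightarrow> \<nu> \<in> parts n n"
  by (simp add: partitions_no1_conv)

lemma no1_no_zero: "\<nu> \<in> partitions_no1 n \<Longrightarrow> 0 \<notin># \<nu>"
  by (simp add: partitions_no1_def)

lemma e_idem_replicate_1_add:
  assumes "\<mu> \<in> partitions_no1 m"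
  shows "e_idem (replicate_mset k 1 + \<mu>) = dpow k (zeta 1) * e_idem \<mu>"
  unfolding e_idem_conv_emon emon_replicate[symmetric]
proof (rule emon_add)
  fix x y :: nat assume "x \<in># replicate_mset k 1" "y \<in># \<mu>"
  then show "x < y"
    using assms by (cases "y = 0 \<or> y = 1") (auto simp: partitions_no1_def split: if_splits)
qed

text \<open>The part 1 comes first in the increasing order, so its powers split off on the left;
  they are the first exponential of the Zassenhaus product.\<close>

lemma S_conv_sum_dpow:
  "S n = (\<Sum>k\<le>n. dpow k (zeta 1) * (\<Sum>\<mu>\<in>partitions_no1 (n - k). e_idem \<mu>))"
proof -
  have "bij_betw (\<lambda>(k, \<mu>). replicate_mset k 1 + \<mu>) (SIGMA k:{..n}. partitions_no1 (n - k)) (parts n n)"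
  proof (rule bij_betw_byWitness[where f' = "\<lambda>\<nu>. (count \<nu> 1, filter_mset (\<lambda>i. i \<noteq> 1) \<nu>)"])
    have filt: "filter_mset (\<lambda>i. i \<noteq> 1) \<mu> = \<mu>" if "1 \<notin># \<mu>" for \<mu> :: "nat multiset"
      using that by (auto simp: filter_mset_eq_conv)
    show "\<forall>x\<in>SIGMA k:{..n}. partitions_no1 (n - k).
       (\<lambda>\<nu>. (count \<nu> 1, filter_mset (\<lambda>i. i \<noteq> 1) \<nu>)) ((\<lambda>(k, \<mu>). replicate_mset k 1 + \<mu>) x) = x"
      using filt by (auto simp: partitions_no1_def not_in_iff[symmetric] count_eq_zero_iff)
    have split: "replicate_mset (count \<nu> 1) 1 + filter_mset (\<lambda>i. i \<noteq> 1) \<nu> = \<nu>" for \<nu> :: "nat multiset"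
      by (rule multiset_eqI) auto
    then show "\<forall>\<nu>\<in>parts n n. (\<lambda>(k, \<mu>). replicate_mset k 1 + \<mu>)
        (count \<nu> 1, filter_mset (\<lambda>i. i \<noteq> 1) \<nu>) = \<nu>"
      by simp
    show "(\<lambda>(k, \<mu>). replicate_mset k 1 + \<mu>) ` (SIGMA k:{..n}. partitions_no1 (n - k)) \<subseteq> parts n n"
      by (auto simp: in_parts_iff partitions_no1_def sum_mset_replicate_mset split: if_splits)
    show "(\<lambda>\<nu>. (count \<nu> 1, filter_mset (\<lambda>i. i \<noteq> 1) \<nu>)) ` parts n n \<subseteq> (SIGMA k:{..n}. partitions_no1 (n - k))"
    proof
      fix x assume "x \<in> (\<lambda>\<nu>. (count \<nu> 1, filter_mset (\<lambda>i. i \<noteq> 1) \<nu>)) ` parts n n"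
      then obtain \<nu> where \<nu>: "0 \<notin># \<nu>" "sum_mset \<nu> = n"
        and x: "x = (count \<nu> 1, filter_mset (\<lambda>i. i \<noteq> 1) \<nu>)" by (auto simp: in_parts_iff)
      have "count \<nu> 1 + sum_mset (filter_mset (\<lambda>i. i \<noteq> 1) \<nu>) = n"
        using arg_cong[OF split[of \<nu>], of sum_mset] \<nu>(2) by (simp add: sum_mset_replicate_mset)
      then have "count \<nu> 1 \<le> n" "sum_mset (filter_mset (\<lambda>i. i \<noteq> 1) \<nu>) = n - count \<nu> 1" by linarith+
      then show "x \<in> (SIGMA k:{..n}. partitions_no1 (n - k))"
        using \<nu>(1) by (auto simp: x partitions_no1_def)
    qed
  qed
  from sum.reindex_bij_betw[OF this, of e_idem]
  have "S n = (\<Sum>(k, \<mu>)\<in>(SIGMA k:{..n}. partitions_no1 (n - k)). e_idem (replicate_mset k 1 + \<mu>))"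
    by (simp add: S_conv_sum_e_idem case_prod_unfold)
  also have "\<dots> = (\<Sum>k\<le>n. \<Sum>\<mu>\<in>partitions_no1 (n - k). e_idem (replicate_mset k 1 + \<mu>))"
    by (subst sum.Sigma) (simp_all add: finite_partitions_no1)
  also have "\<dots> = (\<Sum>k\<le>n. dpow k (zeta 1) * (\<Sum>\<mu>\<in>partitions_no1 (n - k). e_idem \<mu>))"
    using e_idem_replicate_1_add by (simp add: sum_distrib_left)
  finally show ?thesis .
qed

text \<open>The factor \<open>exp (- S\<^sub>1)\<close> cancels the first factor of the Zassenhaus product.\<close>

lemma S_sharp_conv_sum: "S_sharp n = (\<Sum>\<nu>\<in>partitions_no1 n. e_idem \<nu>)"
proof -
  define T where "T m = (\<Sum>\<mu>\<in>partitions_no1 m. e_idem \<mu>)" for m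
  let ?z = "zeta 1"
  have "S_sharp n = (\<Sum>i\<le>n. dpow i (- ?z) * S (n - i))"
    by (simp only: S_sharp_def nsym_scale_conv_mult dpow_uminus zeta_1 mult.assoc)
  also have "\<dots> = (\<Sum>i\<le>n. \<Sum>k\<le>n - i. dpow i (- ?z) * dpow k ?z * T (n - i - k))"
    by (simp add: S_conv_sum_dpow T_def sum_distrib_left mult.assoc)
  also have "\<dots> = (\<Sum>l\<le>n. \<Sum>i\<le>l. dpow i (- ?z) * dpow (l - i) ?z * T (n - l))"
    unfolding sum.Sigma[OF finite_atMost ballI[OF finite_atMost]]
    by (rule sum.reindex_bij_witness[where i = "\<lambda>(l, i). (i, l - i)" and j = "\<lambda>(i, k). (i + k, i)"]) auto
  also have "\<dots> = (\<Sum>l\<le>n. dpow l (- ?z + ?z) * T (n - l))"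
    by (simp only: dpow_add_commuting[of ?z "- ?z"] sum_distrib_right minus_mult_left[symmetric] minus_mult_right[symmetric])
  also have "\<dots> = (\<Sum>l\<in>{0}. dpow l 0 * T (n - l))"
    by (simp only: add.left_inverse, rule sum.mono_neutral_right) (auto simp: dpow_def power_0_left)
  finally show ?thesis by (simp add: T_def)
qed

section \<open>Contents without the letter 1\<close>

lemma content_space_Sym:
  assumes "x \<in> content_space \<nu>"
  shows "x \<in> Sym (sum_mset \<nu>)"
proof -
  have "nsym.subspace (Sym m)" for m
    by (simp add: nsym.subspace_def Sym_zero Sym_add Sym_scale)
  moreover have "zword w \<in> Sym (sum_mset \<nu>)" if "mset w = \<nu>" for w
    using zword_Sym[of w] that by (auto simp: sum_mset_sum_list)
  ultimately show ?thesis
    using nsym.span_minimal[of "{zword w | w. mset w = \<nu>}" "Sym (sum_mset \<nu>)"] assms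
    by (auto simp: content_space_def)
qed

text \<open>The part 1 is the first letter of \<open>e_idem \<mu>\<close>. It would have to receive
  factors of total degree 1, which do not exist without the letter 1.\<close>

lemma e_idem_with_1_star:
  assumes "1 \<in># \<mu>" "\<mu> \<in> parts n n" "x \<in> content_space \<nu>" "0 \<notin># \<nu>" "1 \<notin># \<nu>"
  shows "e_idem \<mu> \<star> x = 0"
proof -
  have "e_idem \<mu> \<star> x \<in> {0}"
    using assms(3) unfolding content_space_def
  proof (rule lin_span[OF _ lin_star_right subspace_zero])
    fix a assume "a \<in> {zword w | w. mset w = \<nu>}"
    then obtain w where w: "mset w = \<nu>" "a = zword w" by blast
    have "1 \<in> set (sorted_list_of_multiset \<mu>)" using assms(1) by simp
    then obtain I where I: "sorted_list_of_multiset \<mu> = 1 # I"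
    proof (cases "sorted_list_of_multiset \<mu>")
      case (Cons i I)
      have "i \<in># \<mu>" by (metis Cons list.set_intros(1) set_sorted_list_of_multiset)
      then have "i \<noteq> 0" using parts_no_zero[OF assms(2)] by metis
      moreover have "sorted (i # I)" by (metis Cons sorted_sorted_list_of_multiset)
      ultimately have "i = 1" using \<open>1 \<in> set _\<close> Cons by auto
      then show thesis using that Cons by simp
    qed simp
    have "zword (1 # I) \<star> pr (map (\<lambda>a. [a]) w) = Usum (\<lambda>u v. 0) (map (\<lambda>a. [a]) w)"
      unfolding zword_simps mult_star_pr
    proof (rule Usum_cong)
      fix u v assume uv: "mset u + mset v = mset (map (\<lambda>a. [a]) w)"
      have letters: "a \<noteq> 0 \<and> a \<noteq> 1" if "a \<in> set (concat u)" for a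
      proof -
        have "a \<in># mset (concat (map (\<lambda>a. [a]) w))"
          using that by (subst mset_concat_split[OF uv, symmetric]) simp
        then have "a \<in># \<nu>" using w(1) by simp
        then show ?thesis using assms by metis
      qed
      have "sum_list (concat u) \<noteq> 1"
      proof (cases "concat u")
        case (Cons a as)
        then show ?thesis using letters[of a] by simp
      next
        case Nil
        then show ?thesis by (simp only:) simp
      qed
      then have "zeta 1 \<star> pr u = 0"
        using star_diff_degree[OF zeta_Sym pr_Sym, of 1 u] by simp
      then show "(zeta 1 \<star> pr u) * (zword I \<star> pr v) = 0" by simp
    qed
    then have "zword (1 # I) \<star> pr (map (\<lambda>a. [a]) w) = 0" by simp
    then show "e_idem \<mu> \<star> a \<in> {0}"
      unfolding e_idem_conv_zword I w(2) pr_singletons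
      by (simp only: nsym_lin_scale[OF lin_star_left] nsym.scale_zero_right singletonI)
  qed
  then show ?thesis by simp
qed

text \<open>\<open>S n\<close> is the unit, \<open>S_sharp n\<close> collects its idempotents
  without part 1, and the remaining idempotents annihilate these contents.\<close>

lemma S_sharp_star:
  assumes "x \<in> content_space \<nu>" "\<nu> \<in> partitions_no1 n"
  shows "S_sharp n \<star> x = x"
proof -
  have "parts n n = partitions_no1 n \<union> {\<mu> \<in> parts n n. 1 \<in># \<mu>}"
    by (auto simp: partitions_no1_conv)
  moreover have "partitions_no1 n \<inter> {\<mu> \<in> parts n n. 1 \<in># \<mu>} = {}"
    by (auto simp: partitions_no1_conv)
  ultimately have "S n = S_sharp n + (\<Sum>\<mu>\<in>{\<mu> \<in> parts n n. 1 \<in># \<mu>}. e_idem \<mu>)"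
    unfolding S_conv_sum_e_idem S_sharp_conv_sum
    by (metis (no_types, lifting) finite_Un finite_parts sum.union_disjoint)
  moreover have "(\<Sum>\<mu>\<in>{\<mu> \<in> parts n n. 1 \<in># \<mu>}. e_idem \<mu>) \<star> x = 0"
    unfolding lin_sum[OF lin_star_left]
    using assms by (intro sum.neutral) (auto intro!: e_idem_with_1_star simp: partitions_no1_def)
  ultimately have "S n \<star> x = S_sharp n \<star> x" by (simp add: lin_add[OF lin_star_left])
  moreover have "x \<in> Sym n"
    using content_space_Sym[OF assms(1)] assms(2) by (simp add: partitions_no1_def)
  ultimately show ?thesis by (simp add: S_star)
qed

section \<open>The ring structure\<close>

abbreviation D0c :: "nat \<Rightarrow> nsym set" where
  "D0c n \<equiv> carrier (D0 n)"

lemma D0_simps [simp]: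
  "mult (D0 n) = (\<star>)" "one (D0 n) = S_sharp n" "zero (D0 n) = 0" "add (D0 n) = (+)"
  by (simp_all add: D0_def)

lemma star_S_sharp: "F \<star> S_sharp n = (\<Sum>\<nu>\<in>partitions_no1 n. F \<star> e_idem \<nu>)"
  by (simp add: S_sharp_conv_sum lin_sum[OF lin_star_right])

lemma content_space_right:
  assumes "x \<in> content_space \<nu>" "\<nu> \<in> parts n n" "\<mu> \<in> parts n n"
  shows "x \<star> e_idem \<mu> = (if \<nu> = \<mu> then x else 0)"
proof -
  have "x \<in> Sym n" using content_space_Sym[OF assms(1)] assms(2) by (simp add: in_parts_iff)
  then show ?thesis
    using star_e_idem[of x n \<mu>] content_proj_content_space[OF assms(1) parts_no_zero[OF assms(2)]] assms(3)
    by simp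
qed

lemma content_space_S_sharp:
  assumes "x \<in> content_space \<nu>" "\<nu> \<in> partitions_no1 n"
  shows "x \<star> S_sharp n = x"
proof -
  have "x \<star> S_sharp n = (\<Sum>\<mu>\<in>partitions_no1 n. if \<nu> = \<mu> then x else 0)"
    unfolding star_S_sharp
    by (intro sum.cong refl content_space_right[OF assms(1) no1_parts[OF assms(2)] no1_parts])
  then show ?thesis using assms(2) by (simp add: finite_partitions_no1)
qed

lemma S_sharp_idem: "S_sharp n \<star> S_sharp n = S_sharp n"
  by (subst (3) S_sharp_conv_sum, subst star_S_sharp)
     (intro sum.cong refl S_sharp_star[OF e_idem_content_space])

text \<open>As \<open>S_sharp n\<close> is idempotent, the left ideal that it generates is the set
  of fixed points of right multiplication by it.\<close>

lemma D0_iff: "x \<in> D0c n \<longleftrightarrow> x \<in> Sym n \<and> x \<star> S_sharp n = x"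
proof
  assume "x \<in> D0c n"
  then obtain F where F: "F \<in> Sym n" "x = F \<star> S_sharp n" by (auto simp: D0_def)
  then show "x \<in> Sym n \<and> x \<star> S_sharp n = x"
    by (simp add: star_Sym star_assoc S_sharp_idem)
next
  assume "x \<in> Sym n \<and> x \<star> S_sharp n = x"
  then show "x \<in> D0c n" by (auto simp: D0_def) metis
qed

lemma D0_decomp: "x \<in> D0c n \<Longrightarrow> x = (\<Sum>\<nu>\<in>partitions_no1 n. x \<star> e_idem \<nu>)"
  by (simp add: D0_iff star_S_sharp)

lemma content_space_D0: "\<nu> \<in> partitions_no1 n \<Longrightarrow> x \<in> content_space \<nu> \<Longrightarrow> x \<in> D0c n"
  using content_space_Sym[of x \<nu>] by (auto simp: D0_iff content_space_S_sharp partitions_no1_def)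

lemma star_e_idem_content: "F \<star> e_idem \<nu> \<in> content_space \<nu>"
  by (intro star_content_space e_idem_content_space)

lemma subspace_D0: "nsym.subspace (D0c n)"
  by (auto simp: nsym.subspace_def D0_iff Sym_zero Sym_add Sym_scale lin_0[OF lin_star_left]
      lin_add[OF lin_star_left] nsym_lin_scale[OF lin_star_left])

lemma S_sharp_D0: "S_sharp n \<in> D0c n"
  unfolding S_sharp_conv_sum
  by (intro nsym.subspace_sum[OF subspace_D0] content_space_D0[OF _ e_idem_content_space])

lemma S_sharp_left:
  assumes "x \<in> D0c n"
  shows "S_sharp n \<star> x = x"
proof -
  have "S_sharp n \<star> (\<Sum>\<nu>\<in>partitions_no1 n. x \<star> e_idem \<nu>) = (\<Sum>\<nu>\<in>partitions_no1 n. x \<star> e_idem \<nu>)"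
    unfolding lin_sum[OF lin_star_right]
    by (intro sum.cong refl S_sharp_star[OF star_e_idem_content])
  then show ?thesis by (simp only: flip: D0_decomp[OF assms])
qed

lemma S_sharp_right: "x \<in> D0c n \<Longrightarrow> x \<star> S_sharp n = x"
  by (simp add: D0_iff)

lemma star_D0: "x \<in> D0c n \<Longrightarrow> y \<in> D0c n \<Longrightarrow> x \<star> y \<in> D0c n"
  by (simp add: D0_iff star_Sym star_assoc)

lemma ring_D0: "ring (D0 n)"
proof (rule ringI)
  show "abelian_group (D0 n)"
  proof (rule abelian_groupI)
    show "\<exists>y\<in>D0c n. y \<oplus>\<^bsub>D0 n\<^esub> x = \<zero>\<^bsub>D0 n\<^esub>" if "x \<in> D0c n" for x
      by (rule bexI[of _ "- x"]) (use that nsym.subspace_neg[OF subspace_D0] in auto)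
  qed (auto simp: nsym.subspace_add[OF subspace_D0] nsym.subspace_0[OF subspace_D0] add_ac)
  show "Group.monoid (D0 n)"
    by (rule monoidI) (auto simp: star_D0 S_sharp_D0 star_assoc S_sharp_left S_sharp_right)
qed (auto simp: lin_add[OF lin_star_left] lin_add[OF lin_star_right])

subsection \<open>The characters\<close>

text \<open>The abelianization: Zassenhaus letters become commuting variables, with multisets as
  monomials.\<close>

definition abel :: "nsym \<Rightarrow> nat multiset \<Rightarrow>\<^sub>0 complex" where
  "abel F = ext (\<lambda>I. single (mset (comp_parts I)) 1) (of_zeta F)"

lemma lin_abel: "lin abel"
  unfolding abel_def by (rule lin_comp[OF lin_ext lin_of_zeta])

lemma abel_mult: "abel (F * G) = abel F * abel G"
  unfolding abel_def of_zeta_mult by (rule ext_mult) (simp add: mult_single)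

lemma abel_zword: "0 \<notin> set w \<Longrightarrow> abel (zword w) = single (mset w) 1"
  by (simp add: abel_def of_zeta_zword)

lemma abel_commutator: "abel (K * (F * G - G * F) * L) = 0"
  by (simp add: abel_mult lin_diff[OF lin_abel] mult.commute)

definition m_fact :: "nat multiset \<Rightarrow> complex" where
  "m_fact \<nu> = (\<Prod>i\<in>set_mset \<nu>. fact (count \<nu> i))"

lemma m_fact_nonzero [simp]: "m_fact \<nu> \<noteq> 0"
  by (simp add: m_fact_def)

lemma e_idem_conv_m_fact: "e_idem \<nu> = nsym_scale (1 / m_fact \<nu>) (zword (sorted_list_of_multiset \<nu>))"
  by (simp add: e_idem_conv_zword m_fact_def)

text \<open>The factor normalizes the value on \<open>e_idem \<nu>\<close> to 1.\<close>

definition charac :: "nat multiset \<Rightarrow> nsym \<Rightarrow> complex" where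
  "charac \<nu> F = m_fact \<nu> * Poly_Mapping.lookup (abel F) \<nu>"

lemma charac_add: "charac \<nu> (F + G) = charac \<nu> F + charac \<nu> G"
  by (simp add: charac_def lin_add[OF lin_abel] lookup_add algebra_simps)

lemma charac_scale: "charac \<nu> (nsym_scale c F) = c * charac \<nu> F"
  by (simp add: charac_def nsym_scale_conv_mult lin_scale[OF lin_abel] lookup_scale)

lemma charac_sum: "charac \<nu> (sum f A) = (\<Sum>x\<in>A. charac \<nu> (f x))"
  by (simp add: charac_def lin_sum[OF lin_abel] lookup_sum sum_distrib_left)

lemma subspace_ker_charac: "nsym.subspace {x. charac \<nu> x = 0}"
  by (simp add: nsym.subspace_def charac_add charac_scale)
     (simp add: charac_def lin_0[OF lin_abel])

lemma charac_zword: "0 \<notin> set w \<Longrightarrow> charac \<nu> (zword w) = (if mset w = \<nu> then m_fact \<nu> else 0)"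
  by (simp add: charac_def abel_zword lookup_single when_def)

lemma charac_e_idem: "0 \<notin># \<nu> \<Longrightarrow> charac \<mu> (e_idem \<nu>) = (if \<mu> = \<nu> then 1 else 0)"
  by (auto simp: e_idem_conv_m_fact charac_scale charac_zword)

lemma charac_other_content:
  assumes "x \<in> content_space \<nu>" "0 \<notin># \<nu>" "\<mu> \<noteq> \<nu>"
  shows "charac \<mu> x = 0"
proof -
  have "{zword w | w. mset w = \<nu>} \<subseteq> {x. charac \<mu> x = 0}"
    using assms(2,3) by (auto simp: charac_zword)
  from nsym.span_minimal[OF this subspace_ker_charac] show ?thesis
    using assms(1) by (auto simp: content_space_def)
qed

lemma charac_star_e_idem:
  assumes "x \<in> D0c n" "\<nu> \<in> partitions_no1 n"
  shows "charac \<nu> (x \<star> e_idem \<nu>) = charac \<nu> x"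
proof -
  have "charac \<nu> x = (\<Sum>\<mu>\<in>partitions_no1 n. charac \<nu> (x \<star> e_idem \<mu>))"
    using D0_decomp[OF assms(1)] charac_sum by metis
  also have "\<dots> = (\<Sum>\<mu>\<in>{\<nu>}. charac \<nu> (x \<star> e_idem \<mu>))"
    using assms(2)
    by (intro sum.mono_neutral_right)
       (auto simp: finite_partitions_no1 intro: charac_other_content[OF star_e_idem_content no1_no_zero])
  finally show ?thesis by simp
qed

lemma charac_Lprod:
  assumes "x \<in> Lprod (size \<nu>) \<nu>"
  shows "charac \<mu> x = 0"
proof -
  have "charac \<mu> (pr bs) = 0" if bs: "list_all valid bs" "length bs < size (mset (concat bs))" for bs
  proof -
    obtain w where w: "w \<in> set bs" "length w \<ge> 2" using nontrivial_bracket[OF bs] by blast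
    from pr_nontrivial_decomp[OF w] obtain K X d L
      where "pr bs = K * (br X * zeta d - zeta d * br X) * L" by blast
    then show ?thesis by (simp add: charac_def abel_commutator)
  qed
  then have "{pr bs | bs. list_all valid bs \<and> mset (concat bs) = \<nu> \<and> length bs < size \<nu>} \<subseteq> {x. charac \<mu> x = 0}"
    by auto
  from nsym.span_minimal[OF this subspace_ker_charac] show ?thesis
    using assms by (auto simp: Lprod_def)
qed

lemma concat_singletons: "concat (map (\<lambda>a. [a]) w) = w"
  by (induction w) simp_all

lemma valid_singletons: "0 \<notin> set w \<Longrightarrow> list_all valid (map (\<lambda>a. [a]) w)"
  by (induction w) (simp_all add: valid_def)

text \<open>All words of content \<nu> agree modulo products of fewer than \<open>size \<nu>\<close>
  brackets, so a content space is the line of its idempotent plus the commutator part.\<close>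

lemma diff_charac_in_Lprod:
  assumes "x \<in> content_space \<nu>" "0 \<notin># \<nu>"
  shows "x - nsym_scale (charac \<nu> x) (e_idem \<nu>) \<in> Lprod (size \<nu>) \<nu>"
proof (rule lin_span[OF assms(1)[unfolded content_space_def] _ subspace_Lprod])
  show "lin (\<lambda>x. x - nsym_scale (charac \<nu> x) (e_idem \<nu>))"
    unfolding lin_def nsym_scale_conv_mult[symmetric] charac_add charac_scale
    by (simp add: nsym.scale_left_distrib nsym.scale_right_diff_distrib algebra_simps)
  fix a assume "a \<in> {zword w | w. mset w = \<nu>}"
  then obtain w where w: "mset w = \<nu>" "a = zword w" by blast
  have "0 \<notin> set w" using assms(2) w(1) by auto
  have "pr (map (\<lambda>a. [a]) w) - pr (map (\<lambda>a. [a]) (sorted_list_of_multiset \<nu>))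
      \<in> Lprod (length (map (\<lambda>a. [a]) w)) (mset (concat (map (\<lambda>a. [a]) w)))"
    by (rule pr_perm[OF _ valid_singletons[OF \<open>0 \<notin> set w\<close>]]) (simp add: w(1))
  then have "zword w - zword (sorted_list_of_multiset \<nu>) \<in> Lprod (size \<nu>) \<nu>"
    unfolding pr_singletons concat_singletons using w(1) by auto
  then show "a - nsym_scale (charac \<nu> a) (e_idem \<nu>) \<in> Lprod (size \<nu>) \<nu>"
    using w \<open>0 \<notin> set w\<close> by (simp add: charac_zword e_idem_conv_m_fact)
qed

text \<open>Modulo \<open>Lprod (size \<nu>) \<nu>\<close>, the element y \<star>
  \<open>e_idem \<nu>\<close> is a multiple of \<open>e_idem \<nu>\<close>. Left multiplication by x
  preserves that space, on which the character vanishes.\<close>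

lemma charac_mult:
  assumes x: "x \<in> D0c n" and y: "y \<in> D0c n" and \<nu>: "\<nu> \<in> partitions_no1 n"
  shows "charac \<nu> (x \<star> y) = charac \<nu> x * charac \<nu> y"
proof -
  let ?e = "e_idem \<nu>"
  have Lx: "z \<star> ?e - nsym_scale (charac \<nu> z) ?e \<in> Lprod (size \<nu>) \<nu>" if "z \<in> D0c n" for z
    using diff_charac_in_Lprod[OF star_e_idem_content[of z \<nu>] no1_no_zero[OF \<nu>]]
    by (simp add: charac_star_e_idem[OF that \<nu>])
  have "charac \<nu> (x \<star> y) = charac \<nu> ((x \<star> y) \<star> ?e)"
    by (rule charac_star_e_idem[OF star_D0[OF x y] \<nu>, symmetric])
  also have "(x \<star> y) \<star> ?e = nsym_scale (charac \<nu> y) (x \<star> ?e) + x \<star> (y \<star> ?e - nsym_scale (charac \<nu> y) ?e)"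
    by (simp add: star_assoc lin_diff[OF lin_star_right] nsym_lin_scale[OF lin_star_right])
  also have "charac \<nu> \<dots> = charac \<nu> y * charac \<nu> (x \<star> ?e)"
    using charac_Lprod[OF star_Lprod[OF Lx[OF y]]] by (simp add: charac_add charac_scale)
  finally show ?thesis by (simp add: charac_star_e_idem[OF x \<nu>])
qed

lemma size_le_sum_mset: "0 \<notin># \<nu> \<Longrightarrow> size \<nu> \<le> sum_mset \<nu>" for \<nu> :: "nat multiset"
  by (induction \<nu>) auto

text \<open>If all characters of x vanish, the components of x lie in the commutator ideal, and each
  of them lowers the number of factors.\<close>

lemma charac_zero_star_Lprod:
  assumes x: "x \<in> D0c n" "\<And>\<nu>. \<nu> \<in> partitions_no1 n \<Longrightarrow> charac \<nu> x = 0" and y: "y \<in> Lprod s \<nu>"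
  shows "x \<star> y \<in> Lprod (s - 1) \<nu>"
proof -
  have "x \<star> e_idem \<mu> \<in> Lprod (size \<mu>) \<mu>" if "\<mu> \<in> partitions_no1 n" for \<mu>
    using diff_charac_in_Lprod[OF star_e_idem_content[of x \<mu>] no1_no_zero[OF that]]
    by (simp add: charac_star_e_idem[OF x(1) that] x(2)[OF that])
  then have "(\<Sum>\<mu>\<in>partitions_no1 n. (x \<star> e_idem \<mu>) \<star> y) \<in> Lprod (s - 1) \<nu>"
    by (intro nsym.subspace_sum[OF subspace_Lprod] Lprod_star_Lprod[OF _ y])
  then show ?thesis
    using D0_decomp[OF x(1)] by (metis lin_sum[OF lin_star_left])
qed

lemma D0_split_basic:
  "split_basic_ring (D0 n) (partitions_no1 n) charac (\<lambda>\<nu> c. nsym_scale c (e_idem \<nu>))"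
proof -
  interpret ring "D0 n" by (rule ring_D0)
  show ?thesis
  proof (intro split_basic_ring.intro[OF ring_D0] split_basic_ring_axioms.intro)
    fix \<nu> c assume \<nu>: "\<nu> \<in> partitions_no1 n"
    show "nsym_scale c (e_idem \<nu>) \<in> D0c n"
      by (intro nsym.subspace_scale[OF subspace_D0] content_space_D0[OF \<nu>] e_idem_content_space)
    fix d
    show "nsym_scale c (e_idem \<nu>) \<oplus>\<^bsub>D0 n\<^esub> nsym_scale d (e_idem \<nu>) = nsym_scale (c + d) (e_idem \<nu>)"
      by (simp add: nsym.scale_left_distrib)
    show "nsym_scale c (e_idem \<nu>) \<otimes>\<^bsub>D0 n\<^esub> nsym_scale d (e_idem \<nu>) = nsym_scale (c * d) (e_idem \<nu>)"
      using e_idem_orthogonal[OF no1_parts[OF \<nu>] no1_parts[OF \<nu>]]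
      by (simp add: nsym_lin_scale[OF lin_star_left] nsym_lin_scale[OF lin_star_right])
    show "charac \<nu> (x \<oplus>\<^bsub>D0 n\<^esub> y) = charac \<nu> x + charac \<nu> y" for x y
      by (simp add: charac_add)
    show "charac \<nu> (x \<otimes>\<^bsub>D0 n\<^esub> y) = charac \<nu> x * charac \<nu> y" if "x \<in> D0c n" "y \<in> D0c n" for x y
      using charac_mult[OF that \<nu>] by simp
    show "charac \<mu> (nsym_scale c (e_idem \<nu>)) = (if \<mu> = \<nu> then c else 0)" for \<mu>
      using no1_no_zero[OF \<nu>] by (simp add: charac_scale charac_e_idem)
  next
    fix I assume I: "left_ideal I (D0 n)" "\<And>\<nu>. \<nu> \<in> partitions_no1 n \<Longrightarrow> nsym_scale 1 (e_idem \<nu>) \<in> I"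
    then interpret I: additive_subgroup I "D0 n" by (simp add: left_ideal_def)
    have "(\<Sum>\<nu>\<in>A. e_idem \<nu>) \<in> I" if "finite A" "A \<subseteq> partitions_no1 n" for A
      using that I(2) I.zero_closed I.a_closed by (induction A) auto
    then show "\<one>\<^bsub>D0 n\<^esub> \<in> I"
      by (simp add: S_sharp_conv_sum finite_partitions_no1)
  next
    fix x assume x: "x \<in> D0c n" "\<And>\<nu>. \<nu> \<in> partitions_no1 n \<Longrightarrow> charac \<nu> x = 0"
    have pow: "x [^]\<^bsub>D0 n\<^esub> k \<star> y \<in> Lprod (s - k) \<nu>" if "y \<in> Lprod s \<nu>" for k :: nat and y s \<nu>
      using that
    proof (induction k arbitrary: y s)
      case 0
      then show ?case by (simp add: star_Lprod)
    next
      case (Suc k)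
      have "x [^]\<^bsub>D0 n\<^esub> k \<star> (x \<star> y) \<in> Lprod (s - 1 - k) \<nu>"
        by (intro Suc.IH charac_zero_star_Lprod[OF x Suc.prems])
      then show ?case by (simp add: star_assoc)
    qed
    \<comment> \<open>The idempotent is a combination of products of \<open>size \<nu>\<close>
      brackets, at most n of them, and every factor x lowers the bound; so the power n + 1 ends in
      \<open>Lprod 0\<close>.\<close>
    have "x [^]\<^bsub>D0 n\<^esub> Suc n \<star> e_idem \<nu> = 0" if \<nu>: "\<nu> \<in> partitions_no1 n" for \<nu>
    proof -
      have "zword (sorted_list_of_multiset \<nu>) \<in> Lprod (Suc (size \<nu>)) \<nu>"
        using pr_in_Lprod[OF valid_singletons[of "sorted_list_of_multiset \<nu>"] refl lessI] no1_no_zero[OF \<nu>]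
        by (simp add: pr_singletons concat_singletons flip: size_mset)
      then have "e_idem \<nu> \<in> Lprod (Suc (size \<nu>)) \<nu>"
        unfolding e_idem_conv_m_fact by (rule nsym.subspace_scale[OF subspace_Lprod])
      from pow[OF this, of "Suc n"] show ?thesis
        using size_le_sum_mset[OF no1_no_zero[OF \<nu>]] \<nu> by (simp add: partitions_no1_def)
    qed
    moreover have "x [^]\<^bsub>D0 n\<^esub> Suc n \<in> D0c n" using x(1) by (rule nat_pow_closed)
    ultimately have "x [^]\<^bsub>D0 n\<^esub> Suc n = 0" using D0_decomp by (metis (no_types, lifting) sum.neutral)
    then show "\<exists>k :: nat. x [^]\<^bsub>D0 n\<^esub> k = \<zero>\<^bsub>D0 n\<^esub>" by (metis D0_simps(3))
  qed
qed

section \<open>Powers of the radical\<close>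

context
  fixes n :: nat
begin

interpretation D: split_basic_ring "D0 n" "partitions_no1 n" charac "\<lambda>\<nu> c. nsym_scale c (e_idem \<nu>)"
  by (rule D0_split_basic)

lemma ideal_rad_power: "ideal (rad_power (D0 n) k) (D0 n)"
  by (induction k) (simp_all add: D.oneideal D.jacobson_radical_eq D.ideal_prod_is_ideal D.ideal_N)

lemma rad_power_subset: "rad_power (D0 n) k \<subseteq> D0c n"
  using ideal.Icarr[OF ideal_rad_power] by blast

lemma subspace_rad_power: "nsym.subspace (rad_power (D0 n) k)"
proof -
  interpret I: ideal "rad_power (D0 n) k" "D0 n" by (rule ideal_rad_power)
  have "nsym_scale c x \<in> rad_power (D0 n) k" if x: "x \<in> rad_power (D0 n) k" for c x
  proof -
    have "nsym_scale c (S_sharp n) \<star> x \<in> rad_power (D0 n) k"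
      using I.I_l_closed[OF x nsym.subspace_scale[OF subspace_D0 S_sharp_D0]] by simp
    moreover have "S_sharp n \<star> x = x" using x rad_power_subset by (intro S_sharp_left) blast
    ultimately show ?thesis by (simp add: nsym_lin_scale[OF lin_star_left])
  qed
  then show ?thesis
    using I.zero_closed I.a_closed by (simp add: nsym.subspace_def)
qed

text \<open>\<open>rad_power\<close> grows by factors on the right, whereas the radical words below
  act from the left. The unit \<open>S_sharp n\<close> starts the induction.\<close>

lemma radical_mult_rad_power:
  assumes "x \<in> D.N" "y \<in> rad_power (D0 n) k"
  shows "x \<star> y \<in> rad_power (D0 n) (Suc k)"
  using assms(2)
proof (induction k arbitrary: y)
  case 0
  then have "x \<star> y \<in> D.N" using ideal.I_r_closed[OF D.ideal_N assms(1)] by simp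
  then have "S_sharp n \<star> (x \<star> y) \<in> rad_power (D0 n) (Suc 0)"
    using ideal_prod.prod[of "S_sharp n" "D0c n" "x \<star> y" D.N "D0 n"]
    by (simp add: S_sharp_D0 D.jacobson_radical_eq)
  moreover have "x \<star> y \<in> D0c n" using \<open>x \<star> y \<in> D.N\<close> by (simp add: D.N_def)
  ultimately show ?case by (simp add: S_sharp_left)
next
  case (Suc k)
  from Suc.prems have "y \<in> ideal_prod (D0 n) (rad_power (D0 n) k) D.N"
    by (simp add: D.jacobson_radical_eq)
  then show ?case
  proof (induction rule: ideal_prod.induct)
    case (prod i j)
    have "(x \<star> i) \<star> j \<in> ideal_prod (D0 n) (rad_power (D0 n) (Suc k)) D.N"
      using ideal_prod.prod[OF Suc.IH[OF prod(1)] prod(2), where R = "D0 n"] by simp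
    then show ?case by (simp add: D.jacobson_radical_eq star_assoc)
  next
    case (sum s t)
    then show ?case
      using nsym.subspace_add[OF subspace_rad_power[of "Suc (Suc k)"]]
      by (simp only: D0_simps lin_add[OF lin_star_right])
  qed
qed

text \<open>The upper bound for the powers: each radical factor costs one bracket.\<close>

lemma rad_power_star_Lprod:
  assumes "x \<in> rad_power (D0 n) k" "y \<in> Lprod s \<nu>"
  shows "x \<star> y \<in> Lprod (s - k) \<nu>"
  using assms
proof (induction k arbitrary: x y s)
  case 0
  then show ?case by (simp add: star_Lprod)
next
  case (Suc k)
  from Suc.prems(1) have "x \<in> ideal_prod (D0 n) (rad_power (D0 n) k) D.N"
    by (simp add: D.jacobson_radical_eq)
  then show ?case
  proof (induction rule: ideal_prod.induct)
    case (prod i j)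
    have "j \<star> y \<in> Lprod (s - 1) \<nu>"
      using prod(2) by (intro charac_zero_star_Lprod[OF _ _ Suc.prems(2), of _ n]) (auto simp: D.N_def)
    from Suc.IH[OF prod(1) this] show ?case by (simp add: star_assoc)
  next
    case (sum s t)
    then show ?case
      using nsym.subspace_add[OF subspace_Lprod] by (simp add: lin_add[OF lin_star_left])
  qed
qed

lemma content_space_mult:
  assumes "x \<in> content_space \<mu>" "y \<in> content_space \<nu>"
  shows "x * y \<in> content_space (\<mu> + \<nu>)"
proof (rule bilin_span[OF assms[unfolded content_space_def] _ _ subspace_content_space])
  show "\<And>x :: nsym. lin ((*) x)" "\<And>y :: nsym. lin (\<lambda>x. x * y)"
    by (intro lin_mult_left lin_mult_right lin_id)+
  fix a b assume "a \<in> {zword w | w. mset w = \<mu>}" "b \<in> {zword w | w. mset w = \<nu>}"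
  then obtain u v where "a = zword u" "b = zword v" "mset (u @ v) = \<mu> + \<nu>" by auto
  then show "a * b \<in> content_space (\<mu> + \<nu>)"
    unfolding content_space_def by (intro nsym.span_base CollectI exI[of _ "u @ v"]) simp
qed

lemma zword_content_space: "zword w \<in> content_space (mset w)"
  unfolding content_space_def by (intro nsym.span_base) blast

lemma br_content_space: "br w \<in> content_space (mset w)"
proof (induction w rule: rev_induct)
  case Nil
  show ?case by (simp add: nsym.subspace_0[OF subspace_content_space])
next
  case (snoc d w)
  have d: "zeta d \<in> content_space {#d#}" using zword_content_space[of "[d]"] by simp
  show ?case
  proof (cases "w = []")
    case False
    have "br w * zeta d - zeta d * br w \<in> content_space (add_mset d (mset w))"
      using content_space_mult[OF snoc d] content_space_mult[OF d snoc]
      by (intro nsym.subspace_diff[OF subspace_content_space]) simp_all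
    then show ?thesis using False by (simp add: br_snoc)
  qed (use d in simp)
qed

lemma pr_content_space: "pr bs \<in> content_space (mset (concat bs))"
proof (induction bs)
  case Nil
  then show ?case using zword_content_space[of "[]"] by simp
next
  case (Cons w bs)
  then show ?case using content_space_mult[OF br_content_space Cons] by simp
qed

lemma Lprod_subset_content_space: "Lprod s \<nu> \<subseteq> content_space \<nu>"
  unfolding Lprod_def by (rule nsym.span_minimal[OF _ subspace_content_space]) (use pr_content_space in blast)

section \<open>Commutator words acting on as many brackets as letters\<close>

lemma picks_swap:
  "(\<Sum>(x, ys)\<leftarrow>picks bs. \<Sum>(y, zs)\<leftarrow>picks ys. f x y zs)
   = (\<Sum>(x, ys)\<leftarrow>picks bs. \<Sum>(y, zs)\<leftarrow>picks ys. f y x zs)" for f :: "'a \<Rightarrow> 'a \<Rightarrow> 'a list \<Rightarrow> nsym"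
proof (induction bs arbitrary: f)
  case (Cons b bs)
  have "(\<Sum>(x, ys)\<leftarrow>picks (b # bs). \<Sum>(y, zs)\<leftarrow>picks ys. f x y zs)
      = (\<Sum>(x, ys)\<leftarrow>picks bs. f b x ys) + (\<Sum>(x, ys)\<leftarrow>picks bs. f x b ys)
        + (\<Sum>(x, ys)\<leftarrow>picks bs. \<Sum>(y, zs)\<leftarrow>picks ys. f x y (b # zs))" for f :: "'a \<Rightarrow> 'a \<Rightarrow> 'a list \<Rightarrow> nsym"
    by (simp add: comp_def case_prod_unfold sum_list_addf add_ac)
  then show ?case using Cons.IH[of "\<lambda>x y zs. f x y (b # zs)"] by (simp add: add_ac)
qed simp

text \<open>Both words of the commutator use the same pairs of brackets, in opposite orders by
  \<open>picks_swap\<close>, so the terms combine to commutators of brackets.\<close>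

lemma commutator_star_same_length:
  assumes "length bs = Suc (Suc (length I))" "p \<ge> 1" "q \<ge> 1"
  shows "((zeta p * zeta q - zeta q * zeta p) * zword I) \<star> pr bs
      = (\<Sum>(x, ys)\<leftarrow>picks bs. \<Sum>(y, zs)\<leftarrow>picks ys.
          if sum_list x = p \<and> sum_list y = q then (br x * br y - br y * br x) * (zword I \<star> pr zs) else 0)"
proof -
  have len: "length ys = Suc (length I)" if "(x, ys) \<in> set (picks bs)" for x ys
    using mset_eq_length[of bs "x # ys"] picks_mset[OF that] assms(1) by simp
  have *: "zword (p # q # I) \<star> pr bs = (\<Sum>(x, ys)\<leftarrow>picks bs. \<Sum>(y, zs)\<leftarrow>picks ys.
        if sum_list x = p \<and> sum_list y = q then br x * br y * (zword I \<star> pr zs) else 0)"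
    if "p \<ge> 1" "q \<ge> 1" for p q
  proof -
    have "zword (p # q # I) \<star> pr bs
        = (\<Sum>(x, ys)\<leftarrow>picks bs. if sum_list x = p then br x * (zword (q # I) \<star> pr ys) else 0)"
      by (rule zword_Cons_star_same_length) (use assms(1) that in simp_all)
    also have "\<dots> = (\<Sum>(x, ys)\<leftarrow>picks bs. \<Sum>(y, zs)\<leftarrow>picks ys.
        if sum_list x = p \<and> sum_list y = q then br x * br y * (zword I \<star> pr zs) else 0)"
    proof (intro arg_cong[of _ _ sum_list] map_cong refl, clarify)
      fix x ys assume "(x, ys) \<in> set (picks bs)"
      then have "zword (q # I) \<star> pr ys
          = (\<Sum>(y, zs)\<leftarrow>picks ys. if sum_list y = q then br y * (zword I \<star> pr zs) else 0)"
        by (intro zword_Cons_star_same_length len that)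
      then show "(if sum_list x = p then br x * (zword (q # I) \<star> pr ys) else 0)
          = (\<Sum>(y, zs)\<leftarrow>picks ys. if sum_list x = p \<and> sum_list y = q then br x * br y * (zword I \<star> pr zs) else 0)"
        by (auto simp: sum_list_const_mult[symmetric] mult.assoc case_prod_unfold
            intro!: arg_cong[of _ _ sum_list] map_cong)
    qed
    finally show ?thesis .
  qed
  have "((zeta p * zeta q - zeta q * zeta p) * zword I) \<star> pr bs
      = zword (p # q # I) \<star> pr bs - zword (q # p # I) \<star> pr bs"
    by (simp add: left_diff_distrib mult.assoc lin_diff[OF lin_star_left])
  also have "zword (q # p # I) \<star> pr bs = (\<Sum>(x, ys)\<leftarrow>picks bs. \<Sum>(y, zs)\<leftarrow>picks ys.
        if sum_list y = q \<and> sum_list x = p then br y * br x * (zword I \<star> pr zs) else 0)"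
    unfolding *[OF assms(3,2)] by (rule picks_swap)
  finally show ?thesis
    unfolding *[OF assms(2,3)]
    by (auto simp: case_prod_unfold left_diff_distrib simp flip: sum_list_subtractf
        intro!: arg_cong[of _ _ sum_list] map_cong)
qed

lemma sum_list_in_subspace:
  assumes "nsym.subspace V" "\<And>x. x \<in> set xs \<Longrightarrow> f x \<in> V"
  shows "sum_list (map f xs) \<in> V"
  using assms(2)
  by (induction xs) (simp_all add: nsym.subspace_0[OF assms(1)] nsym.subspace_add[OF assms(1)])

text \<open>The multiplicity of g modulo V is tracked as a natural number, so that contributions
  cannot cancel; \<open>Q\<close> marks terms that certainly contribute.\<close>

lemma sum_list_approx:
  assumes "nsym.subspace V" "\<And>x. x \<in> set xs \<Longrightarrow> \<exists>c :: nat. f x - nsym_scale (of_nat c) g \<in> V \<and> (Q x \<longrightarrow> c > 0)"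
  shows "\<exists>c :: nat. sum_list (map f xs) - nsym_scale (of_nat c) g \<in> V \<and> ((\<exists>x\<in>set xs. Q x) \<longrightarrow> c > 0)"
  using assms(2)
proof (induction xs)
  case Nil
  show ?case by (rule exI[of _ 0]) (simp add: nsym.subspace_0[OF assms(1)])
next
  case (Cons x xs)
  have "\<exists>c :: nat. sum_list (map f xs) - nsym_scale (of_nat c) g \<in> V \<and> ((\<exists>x\<in>set xs. Q x) \<longrightarrow> c > 0)"
    by (rule Cons.IH) (simp add: Cons.prems)
  then obtain c d :: nat where cd: "f x - nsym_scale (of_nat c) g \<in> V" "Q x \<longrightarrow> c > 0"
    "sum_list (map f xs) - nsym_scale (of_nat d) g \<in> V" "(\<exists>x\<in>set xs. Q x) \<longrightarrow> d > 0"
    using Cons.prems[of x] by auto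
  have "sum_list (map f (x # xs)) - nsym_scale (of_nat (c + d)) g
      = (f x - nsym_scale (of_nat c) g) + (sum_list (map f xs) - nsym_scale (of_nat d) g)"
    by (simp add: nsym.scale_left_distrib)
  also have "\<dots> \<in> V" by (rule nsym.subspace_add[OF assms(1) cd(1,3)])
  finally show ?case using cd by (intro exI[of _ "c + d"]) auto
qed

declare rad_power.simps(2) [simp del]

text \<open>
  A bracket \<open>[Q, \<zeta>\<^sub>d]\<close> of least degree among the nontrivial ones is split off by the word
  \<open>[\<zeta>\<^sub>q, \<zeta>\<^sub>d] \<cdots>\<close> of the radical, where \<open>q > d\<close> is the degree of \<open>Q\<close>. The other terms of the
  product contain \<open>Q\<close>, a nontrivial bracket of smaller degree.
\<close>

lemma pr_in_rad_power_Suc: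
  assumes \<nu>: "\<nu> \<in> partitions_no1 n"
    and prev: "Lprod (Suc (size \<nu>) - k) \<nu> \<subseteq> rad_power (D0 n) k"
    and shorter: "Lprod s \<nu> \<subseteq> rad_power (D0 n) (Suc k)"
    and bs: "list_all valid bs" "mset (concat bs) = \<nu>" "length bs = s" "s + Suc k \<le> size \<nu>"
    and w: "w \<in> set bs" "length w \<ge> 2" "sum_list w = m"
  shows "pr bs \<in> rad_power (D0 n) (Suc k)"
  using bs w
proof (induction m arbitrary: bs w rule: less_induct)
  case (less m bs w)
  let ?V = "rad_power (D0 n) (Suc k)"
  note V = subspace_rad_power[of "Suc k"]
  show ?case
  proof (cases "\<exists>v\<in>set bs. length v \<ge> 2 \<and> sum_list v < m")
    case True
    then show ?thesis using less.IH less.prems(1-4) by blast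
  next
    case min: False
    obtain Q d where wQ: "w = Q @ [d]" "Q \<noteq> []"
      using less.prems(6) by (cases w rule: rev_cases) fastforce+
    obtain as cs0 where bs: "bs = as @ w # cs0" using less.prems(5) by (meson split_list)
    define cs where "cs = as @ cs0"
    have mset_bs: "mset bs = add_mset w (mset cs)" by (simp add: bs cs_def)
    have valid: "valid w" "list_all valid cs" using less.prems(1) by (auto simp: bs cs_def)
    then have Qd: "valid Q" "d \<noteq> 0" "d \<le> hd Q" using wQ by (auto simp: valid_snoc)
    let ?q = "sum_list Q"
    have hd_q: "hd Q \<le> ?q" using wQ(2) by (cases Q) auto
    show ?thesis
    proof (cases "?q = d")
      case True
      \<comment> \<open>The degree of Q is at least its largest letter, which is at least d.
        Equality makes w the trivial bracket of \<zeta> d with itself.\<close>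
      have "Q = [d]"
      proof (cases Q)
        case (Cons a as)
        then have "sum_list as = 0" "a = d" using True Qd(3) hd_q by auto
        moreover have "as = []" using \<open>sum_list as = 0\<close> Qd(1) Cons by (cases as) (auto simp: valid_def)
        ultimately show ?thesis using Cons by simp
      qed (use wQ in simp)
      then have "br w = 0" by (simp add: wQ)
      then show ?thesis by (simp add: bs nsym.subspace_0[OF V])
    next
      case False
      then have dq: "d < ?q" using Qd(3) hd_q by linarith
      have m: "m = ?q + d" using less.prems(7) wQ by simp
      define I where "I = map sum_list cs"
      \<comment> \<open>Q and \<zeta> d become separate factors. There is one more than in
        \<open>bs\<close>, so \<open>prev\<close> places \<open>pr bs0\<close> in the power k, and
        the radical word supplies the missing power.\<close>
      define bs0 where "bs0 = Q # [d] # cs"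
      have valid0: "list_all valid bs0" using valid Qd by (simp add: bs0_def) (simp add: valid_def)
      have len: "length bs0 = Suc s" "length bs0 = Suc (Suc (length I))"
        using less.prems(3) by (simp_all add: bs0_def bs cs_def I_def)
      have content0: "mset (concat bs0) = \<nu>"
        using less.prems(2) by (simp add: bs0_def bs cs_def wQ add_ac)
      have letters: "a \<noteq> 0 \<and> a \<noteq> 1" if "v \<in> set bs0" "a \<in> set v" for a v
      proof -
        have "a \<in># \<nu>" using that content0[symmetric] by auto
        then show ?thesis using \<nu> by (cases "a = 0 \<or> a = 1") (auto simp: partitions_no1_def)
      qed
      have sums: "sum_list v \<noteq> 0 \<and> sum_list v \<noteq> 1" if "v \<in> set bs0" for v
      proof (cases v)
        case Nil
        then show ?thesis using that valid0 by (auto simp: list_all_iff valid_def)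
      next
        case (Cons a as)
        then show ?thesis using letters[OF that, of a] by auto
      qed
      define F where "F = (zeta ?q * zeta d - zeta d * zeta ?q) * zword I"
      define \<kappa> where "\<kappa> = mset (map sum_list bs0)"
      have \<kappa>: "\<kappa> \<in> partitions_no1 n"
      proof -
        have "sum_mset \<kappa> = sum_list (concat bs0)"
          using sum_list_concat_map[of "\<lambda>x. x" bs0] sum_mset_sum_list[of "map sum_list bs0"] by (simp add: \<kappa>_def)
        also have "\<dots> = n"
          using content0 \<nu> sum_mset_sum_list[of "concat bs0"] by (simp add: partitions_no1_def)
        finally have "sum_mset \<kappa> = n" .
        moreover have "a \<noteq> 0 \<and> a \<noteq> 1" if a: "a \<in># \<kappa>" for a
        proof -
          obtain v where "v \<in> set bs0" "a = sum_list v" using a by (auto simp: \<kappa>_def)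
          then show ?thesis using sums[OF \<open>v \<in> set bs0\<close>] by metis
        qed
        ultimately show ?thesis unfolding partitions_no1_def by blast
      qed
      have "F = zword (?q # d # I) - zword (d # ?q # I)"
        by (simp add: F_def left_diff_distrib mult.assoc)
      moreover have "mset (?q # d # I) = \<kappa>" "mset (d # ?q # I) = \<kappa>" by (simp_all add: \<kappa>_def bs0_def I_def)
      ultimately have "F \<in> content_space \<kappa>"
        using zword_content_space nsym.subspace_diff[OF subspace_content_space] by metis
      then have "F \<in> D0c n" by (rule content_space_D0[OF \<kappa>])
      moreover have "charac \<mu> F = 0" for \<mu>
        using abel_commutator[of 1 "zeta ?q" "zeta d" "zword I"] by (simp add: F_def charac_def)
      ultimately have "F \<in> D.N" by (simp add: D.N_def)
      moreover have "pr bs0 \<in> rad_power (D0 n) k"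
        using prev pr_in_Lprod[OF valid0 content0, of "Suc (size \<nu>) - k"] len less.prems(4) by auto
      ultimately have FG: "F \<star> pr bs0 \<in> ?V" by (rule radical_mult_rad_power)
      let ?t = "\<lambda>x y zs. if sum_list x = ?q \<and> sum_list y = d
        then (br x * br y - br y * br x) * (zword I \<star> pr zs) else 0"
      \<comment> \<open>By the minimality of m, a bracket of smaller degree other than Q is a single
        letter.\<close>
      have small: "v = [sum_list v]" if "v \<in> set bs0" "v \<noteq> Q" "sum_list v < m" for v
      proof -
        have "v = [d] \<or> v \<in> set bs" using that by (auto simp: bs0_def bs cs_def)
        then have "length v < 2" using min that(3) by auto
        moreover have "v \<noteq> []" using that(1) valid0 by (auto simp: list_all_iff valid_def)
        ultimately show ?thesis by (cases v) auto
      qed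
      have inner: "\<exists>c :: nat. ?t x y zs - nsym_scale (of_nat c) (pr bs) \<in> ?V \<and> (x = Q \<and> y = [d] \<longrightarrow> c > 0)"
        if xy: "(x, ys) \<in> set (picks bs0)" "(y, zs) \<in> set (picks ys)" for x y ys zs
      proof (cases "sum_list x = ?q \<and> sum_list y = d")
        case False
        then show ?thesis by (intro exI[of _ 0]) (auto simp: nsym.subspace_0[OF V])
      next
        case True
        have mset0: "mset bs0 = add_mset x (add_mset y (mset zs))"
          using picks_mset[OF xy(1)] picks_mset[OF xy(2)] by simp
        have "set bs0 = insert x (insert y (set zs))"
          using mset_eq_setD[of bs0 "x # y # zs"] mset0 by simp
        then have in0: "x \<in> set bs0" "y \<in> set bs0" and zs_sub: "set zs \<subseteq> set bs0" by auto
        have valid_zs: "list_all valid zs" using valid0 zs_sub by (auto simp: list_all_iff)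
        \<comment> \<open>The degree d is too small for Q, so only a single letter is
          possible.\<close>
        have y: "y = [d]" using small[OF in0(2)] True dq m by auto
        have degs: "mset I = mset (map sum_list zs)"
          using arg_cong[OF mset0, of "image_mset sum_list"] True by (simp add: bs0_def I_def)
        have lenI: "length I = length zs" using mset_eq_length[OF degs] by simp
        have "0 \<notin> set I" unfolding I_def by (rule sum_list_valid[OF valid(2)])
        from zword_star_same_length[OF lenI this]
        have "?t x y zs = (\<Sum>es\<leftarrow>arrangements I zs. (br x * br y - br y * br x) * pr es)"
          using True by (simp add: sum_list_const_mult)
        also have "\<dots> = (\<Sum>es\<leftarrow>arrangements I zs. pr ((x @ [d]) # es))"
          using in0(1) valid0 by (auto simp: y br_snoc list_all_iff valid_def)
        finally have t: "?t x y zs = (\<Sum>es\<leftarrow>arrangements I zs. pr ((x @ [d]) # es))" .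
        have arr: "mset es = mset zs" if "es \<in> set (arrangements I zs)" for es
          by (rule mset_arrangements[OF lenI that])
        show ?thesis
        proof (cases "x = Q")
          case xQ: True
          have "mset zs = mset cs" using mset0 by (simp add: xQ y bs0_def)
          then have "pr ((x @ [d]) # es) - pr bs \<in> ?V" if "es \<in> set (arrangements I zs)" for es
          proof -
            have "mset ((x @ [d]) # es) = mset bs"
              using arr[OF that] \<open>mset zs = mset cs\<close> mset_bs by (simp add: xQ wQ)
            from pr_perm[OF this[symmetric] less.prems(1)] have "pr bs - pr ((x @ [d]) # es) \<in> ?V"
              using shorter less.prems(2,3) by auto
            from nsym.subspace_neg[OF V this] show ?thesis by simp
          qed
          from sum_list_mset_diff_in_subspace[OF V this]
          have "?t x y zs - nsym_scale (of_nat (length (arrangements I zs))) (pr bs) \<in> ?V"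
            unfolding t by simp
          moreover have "length (arrangements I zs) > 0"
            using arrangements_nonempty_iff[OF lenI] degs by simp
          ultimately show ?thesis by blast
        next
          case xQ: False
          \<comment> \<open>The letter q has received something other than Q, hence the single
            letter of that degree. So Q is nontrivial and remains among the other factors, and its
            degree is less than m.\<close>
          have x: "x = [?q]" using small[OF in0(1) xQ] True m Qd(2) by auto
          then have Q2: "length Q \<ge> 2"
            using xQ wQ(2) by (cases Q; cases "tl Q") auto
          have "Q \<in> set bs0" by (simp add: bs0_def)
          moreover have "Q \<noteq> [d]" using dq by auto
          ultimately have "Q \<in> set zs" using \<open>set bs0 = _\<close> xQ y by auto
          have "pr ((x @ [d]) # es) \<in> ?V" if es: "es \<in> set (arrangements I zs)" for es
          proof (rule less.IH[where y = ?q and w = Q])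
            show "?q < m" using m Qd(2) by simp
            have set_es: "set es = set zs" using mset_eq_setD[OF arr[OF es]] .
            have "valid [a, d]" if "d < a" for a using that Qd(2) by (auto simp: valid_def)
            then have "valid (x @ [d])" using dq by (simp add: x)
            then show "list_all valid ((x @ [d]) # es)"
              using valid_zs set_es by (simp add: list_all_iff)
            have "mset (concat es) = mset (concat zs)"
              using mset_concat_split[of es "[]" zs] arr[OF es] by simp
            moreover have "mset (concat bs0) = mset x + mset y + mset (concat zs)"
              using mset_concat_split[of "[x, y]" zs bs0] mset0 by simp
            ultimately show "mset (concat ((x @ [d]) # es)) = \<nu>" using content0 y by simp
            show "length ((x @ [d]) # es) = s"
              using mset_eq_length[OF arr[OF es]] lenI len by simp
            show "s + Suc k \<le> size \<nu>" by (rule less.prems(4))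
            show "Q \<in> set ((x @ [d]) # es)" using \<open>Q \<in> set zs\<close> set_es by simp
          qed (use Q2 in auto)
          then have "?t x y zs \<in> ?V"
            unfolding t by (rule sum_list_in_subspace[OF V])
          then show ?thesis using xQ by (intro exI[of _ 0]) auto
        qed
      qed
      have middle: "\<exists>c :: nat. (\<Sum>(y, zs)\<leftarrow>picks ys. ?t x y zs) - nsym_scale (of_nat c) (pr bs) \<in> ?V
          \<and> (x = Q \<longrightarrow> c > 0)" if "(x, ys) \<in> set (picks bs0)" for x ys
      proof -
        have "\<exists>c :: nat. (\<Sum>(y, zs)\<leftarrow>picks ys. ?t x y zs) - nsym_scale (of_nat c) (pr bs) \<in> ?V
            \<and> ((\<exists>p\<in>set (picks ys). x = Q \<and> fst p = [d]) \<longrightarrow> c > 0)"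
          by (rule sum_list_approx[OF V]) (use inner[OF that] in auto)
        moreover have "\<exists>p\<in>set (picks ys). x = Q \<and> fst p = [d]" if "x = Q"
        proof -
          have "mset ys = mset ([d] # cs)" using picks_mset[OF \<open>(x, ys) \<in> _\<close>] that by (simp add: bs0_def)
          then have "[d] \<in> set ys" using mset_eq_setD by fastforce
          from picks_ex[OF this] show ?thesis using that by force
        qed
        ultimately show ?thesis by blast
      qed
      have "\<exists>c :: nat. (\<Sum>(x, ys)\<leftarrow>picks bs0. \<Sum>(y, zs)\<leftarrow>picks ys. ?t x y zs) - nsym_scale (of_nat c) (pr bs) \<in> ?V
          \<and> ((\<exists>p\<in>set (picks bs0). fst p = Q) \<longrightarrow> c > 0)"
        by (rule sum_list_approx[OF V]) (use middle in auto)
      moreover have "\<exists>p\<in>set (picks bs0). fst p = Q" by (simp add: bs0_def)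
      moreover have "F \<star> pr bs0 = (\<Sum>(x, ys)\<leftarrow>picks bs0. \<Sum>(y, zs)\<leftarrow>picks ys. ?t x y zs)"
        unfolding F_def by (rule commutator_star_same_length[OF len(2)]) (use Qd dq in auto)
      ultimately obtain c :: nat where c: "c > 0" "F \<star> pr bs0 - nsym_scale (of_nat c) (pr bs) \<in> ?V" by auto
      from nsym.subspace_diff[OF V FG c(2)] have "nsym_scale (of_nat c) (pr bs) \<in> ?V" by simp
      then show ?thesis by (rule subspace_scale_cancel[OF V]) (use c in simp)
    qed
  qed
qed

text \<open>The lower bound for the powers, by induction on k and, for fixed k, on the number of
  brackets: the inner induction keeps products of fewer brackets available for reordering.\<close>

lemma Lprod_subset_rad_power:
  assumes \<nu>: "\<nu> \<in> partitions_no1 n"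
  shows "Lprod (Suc (size \<nu>) - k) \<nu> \<subseteq> rad_power (D0 n) k"
proof (induction k)
  case 0
  show ?case using Lprod_subset_content_space content_space_D0[OF \<nu>] by auto
next
  case (Suc k)
  have pr: "pr bs \<in> rad_power (D0 n) (Suc k)"
    if "list_all valid bs" "mset (concat bs) = \<nu>" "length bs + Suc k \<le> size \<nu>" for bs
    using that
  proof (induction "length bs" arbitrary: bs rule: less_induct)
    case less
    have "Lprod (length bs) \<nu> \<subseteq> rad_power (D0 n) (Suc k)"
      unfolding Lprod_def by (rule nsym.span_minimal[OF _ subspace_rad_power]) (use less in auto)
    moreover obtain w where "w \<in> set bs" "length w \<ge> 2"
      using nontrivial_bracket[OF less.prems(1)] less.prems by auto
    ultimately show ?case
      using pr_in_rad_power_Suc[OF \<nu> Suc _ less.prems(1,2) refl less.prems(3)] by blast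
  qed
  then show ?case
    unfolding Lprod_def by (intro nsym.span_minimal subspace_rad_power) auto
qed

end

section \<open>Corners\<close>

definition corner_space :: "nat multiset \<Rightarrow> nat multiset \<Rightarrow> nsym set" where
  "corner_space \<mu> \<nu> = (\<lambda>x. e_idem \<mu> \<star> x) ` content_space \<nu>"

lemma e_idem_star_short:
  assumes "x \<in> Lprod (size \<mu>) \<nu>"
  shows "e_idem \<mu> \<star> x = 0"
proof -
  have "e_idem \<mu> \<star> x \<in> {0}"
    using assms unfolding Lprod_def
  proof (rule lin_span[OF _ lin_star_right subspace_zero])
    fix a assume "a \<in> {pr bs | bs. list_all valid bs \<and> mset (concat bs) = \<nu> \<and> length bs < size \<mu>}"
    then obtain bs where "a = pr bs" "length bs < length (sorted_list_of_multiset \<mu>)"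
      by (auto simp flip: size_mset)
    then show "e_idem \<mu> \<star> a \<in> {0}"
      using zword_star_short
      by (simp add: e_idem_conv_m_fact nsym_lin_scale[OF lin_star_left])
  qed
  then show ?thesis by simp
qed

lemma content_space_subset_Lprod:
  assumes "0 \<notin># \<nu>"
  shows "content_space \<nu> \<subseteq> Lprod (Suc (size \<nu>)) \<nu>"
  unfolding content_space_def
proof (rule nsym.span_minimal[OF _ subspace_Lprod], safe)
  fix w assume "\<nu> = mset w"
  then show "zword w \<in> Lprod (Suc (size (mset w))) (mset w)"
    using pr_in_Lprod[OF valid_singletons[of w] refl lessI] assms
    by (simp add: pr_singletons concat_singletons)
qed

lemma e_idem_star_in_Lprod:
  assumes "x \<in> content_space \<nu>" "0 \<notin># \<nu>"
  shows "e_idem \<mu> \<star> x \<in> Lprod (Suc (size \<mu>)) \<nu>"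
  using subsetD[OF content_space_subset_Lprod[OF assms(2)] assms(1)] unfolding Lprod_def[of _ \<nu>]
proof (rule lin_span[OF _ lin_star_right nsym.subspace_span])
  fix a assume "a \<in> {pr bs | bs. list_all valid bs \<and> mset (concat bs) = \<nu> \<and> length bs < Suc (size \<nu>)}"
  then obtain bs where bs: "a = pr bs" "list_all valid bs" "mset (concat bs) = \<nu>" by blast
  have "length (sorted_list_of_multiset \<mu>) = size \<mu>" by (simp flip: size_mset)
  then show "e_idem \<mu> \<star> a \<in> nsym.span {pr bs | bs. list_all valid bs \<and> mset (concat bs) = \<nu> \<and> length bs < Suc (size \<mu>)}"
    using zword_star_in_Lprod[OF bs(2), of "sorted_list_of_multiset \<mu>"] bs(1,3)
    by (simp add: e_idem_conv_m_fact nsym_lin_scale[OF lin_star_left] nsym.subspace_scale[OF subspace_Lprod] flip: Lprod_def)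
qed

text \<open>As long as k is at most \<open>size \<nu> - size \<mu>\<close>, the elements
  \<open>e_idem \<mu> \<star> y\<close> have so few brackets that they already lie in the k-th
  power. For larger k the k-th power maps \<open>e_idem \<nu>\<close> to products of fewer than
  \<open>size \<mu>\<close> brackets, which \<open>e_idem \<mu>\<close> annihilates.\<close>

lemma corner_rad_power:
  assumes \<mu>: "\<mu> \<in> partitions_no1 n" and \<nu>: "\<nu> \<in> partitions_no1 n"
  shows "corner \<mu> (rad_power (D0 n) k) \<nu> = (if k + size \<mu> \<le> size \<nu> then corner_space \<mu> \<nu> else {0})"
proof (cases "k + size \<mu> \<le> size \<nu>")
  case True
  have "e_idem \<mu> \<star> x \<star> e_idem \<nu> \<in> corner_space \<mu> \<nu>" for x
    using star_e_idem_content by (auto simp: corner_space_def star_assoc)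
  moreover have "e_idem \<mu> \<star> y \<in> corner \<mu> (rad_power (D0 n) k) \<nu>" if y: "y \<in> content_space \<nu>" for y
  proof -
    let ?z = "e_idem \<mu> \<star> y"
    have "?z \<in> Lprod (Suc (size \<nu>) - k) \<nu>"
      by (rule subsetD[OF Lprod_mono e_idem_star_in_Lprod[OF y no1_no_zero[OF \<nu>]]]) (use True in simp)
    then have "?z \<in> rad_power (D0 n) k" using Lprod_subset_rad_power[OF \<nu>] by blast
    moreover have "?z \<star> e_idem \<nu> = ?z"
      using content_space_right[OF star_content_space[OF y] no1_parts[OF \<nu>] no1_parts[OF \<nu>]] by simp
    then have "e_idem \<mu> \<star> ?z \<star> e_idem \<nu> = ?z"
      using e_idem_orthogonal[OF no1_parts[OF \<mu>] no1_parts[OF \<mu>]]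
      by (simp add: star_assoc) (simp flip: star_assoc)
    ultimately show ?thesis unfolding corner_def by (metis image_eqI)
  qed
  ultimately show ?thesis using True by (auto simp: corner_def corner_space_def)
next
  case False
  have "e_idem \<mu> \<star> x \<star> e_idem \<nu> = 0" if "x \<in> rad_power (D0 n) k" for x
  proof -
    have "e_idem \<nu> \<in> Lprod (Suc (size \<nu>)) \<nu>"
      using content_space_subset_Lprod[OF no1_no_zero[OF \<nu>]] e_idem_content_space by blast
    from rad_power_star_Lprod[OF that this]
    have "x \<star> e_idem \<nu> \<in> Lprod (size \<mu>) \<nu>"
      by (rule subsetD[OF Lprod_mono, rotated]) (use False in simp)
    then show ?thesis by (simp add: star_assoc e_idem_star_short)
  qed
  moreover have "0 \<in> rad_power (D0 n) k" by (rule nsym.subspace_0[OF subspace_rad_power])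
  ultimately show ?thesis using False by (force simp: corner_def)
qed

section \<open>Dimensions of the corners\<close>

lemma subspace_image:
  fixes f :: "nsym \<Rightarrow> nsym"
  assumes "lin f" "nsym.subspace V"
  shows "nsym.subspace (f ` V)"
  unfolding nsym.subspace_def
proof (intro conjI ballI allI)
  show "0 \<in> f ` V" using nsym.subspace_0[OF assms(2)] lin_0[OF assms(1)] by (metis image_eqI)
next
  fix x y assume "x \<in> f ` V" "y \<in> f ` V"
  then show "x + y \<in> f ` V"
    using nsym.subspace_add[OF assms(2)] lin_add[OF assms(1)] by (auto simp: image_iff) metis
next
  fix c x assume "x \<in> f ` V"
  then show "nsym_scale c x \<in> f ` V"
    using nsym.subspace_scale[OF assms(2)] nsym_lin_scale[OF assms(1)] by (auto simp: image_iff) metis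
qed

lemma subspace_corner_space: "nsym.subspace (corner_space \<mu> \<nu>)"
  unfolding corner_space_def by (rule subspace_image[OF lin_star_right subspace_content_space])

lemma corner_space_finite_span:
  "\<exists>T. finite T \<and> corner_space \<mu> \<nu> \<subseteq> nsym.span T"
proof -
  have "{w. mset w = \<nu>} \<subseteq> {w. set w \<subseteq> set_mset \<nu> \<and> length w = size \<nu>}" by auto
  then have "finite {w. mset w = \<nu>}"
    using finite_lists_length_eq[of "set_mset \<nu>" "size \<nu>"] finite_subset by blast
  then have "finite {zword w | w. mset w = \<nu>}" by simp
  moreover have "corner_space \<mu> \<nu> \<subseteq> content_space \<nu>"
    by (auto simp: corner_space_def star_content_space)
  ultimately show ?thesis unfolding content_space_def by blast
qed

lemma nsym_dim_zero: "nsym.dim {0} = 0"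
  using nsym.dim_eq_card[of "{}" "{0}"] nsym.span_eq_iff[of "{0}"] subspace_zero nsym.independent_empty by simp

lemma dim_corner_space_eq_0_iff: "nsym.dim (corner_space \<mu> \<nu>) = 0 \<longleftrightarrow> corner_space \<mu> \<nu> = {0}"
proof
  assume 0: "nsym.dim (corner_space \<mu> \<nu>) = 0"
  obtain T where T: "finite T" "corner_space \<mu> \<nu> \<subseteq> nsym.span T" using corner_space_finite_span by blast
  obtain B where B: "B \<subseteq> corner_space \<mu> \<nu>" "nsym.independent B" "corner_space \<mu> \<nu> \<subseteq> nsym.span B"
    "card B = nsym.dim (corner_space \<mu> \<nu>)" by (rule nsym.basis_exists)
  have "finite B" using nsym.independent_span_bound[OF T(1) B(2)] B(1) T(2) by blast
  then have "B = {}" using B(4) 0 by simp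
  then show "corner_space \<mu> \<nu> = {0}"
    using B(3) nsym.subspace_0[OF subspace_corner_space] by auto
qed (simp add: nsym_dim_zero)

lemma cartan_eq:
  assumes "\<mu> \<in> partitions_no1 n" "\<nu> \<in> partitions_no1 n" "size \<mu> \<le> size \<nu>"
  shows "cartan n \<nu> \<mu> = nsym.dim (corner_space \<mu> \<nu>)"
  using corner_rad_power[OF assms(1,2), of 0] assms(3) by (simp add: cartan_def)

text \<open>The filtration of a corner is constant up to one step and zero afterwards, so a single
  quotient carries the whole dimension.\<close>

lemma q_cartan_nth:
  assumes \<mu>: "\<mu> \<in> partitions_no1 n" and \<nu>: "\<nu> \<in> partitions_no1 n"
  shows "fps_nth (q_cartan n \<nu> \<mu>) k
    = (if size \<mu> \<le> size \<nu> \<and> k = size \<nu> - size \<mu> then nsym.dim (corner_space \<mu> \<nu>) else 0)"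
proof -
  let ?C = "\<lambda>k. corner \<mu> (rad_power (D0 n) k) \<nu>"
  have sub: "nsym.subspace (?C k)" for k
    unfolding corner_rad_power[OF \<mu> \<nu>] by (simp add: subspace_corner_space subspace_zero)
  have "?C (Suc k) \<subseteq> ?C k"
    unfolding corner_rad_power[OF \<mu> \<nu>] using nsym.subspace_0[OF subspace_corner_space] by auto
  moreover obtain T where "finite T" "?C k \<subseteq> nsym.span T"
    using corner_space_finite_span[of \<mu> \<nu>] nsym.span_zero unfolding corner_rad_power[OF \<mu> \<nu>]
    by (cases "k + size \<mu> \<le> size \<nu>") auto
  ultimately have "quotient_dim (?C k) (?C (Suc k)) = nsym.dim (?C k) - nsym.dim (?C (Suc k))"
    by (intro quotient_dim_eq sub)
  then have "fps_nth (q_cartan n \<nu> \<mu>) k = nsym.dim (?C k) - nsym.dim (?C (Suc k))"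
    by (simp only: q_cartan_def fps_nth_Abs_fps)
  then show ?thesis
    unfolding corner_rad_power[OF \<mu> \<nu>] by (auto simp: nsym_dim_zero)
qed

section \<open>Refinement and arrows\<close>

lemma valid_content_0:
  assumes "list_all valid bs" "sum_list (concat bs) = 0"
  shows "bs = []"
proof (cases bs)
  case (Cons w cs)
  then have "sum_list w = 0" "valid w" using assms by (simp_all del: sum_list_eq_0_iff)
  then show ?thesis using sum_list_valid_pos[of w] by linarith
qed simp

text \<open>A nonzero term gives each letter i brackets of total degree i, and the contents of what
  the letters receive are the blocks of the grouping.\<close>

lemma zword_star_nonzero_finer:
  assumes "list_all valid bs" "zword I \<star> pr bs \<noteq> 0"
  shows "finer (mset (concat bs)) (mset I)"
  using assms
proof (induction I arbitrary: bs)
  case Nil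
  then have "sum_list (concat bs) = 0"
    using S_star_pr[of 0 bs] by (auto simp: S_def split: if_splits)
  then have "bs = []" by (rule valid_content_0[OF Nil.prems(1)])
  then show ?case by (auto simp: finer_def)
next
  case (Cons i I)
  have "\<exists>u v. mset u + mset v = mset bs \<and> (zeta i \<star> pr u) * (zword I \<star> pr v) \<noteq> 0"
  proof (rule ccontr)
    assume "\<not> ?thesis"
    then have "zword (i # I) \<star> pr bs = Usum (\<lambda>u v. 0) bs"
      unfolding zword_simps mult_star_pr by (intro Usum_cong) blast
    then show False using Cons.prems(2) by simp
  qed
  then obtain u v where uv: "mset u + mset v = mset bs" "zeta i \<star> pr u \<noteq> 0" "zword I \<star> pr v \<noteq> 0"
    by (metis mult_zero_left mult_zero_right)
  have i: "sum_list (concat u) = i"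
    using uv(2) star_diff_degree[OF zeta_Sym pr_Sym] by metis
  have "list_all valid v" using Cons.prems(1) list_all_split[OF uv(1)] by blast
  from Cons.IH[OF this uv(3)] obtain P where P: "\<Sum>\<^sub># P = mset (concat v)" "image_mset sum_mset P = mset I"
    by (auto simp: finer_def)
  have "\<Sum>\<^sub># (add_mset (mset (concat u)) P) = mset (concat bs)"
    using P(1) mset_concat_split[OF uv(1)] by simp
  moreover have "image_mset sum_mset (add_mset (mset (concat u)) P) = mset (i # I)"
    using P(2) i sum_mset_sum_list[of "concat u"] by simp
  ultimately show ?case unfolding finer_def by blast
qed

lemma finer_size:
  assumes "finer \<nu> \<mu>" "0 \<notin># \<mu>"
  shows "size \<mu> \<le> size \<nu>"
proof -
  obtain P where P: "\<Sum>\<^sub># P = \<nu>" "image_mset sum_mset P = \<mu>" using assms(1) by (auto simp: finer_def)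
  have "size P \<le> size (\<Sum>\<^sub># P)" if "\<And>B. B \<in># P \<Longrightarrow> B \<noteq> {#}"
    using that
  proof (induction P)
    case (add B P)
    then have "size P \<le> size (\<Sum>\<^sub># P)" "size B \<noteq> 0" by auto
    moreover have "size (\<Sum>\<^sub># (add_mset B P)) = size B + size (\<Sum>\<^sub># P)" "size (add_mset B P) = Suc (size P)"
      by simp_all
    ultimately show ?case by linarith
  qed simp
  moreover have "B \<noteq> {#}" if "B \<in># P" for B
  proof
    assume "B = {#}"
    moreover have "sum_mset B \<in># image_mset sum_mset P" using that by simp
    ultimately have "0 \<in># \<mu>" using P(2) by simp
    then show False using assms(2) P(2) by simp
  qed
  ultimately show ?thesis using P by auto
qed

lemma corner_space_not_finer:
  assumes "\<not> finer \<nu> \<mu>" "0 \<notin># \<nu>"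
  shows "corner_space \<mu> \<nu> = {0}"
proof -
  have "e_idem \<mu> \<star> x = 0" if "x \<in> content_space \<nu>" for x
  proof -
    have "e_idem \<mu> \<star> x \<in> {0}"
      using that unfolding content_space_def
    proof (rule lin_span[OF _ lin_star_right subspace_zero])
      fix a assume "a \<in> {zword w | w. mset w = \<nu>}"
      then obtain w where w: "a = zword w" "mset w = \<nu>" by blast
      then have "list_all valid (map (\<lambda>a. [a]) w)" using assms(2) by (intro valid_singletons) auto
      from zword_star_nonzero_finer[OF this, of "sorted_list_of_multiset \<mu>"]
      have "zword (sorted_list_of_multiset \<mu>) \<star> zword w = 0"
        using assms(1) w(2) by (auto simp: pr_singletons concat_singletons)
      then show "e_idem \<mu> \<star> a \<in> {0}"
        by (simp add: w(1) e_idem_conv_m_fact nsym_lin_scale[OF lin_star_left])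
    qed
    then show ?thesis by simp
  qed
  then show ?thesis
    using nsym.subspace_0[OF subspace_content_space] by (force simp: corner_space_def)
qed

section \<open>Corners whose lengths differ by one\<close>

lemma sum_list_bracket_lengths:
  assumes "list_all valid cs"
  shows "length cs \<le> length (concat cs)"
    and "length (concat cs) = length cs \<Longrightarrow> \<exists>v. cs = map (\<lambda>a. [a]) v"
proof -
  have *: "length cs \<le> length (concat cs)" if "list_all valid cs" for cs
    using that
  proof (induction cs)
    case (Cons w cs)
    then have "length w > 0" "length cs \<le> length (concat cs)" by (simp_all add: valid_def)
    then have "Suc (length cs) \<le> length w + length (concat cs)" by linarith
    then show ?case by simp
  qed simp
  show "length cs \<le> length (concat cs)" by (rule *[OF assms])
  show "\<exists>v. cs = map (\<lambda>a. [a]) v" if "length (concat cs) = length cs"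
    using assms that
  proof (induction cs)
    case (Cons w cs)
    have "length w \<ge> 1" using Cons.prems(1) by (cases w) (auto simp: valid_def)
    moreover have "length cs \<le> length (concat cs)" by (rule *) (use Cons.prems in simp)
    ultimately have "length w = 1" "length (concat cs) = length cs" using Cons.prems(2) by auto
    moreover obtain a where "w = [a]" using \<open>length w = 1\<close> by (cases w) auto
    moreover obtain v where "cs = map (\<lambda>a. [a]) v" using Cons \<open>length (concat cs) = _\<close> by auto
    ultimately have "w # cs = map (\<lambda>a. [a]) (a # v)" by simp
    then show ?case by (rule exI[of _ "a # v"])
  qed simp
qed

text \<open>A nonzero corner needs a product of exactly \<open>size \<mu>\<close> brackets of
  content \<nu>. With one letter more than brackets, exactly one bracket is a pair and the others
  are letters; the pair is distinct, as otherwise the product vanishes.\<close>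

lemma corner_space_nonzero_imp_adds:
  assumes "corner_space \<mu> \<nu> \<noteq> {0}" "0 \<notin># \<nu>" "0 \<notin># \<mu>" "size \<nu> = Suc (size \<mu>)"
  shows "adds_two_distinct_parts \<nu> \<mu>"
proof -
  define I where "I = sorted_list_of_multiset \<mu>"
  have I: "length I = size \<mu>" "mset I = \<mu>" "0 \<notin> set I" using assms(3) by (simp_all add: I_def flip: size_mset)
  have "\<exists>bs. list_all valid bs \<and> mset (concat bs) = \<nu> \<and> length bs < Suc (size \<mu>) \<and> e_idem \<mu> \<star> pr bs \<noteq> 0"
  proof (rule ccontr)
    assume none: "\<not> ?thesis"
    have L: "e_idem \<mu> \<star> x = 0" if "x \<in> Lprod (Suc (size \<mu>)) \<nu>" for x
    proof -
      have "e_idem \<mu> \<star> x \<in> {0}"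
        by (rule lin_span[OF that[unfolded Lprod_def] lin_star_right subspace_zero]) (use none in auto)
      then show ?thesis by simp
    qed
    define k where "k = \<Sum>\<^sub># \<mu>"
    have \<mu>: "\<mu> \<in> parts k k" using assms(3) by (simp add: in_parts_iff k_def)
    have "e_idem \<mu> \<star> x = 0" if "x \<in> content_space \<nu>" for x
    proof -
      \<comment> \<open>One application of the idempotent leaves at most \<open>size \<mu>\<close>
        brackets, and applying it again changes nothing.\<close>
      have "e_idem \<mu> \<star> (e_idem \<mu> \<star> x) = 0"
        by (rule L[OF e_idem_star_in_Lprod[OF that assms(2)]])
      then show ?thesis using e_idem_orthogonal[OF \<mu> \<mu>] by (simp flip: star_assoc)
    qed
    then show False
      using assms(1) nsym.subspace_0[OF subspace_content_space[of \<nu>]] by (auto simp: corner_space_def)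
  qed
  then obtain bs where bs: "list_all valid bs" "mset (concat bs) = \<nu>" "length bs < Suc (size \<mu>)"
    "zword I \<star> pr bs \<noteq> 0"
    by (auto simp: I_def e_idem_conv_m_fact nsym_lin_scale[OF lin_star_left])
  have len: "length I = length bs"
    using zword_star_short[of bs I] bs(3,4) I(1) by linarith
  from zword_star_same_length[OF len I(3)] bs(4) have "arrangements I bs \<noteq> []" by auto
  then have degs: "\<mu> = mset (map sum_list bs)" using arrangements_nonempty_iff[OF len] I(2) by simp
  obtain w where w: "w \<in> set bs" "length w \<ge> 2"
    using nontrivial_bracket[OF bs(1)] bs(2) len I(1) assms(4) by auto
  obtain as cs0 where "bs = as @ w # cs0" using w(1) by (meson split_list)
  define cs where "cs = as @ cs0"
  have cs: "mset bs = add_mset w (mset cs)" "list_all valid cs" "mset (concat bs) = mset w + mset (concat cs)"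
    using bs(1) by (simp_all add: cs_def \<open>bs = as @ w # cs0\<close>)
  have "length bs = Suc (length cs)" using mset_eq_length[of bs "w # cs"] cs(1) by simp
  moreover have "length (concat bs) = length w + length (concat cs)"
    using mset_eq_length[of "concat bs" "w @ concat cs"] cs(3) by simp
  moreover have "length (concat bs) = size \<nu>" using bs(2) by (metis size_mset)
  ultimately have "length w = 2" "length (concat cs) = length cs"
    using sum_list_bracket_lengths(1)[OF cs(2)] w(2) len I(1) assms(4) by linarith+
  obtain a d where ad: "w = [a, d]" using \<open>length w = 2\<close> by (auto simp: numeral_2_eq_2 length_Suc_conv)
  obtain v where v: "cs = map (\<lambda>a. [a]) v"
    using sum_list_bracket_lengths(2)[OF cs(2) \<open>length (concat cs) = _\<close>] by blast
  have "a \<noteq> d"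
  proof
    assume "a = d"
    then have "pr bs = 0" by (simp add: \<open>bs = as @ w # cs0\<close> ad)
    then show False using bs(4) by (simp add: lin_0[OF lin_star_right])
  qed
  moreover have \<nu>: "\<nu> = {#a, d#} + mset v"
    using bs(2) cs(3) by (simp add: ad v concat_singletons)
  moreover have "\<mu> = mset v + {#a + d#}"
  proof -
    have "\<mu> = image_mset sum_list (mset bs)" using degs by simp
    then show ?thesis by (simp add: cs(1) ad v multiset.map_comp comp_def)
  qed
  ultimately show ?thesis
    unfolding adds_two_distinct_parts_def by (intro exI[of _ a] exI[of _ d]) simp
qed

text \<open>
  The number of pairs of positions with \<open>i\<close> before \<open>j\<close>, minus the number of those with \<open>j\<close>
  before \<open>i\<close>. Exchanging adjacent letters \<open>i\<close> and \<open>j\<close> changes it by exactly \<open>2\<close>, so it takes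
  the value \<open>2\<close> on every product of letters and one commutator of \<open>\<zeta>\<^sub>i\<close> and \<open>\<zeta>\<^sub>j\<close>.
\<close>

primrec balance :: "nat \<Rightarrow> nat \<Rightarrow> nat list \<Rightarrow> int" where
  "balance i j [] = 0"
| "balance i j (a # w) = (if a = i then int (count_list w j) else if a = j then - int (count_list w i) else 0)
     + balance i j w"

lemma balance_swap:
  assumes "i \<noteq> j"
  shows "balance i j (u @ i # j # v) - balance i j (u @ j # i # v) = 2"
  using assms by (induction u) (auto simp: count_list_append)

text \<open>A linear functional whose values are stored as scalars \<open>single 0 c\<close>, so
  that \<open>lin\<close> applies to it.\<close>

definition balance_map :: "nat \<Rightarrow> nat \<Rightarrow> nsym \<Rightarrow> nsym" where
  "balance_map i j F = ext (\<lambda>I. single 0 (of_int (balance i j (comp_parts I)))) (of_zeta F)"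

lemma lin_balance_map: "lin (balance_map i j)"
  unfolding balance_map_def by (rule lin_comp[OF lin_ext lin_of_zeta])

lemma balance_map_zword:
  "0 \<notin> set w \<Longrightarrow> balance_map i j (zword w) = single 0 (of_int (balance i j w))"
  by (simp add: balance_map_def of_zeta_zword)

lemma balance_map_commutator:
  assumes "i \<noteq> j" "i \<noteq> 0" "j \<noteq> 0" "0 \<notin> set u" "0 \<notin> set v"
  shows "balance_map i j (zword u * (zeta i * zeta j - zeta j * zeta i) * zword v) = single 0 2"
proof -
  have "zword u * (zeta i * zeta j - zeta j * zeta i) * zword v = zword (u @ i # j # v) - zword (u @ j # i # v)"
    by (simp add: algebra_simps)
  also have "balance_map i j \<dots> = single 0 (of_int (balance i j (u @ i # j # v) - balance i j (u @ j # i # v)))"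
    using assms by (simp add: lin_diff[OF lin_balance_map] balance_map_zword single_diff[symmetric] del: zword_simps single_of_int)
  finally show ?thesis by (simp add: balance_swap[OF assms(1)])
qed

text \<open>The witness is the bracket of i and j times the other letters. Up to a nonzero scalar,
  \<open>e_idem \<mu>\<close> maps it to the sum of its arrangements; each of these has the value 2
  under \<open>balance_map i j\<close>, so they cannot cancel.\<close>

lemma adds_imp_corner_space_nonzero:
  assumes "adds_two_distinct_parts \<nu> \<mu>" "0 \<notin># \<nu>" "0 \<notin># \<mu>"
  shows "corner_space \<mu> \<nu> \<noteq> {0} \<and> size \<nu> = Suc (size \<mu>)"
proof
  obtain i j where ij: "i \<noteq> j" "{#i, j#} \<subseteq># \<nu>" "\<mu> = \<nu> - {#i, j#} + {#i + j#}"
    using assms(1) by (auto simp: adds_two_distinct_parts_def)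
  obtain \<rho> where \<nu>: "\<nu> = {#i, j#} + \<rho>" using ij(2) by (metis subset_mset.le_iff_add)
  then have \<mu>: "\<mu> = add_mset (i + j) \<rho>" using ij(3) by simp
  show "size \<nu> = Suc (size \<mu>)" by (simp add: \<nu> \<mu>)
  define r where "r = sorted_list_of_multiset \<rho>"
  define bs where "bs = [i, j] # map (\<lambda>a. [a]) r"
  define I where "I = sorted_list_of_multiset \<mu>"
  have nz: "i \<noteq> 0" "j \<noteq> 0" "0 \<notin># \<rho>" using assms(2) by (auto simp: \<nu>)
  have I: "mset I = mset (map sum_list bs)" "0 \<notin> set I"
    using assms(3) by (simp_all add: I_def bs_def r_def multiset.map_comp comp_def \<mu> del: sorted_list_of_multiset_insert)
  have len: "length I = length bs" using mset_eq_length[OF I(1)] by simp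
  have arr: "balance_map i j (pr cs) = single 0 2" if "cs \<in> set (arrangements I bs)" for cs
  proof -
    have "mset cs = mset bs" by (rule mset_arrangements[OF len that])
    then have "[i, j] \<in> set cs" using mset_eq_setD[of cs bs] by (simp add: bs_def)
    then obtain c1 c2 where cs: "cs = c1 @ [i, j] # c2" by (meson split_list)
    have "mset (c1 @ c2) = mset (map (\<lambda>a. [a]) r)" using \<open>mset cs = _\<close> by (simp add: cs bs_def)
    from mset_eq_setD[OF this] have set: "set c1 \<union> set c2 = (\<lambda>a. [a]) ` set r" by simp
    have single: "pr c = zword (concat c) \<and> 0 \<notin> set (concat c)" if "set c \<subseteq> (\<lambda>a. [a]) ` set r" for c
      using that nz(3) by (induction c) (auto simp: r_def)
    have c: "pr c1 = zword (concat c1)" "0 \<notin> set (concat c1)" "pr c2 = zword (concat c2)" "0 \<notin> set (concat c2)"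
      using single[of c1] single[of c2] set by auto
    have "pr cs = zword (concat c1) * (zeta i * zeta j - zeta j * zeta i) * zword (concat c2)"
      by (simp add: cs c(1,3) mult.assoc)
    then show ?thesis using balance_map_commutator[OF ij(1) nz(1,2) c(2,4)] by simp
  qed
  have "balance_map i j (sum_list (map pr xs)) = of_nat (length xs) * single 0 2"
    if "\<And>cs. cs \<in> set xs \<Longrightarrow> balance_map i j (pr cs) = single 0 2" for xs
    using that by (induction xs) (simp_all add: lin_0[OF lin_balance_map] lin_add[OF lin_balance_map] distrib_right)
  from this[OF arr] have "balance_map i j (zword I \<star> pr bs) = of_nat (length (arrangements I bs)) * 2"
    unfolding zword_star_same_length[OF len I(2)] by simp
  moreover have "arrangements I bs \<noteq> []" using arrangements_nonempty_iff[OF len] I(1) by simp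
  moreover have "of_nat m * 2 \<noteq> (0 :: nsym)" if "m \<noteq> 0" for m
    using of_nat_eq_0_iff[where 'a = nsym, of "m * 2"] that by (simp del: of_nat_eq_0_iff)
  ultimately have "zword I \<star> pr bs \<noteq> 0" using lin_0[OF lin_balance_map, of i j] by auto
  moreover have "zword I = nsym_scale (m_fact \<mu>) (e_idem \<mu>)" by (simp add: e_idem_conv_m_fact I_def)
  ultimately have "e_idem \<mu> \<star> pr bs \<noteq> 0"
    by (auto simp: nsym_lin_scale[OF lin_star_left])
  moreover have "pr bs \<in> content_space \<nu>"
    using pr_content_space[of bs] by (simp add: bs_def concat_singletons r_def \<nu>)
  ultimately show "corner_space \<mu> \<nu> \<noteq> {0}" by (auto simp: corner_space_def)
qed

theorem theorem2p6:
  fixes n :: nat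
  shows
    "(\<forall>\<nu>\<in>partitions_no1 n. simple_module (D0 n) (top_module (D0 n) (e_idem \<nu>))) \<and>
     (\<forall>\<nu>\<in>partitions_no1 n. \<forall>\<mu>\<in>partitions_no1 n.
        module_iso (D0 n) (top_module (D0 n) (e_idem \<nu>)) (top_module (D0 n) (e_idem \<mu>)) \<longrightarrow> \<nu> = \<mu>) \<and>
     (\<forall>M :: (nsym, 'm) module. simple_module (D0 n) M \<longrightarrow>
        (\<exists>\<nu>\<in>partitions_no1 n. module_iso (D0 n) M (top_module (D0 n) (e_idem \<nu>)))) \<and>
     (\<forall>\<nu>\<in>partitions_no1 n. \<forall>\<mu>\<in>partitions_no1 n.
        arrows n \<nu> \<mu> \<noteq> 0 \<longleftrightarrow> adds_two_distinct_parts \<nu> \<mu>) \<and>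
     (\<forall>\<nu>\<in>partitions_no1 n. \<forall>\<mu>\<in>partitions_no1 n.
        q_cartan n \<nu> \<mu> =
          (if finer \<nu> \<mu> then fps_const (cartan n \<nu> \<mu>) * fps_X ^ (size \<nu> - size \<mu>) else 0))"
proof (intro conjI ballI allI impI)
  interpret D: split_basic_ring "D0 n" "partitions_no1 n" charac "\<lambda>\<nu> c. nsym_scale c (e_idem \<nu>)"
    by (rule D0_split_basic)
  show "simple_module (D0 n) (top_module (D0 n) (e_idem \<nu>))" if "\<nu> \<in> partitions_no1 n" for \<nu>
    using D.simple_top_module[OF that] by simp
  show "\<nu> = \<mu>" if "\<nu> \<in> partitions_no1 n" "\<mu> \<in> partitions_no1 n"
    "module_iso (D0 n) (top_module (D0 n) (e_idem \<nu>)) (top_module (D0 n) (e_idem \<mu>))" for \<nu> \<mu>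
    using D.top_module_iso_imp_eq[OF that(1,2)] that(3) by simp
  show "\<exists>\<nu>\<in>partitions_no1 n. module_iso (D0 n) M (top_module (D0 n) (e_idem \<nu>))"
    if "simple_module (D0 n) M" for M :: "(nsym, 'm) module"
    using D.simple_module_iso_top[OF that] by simp
next
  fix \<nu> \<mu> assume \<nu>: "\<nu> \<in> partitions_no1 n" and \<mu>: "\<mu> \<in> partitions_no1 n"
  have "size \<mu> \<le> size \<nu> \<and> 1 = size \<nu> - size \<mu> \<longleftrightarrow> size \<nu> = Suc (size \<mu>)"
    by linarith
  then have "arrows n \<nu> \<mu> \<noteq> 0 \<longleftrightarrow> size \<nu> = Suc (size \<mu>) \<and> corner_space \<mu> \<nu> \<noteq> {0}"
    unfolding arrows_def q_cartan_nth[OF \<mu> \<nu>] dim_corner_space_eq_0_iff[symmetric] by simp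
  also have "\<dots> \<longleftrightarrow> adds_two_distinct_parts \<nu> \<mu>"
    using corner_space_nonzero_imp_adds adds_imp_corner_space_nonzero no1_no_zero[OF \<nu>] no1_no_zero[OF \<mu>]
    by blast
  finally show "arrows n \<nu> \<mu> \<noteq> 0 \<longleftrightarrow> adds_two_distinct_parts \<nu> \<mu>" .
  show "q_cartan n \<nu> \<mu> = (if finer \<nu> \<mu> then fps_const (cartan n \<nu> \<mu>) * fps_X ^ (size \<nu> - size \<mu>) else 0)"
  proof (cases "finer \<nu> \<mu>")
    case True
    then have "size \<mu> \<le> size \<nu>" by (rule finer_size[OF _ no1_no_zero[OF \<mu>]])
    then show ?thesis
      using True by (intro fps_ext) (simp add: q_cartan_nth[OF \<mu> \<nu>] cartan_eq[OF \<mu> \<nu>])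
  next
    case False
    then show ?thesis
      using corner_space_not_finer[OF False no1_no_zero[OF \<nu>]]
      by (intro fps_ext) (simp add: q_cartan_nth[OF \<mu> \<nu>] nsym_dim_zero)
  qed
qed

end
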